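(* Let $(\mathbf Z_t)_{t\in\mathbb Z}$, $\mathbf Z_t=(Z_{1,t},Z_{2,t})'$, be an i.i.d. sequence of random vectors in $\mathbb R^2$ with mean zero and covariance matrix $\begin{pmatrix}1&\rho\\ \rho&1\end{pmatrix}$, whose common law has a Lebesgue density on $\mathbb R^2$ and is symmetric ($\mathbf Z_t\overset{d}{=}-\mathbf Z_t$). Let $\alpha_{01},\alpha_{02},\alpha_{11},\alpha_{12},\alpha_{22},\beta_{11},\beta_{12},\beta_{22}>0$ be constants and set $$A_{1,t}=\alpha_{11}Z_{1,t-1}^2+\beta_{11},\quad A_{2,t}=\alpha_{12}Z_{2,t-1}^2+\beta_{12},\quad A_{4,t}=\alpha_{22}Z_{2,t-1}^2+\beta_{22}.$$ Write $A_i$ for a generic copy of $A_{i,t}$. Assume there exist $0<\alpha_1<\alpha_2$ such that $$\mathbb E A_1^{\alpha_1}=1,\quad\mathbb E A_1^{\alpha_1}\log^+A_1<\infty,\quad \mathbb E A_4^{\alpha_2}=1,\quad\mathbb E A_4^{\alpha_2}\log^+A_4<\infty.$$ Let $(\sigma_{1,t}^2,\sigma_{2,t}^2)'$ be the strictly stationary causal solution of $$\sigma_{1,t}^2=\alpha_{01}+A_{1,t}\sigma_{1,t-1}^2+A_{2,t}\sigma_{2,t-1}^2,\qquad \sigma_{2,t}^2=\alpha_{02}+A_{4,t}\sigma_{2,t-1}^2,\qquad t\in\mathbb Z,$$ and let $X_{i,t}=\sigma_{i,t}Z_{i,t}$ with $\sigma_{i,t}\ge0$. Then for every $h\ge1$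 and $i=1,2$, the random vector $\mathbf X_{i,h}=(X_{i,1},\dots,X_{i,h})$ is multivariate regularly varying with index $2\alpha_i$, and its spectral measure is the distribution of $$(r_{i,1}\theta_{i,1},\dots,r_{i,h}\theta_{i,h}),$$ where $\boldsymbol\Theta_{i,h}=(\theta_{i,1},\dots,\theta_{i,h})\in\mathbb S^{h-1}$ has distribution $$\mathbb P(\boldsymbol\Theta_{i,h}\in\cdot)=\frac{\mathbb E\big[|\mathbf Y_{i,h}|^{2\alpha_i}\,\mathbf 1(\mathbf Y_{i,h}/|\mathbf Y_{i,h}|\in\cdot)\big]}{\mathbb E|\mathbf Y_{i,h}|^{2\alpha_i}},$$ and $(r_{i,t})_t$ is an i.i.d. sequence with $\mathbb P(r_{i,t}=\pm1)=1/2$, independent of $\boldsymbol\Theta_{i,h}$. Here $$\mathbf Y_{1,h}=\big(|Z_{1,1}|(\Pi_1^{(1)})^{1/2},\dots,|Z_{1,h}|(\Pi_h^{(1)})^{1/2}\big),\quad \mathbf Y_{2,h}=\big(|Z_{2,1}|(\Pi_1^{(4)})^{1/2},\dots,|Z_{2,h}|(\Pi_h^{(4)})^{1/2}\big),$$ with $\Pi_\ell^{(j)}=\prod_{k=1}^\ell A_{j,k}$ for $j=1,4$.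
   Context: The process $\mathbf X_t=(X_{1,t},X_{2,t})'$ is a bivariate constant conditional correlation GARCH(1,1) process with upper triangular coefficient matrices. With $\mathbf A_t=\begin{pmatrix}A_{1,t}&A_{2,t}\\0&A_{4,t}\end{pmatrix}$ and $\mathbf B=(\alpha_{01},\alpha_{02})'$, the strictly stationary causal solution is $(\sigma_{1,t}^2,\sigma_{2,t}^2)'=\sum_{i=-\infty}^t\mathbf A_t\cdots\mathbf A_{i+1}\mathbf B$ (empty product $=$ identity; the series converges a.s. under the hypotheses). $|\cdot|$ is the Euclidean norm, $\mathbb S^{h-1}$ the unit sphere of $\mathbb R^h$, $\log^+x=\max(\log x,0)$. An $\mathbb R^h$-valued random vector $\mathbf X$ is multivariate regularly varying with index $\alpha>0$ if there is a random vector $\boldsymbol\Theta$ on $\mathbb S^{h-1}$ such that for every $u>0$, as $x\to\infty$, $$\frac{\mathbb P(|\mathbf X|>ux,\ \mathbf X/|\mathbf X|\in\cdot)}{\mathbb P(|\mathbf X|>x)}\xrightarrow{v}u^{-\alpha}\,\mathbb P(\boldsymbol\Theta\in\cdot)$$ (vague convergence of measures on the sphere); the law of $\boldsymbol\Theta$ is the spectral measure of $\mathbf X$. *)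

theory Defs
  imports "HOL-Probability.Probability"
begin

definition covariance_matrix :: "'a measure \<Rightarrow> ('a \<Rightarrow> real ^ 'n) \<Rightarrow> real ^ 'n ^ 'n" where
  "covariance_matrix M X =
     (\<chi> i j. \<integral>w. (X w $ i - (\<integral>v. X v $ i \<partial>M)) * (X w $ j - (\<integral>v. X v $ j \<partial>M)) \<partial>M)"

text \<open>Vague convergence of Borel measures on the space S: convergence of the integrals of all
  continuous functions on S with compact support in S. The measures live on the ambient type.\<close>

definition vague_conv_on ::
    "'b::topological_space set \<Rightarrow> ('c \<Rightarrow> 'b measure) \<Rightarrow> 'b measure \<Rightarrow> 'c filter \<Rightarrow> bool" where
  "vague_conv_on S \<mu> \<nu> F \<longleftrightarrow>
     (\<forall>f :: 'b \<Rightarrow> real.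
        continuous_on S f \<longrightarrow> (\<exists>K. compact K \<and> K \<subseteq> S \<and> (\<forall>y \<in> S - K. f y = 0)) \<longrightarrow>
        ((\<lambda>x. LINT y:S|\<mu> x. f y) \<longlongrightarrow> (LINT y:S|\<nu>. f y)) F)"

text \<open>The measure that maps B to P(|X| > ux, X/|X| in B) / P(|X| > x). If P(|X| > x) = 0,
  it is the zero measure.\<close>

definition tail_direction_measure ::
    "'a measure \<Rightarrow> ('a \<Rightarrow> 'b::euclidean_space) \<Rightarrow> real \<Rightarrow> real \<Rightarrow> 'b measure" where
  "tail_direction_measure M X u x =
     scale_measure (ennreal (1 / measure M {w \<in> space M. norm (X w) > x}))
       (distr (density M (indicator {w \<in> space M. norm (X w) > u * x})) borel
         (\<lambda>w. X w /\<^sub>R norm (X w)))"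

text \<open>X is multivariate regularly varying with index a, and its spectral measure (the law
  of the random vector on the unit sphere in the limit) is Q.\<close>

definition mrv_with_spectral_measure ::
    "'a measure \<Rightarrow> ('a \<Rightarrow> 'b::euclidean_space) \<Rightarrow> real \<Rightarrow> 'b measure \<Rightarrow> bool" where
  "mrv_with_spectral_measure M X a Q \<longleftrightarrow>
     X \<in> borel_measurable M \<and> a > 0 \<and>
     prob_space Q \<and> sets Q = sets borel \<and> (AE y in Q. y \<in> sphere 0 1) \<and>
     (\<forall>u > 0. vague_conv_on (sphere 0 1) (tail_direction_measure M X u)
                (scale_measure (ennreal (u powr (- a))) Q) at_top)"

text \<open>The law that maps B to E(|Y|^p 1(Y/|Y| in B)) / E(|Y|^p).\<close>

definition weighted_direction_law ::
    "'a measure \<Rightarrow> ('a \<Rightarrow> 'b::euclidean_space) \<Rightarrow> real \<Rightarrow> 'b measure" where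
  "weighted_direction_law M Y p =
     distr (density M (\<lambda>w. ennreal (norm (Y w) powr p / (\<integral>v. norm (Y v) powr p \<partial>M)))) borel
       (\<lambda>w. Y w /\<^sub>R norm (Y w))"

text \<open>The law of the vector with components r_j theta_j, where theta has law T and the r_j are
  independent uniform signs, independent of theta.\<close>

definition random_sign_law :: "(real ^ 'n) measure \<Rightarrow> (real ^ 'n) measure" where
  "random_sign_law T =
     distr (T \<Otimes>\<^sub>M (\<Pi>\<^sub>M j\<in>UNIV. measure_pmf (pmf_of_set {-1, 1 :: real}))) borel
       (\<lambda>(\<theta>, r). \<chi> j. r j * \<theta> $ j)"

text \<open>The matrix product A t ** A (t - 1) ** ... ** A (t - n + 1) of n factors.\<close>

primrec backward_prod :: "(int \<Rightarrow> real ^ 'n ^ 'n) \<Rightarrow> int \<Rightarrow> nat \<Rightarrow> real ^ 'n ^ 'n" where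
  "backward_prod A t 0 = mat 1"
| "backward_prod A t (Suc n) = A t ** backward_prod A (t - 1) n"

text \<open>The causal solution of S t = B + A t *v S (t - 1): the sum over all integers i up to t of
  A t ** ... ** A (i + 1) *v B, with n = t - i.\<close>

definition causal_solution ::
    "(int \<Rightarrow> real ^ 'n ^ 'n) \<Rightarrow> real ^ 'n \<Rightarrow> int \<Rightarrow> real ^ 'n" where
  "causal_solution A B t = (\<Sum>n. backward_prod A t n *v B)"

lemma causal_solution_recursion:
  fixes A :: "int \<Rightarrow> real ^ 'n ^ 'n" and B :: "real ^ 'n"
  assumes "summable (\<lambda>n. backward_prod A (t - 1) n *v B)"
  shows "causal_solution A B t = B + A t *v causal_solution A B (t - 1)"
proof -
  have bl: "bounded_linear ((*v) (A t))"
    by (rule matrix_vector_mul_bounded_linear)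
  have eq: "(\<lambda>n. backward_prod A t (Suc n) *v B)
      = (\<lambda>n. A t *v (backward_prod A (t - 1) n *v B))"
    by (simp add: matrix_vector_mul_assoc)
  have "summable (\<lambda>n. backward_prod A t (Suc n) *v B)"
    unfolding eq by (rule bounded_linear.summable[OF bl assms])
  then have "summable (\<lambda>n. backward_prod A t n *v B)"
    by (subst (asm) summable_Suc_iff)
  then have "(\<Sum>n. backward_prod A t (Suc n) *v B) = causal_solution A B t - B"
    unfolding causal_solution_def using suminf_split_head by fastforce
  moreover have "(\<Sum>n. backward_prod A t (Suc n) *v B) = A t *v causal_solution A B (t - 1)"
    unfolding eq causal_solution_def by (rule bounded_linear.suminf[OF bl assms, symmetric])
  ultimately show ?thesis
    by (simp add: algebra_simps)
qed

end

theory Submission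
  imports Defs
begin

text \<open>
  Each squared volatility solves R_t = A_t R_(t-1) + B_t with A_t independent of R_(t-1), where
  E A^\<alpha> = 1 and B_t has a moment of order larger than \<alpha>; for the first coordinate this holds because
  B_t is driven by the second one, whose tail index \<alpha>2 exceeds \<alpha>1. Under the exponential change
  of variables f(x) = e^(\<alpha>x) P(R > e^x) this becomes a renewal equation f = g + T f on the line, with
  g \<ge> 0 integrable, for the law of log A tilted by A^\<alpha>. The renewal theorem is proved directly for this
  f. An explicit supersolution bounds f. A telescoping variance argument shows that a smoothed f is
  asymptotically invariant under the steps, hence under all shifts since the step law has no atoms.
  Integrating the equation up to x identifies the limit as the integral of g over the mean step; it
  is positive because B is.

  The vector (X_1, ..., X_h) is R_0^(1/2) V up to an error with a finite moment of order 2\<alpha>, where V depends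
  only on Z_0, ..., Z_h and so is independent of R_0. Breiman's lemma gives the limit in terms of the law of
  V, and since V is a function of the signs and of even functions of the innovations, independent
  uniform signs can be factored out.
\<close>

section \<open>A renewal theorem on the line\<close>

text \<open>Integrability of the forcing term g alone neither makes it vanish at infinity nor makes
  it directly Riemann integrable. The argument therefore works with integrals over a window of width
  \<delta>; the window is removed at the end because exp (- \<alpha> x) f x is a tail probability,
  hence decreasing in x. Boundedness of f cannot be read off the equation, since constants solve h =
  T h. It comes from E A^r < 1 for r < \<alpha>: under the tilted law \<open>T\<close> multiplies
  exp (s x), with s = \<alpha> - r, by a factor below 1, and domination by this exponential at the
  left end excludes homogeneous parts. The lower bound \<beta> > 0 on A keeps log A bounded below,
  so that the moment with the positive part of the logarithm already gives the tilted step a finite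
  mean. The second obstacle is that R^\<alpha> has an infinite mean, while the integral of g is the
  mean of R^\<alpha> - (A R')^\<alpha> up to a factor. This difference is of lower order than
  R^\<alpha>, which is where the gap between the moments of R and of the additive term is
  spent.\<close>

lemma abs_sq_le: "\<bar>a\<bar> \<le> c \<Longrightarrow> a\<^sup>2 \<le> c\<^sup>2" for a c :: real
  by (metis abs_ge_zero power2_abs power_mono)

lemma abs_add_le: "\<bar>a\<bar> \<le> s \<Longrightarrow> \<bar>b\<bar> \<le> t \<Longrightarrow> \<bar>a + b\<bar> \<le> s + t" for a b s t :: real
  by linarith

section \<open>Convolution with a step law and mean squared increments\<close>

locale real_step = prob_space \<eta> for \<eta> :: "real measure" +
  assumes sets_step [measurable_cong]: "sets \<eta> = sets borel"
begin

lemma space_step [simp]: "space \<eta> = UNIV"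
  using sets_eq_imp_space_eq[OF sets_step] by simp

lemma prob_UNIV [simp]: "prob UNIV = 1"
  using prob_space by simp

definition T :: "(real \<Rightarrow> real) \<Rightarrow> real \<Rightarrow> real" where
  "T h x = (\<integral>u. h (x - u) \<partial>\<eta>)"

text \<open>Up to a factor two, the carre du champ of the operator \<open>T\<close>: expanding the
  square gives T (h^2) - 2 h T h + h^2. It is small where h is nearly invariant under typical
  steps.\<close>

definition D :: "(real \<Rightarrow> real) \<Rightarrow> real \<Rightarrow> real" where
  "D h x = (\<integral>u. (h (x - u) - h x)\<^sup>2 \<partial>\<eta>)"

lemma measurable_T [measurable (raw)]:
  assumes [measurable]: "h \<in> borel_measurable borel"
  shows "T h \<in> borel_measurable borel"
  unfolding T_def by measurable

lemma measurable_D [measurable (raw)]: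
  assumes [measurable]: "h \<in> borel_measurable borel"
  shows "D h \<in> borel_measurable borel"
  unfolding D_def by measurable

lemma integrable_bounded:
  fixes h :: "real \<Rightarrow> real" and C :: real
  assumes [measurable]: "h \<in> borel_measurable borel" and "\<And>x. \<bar>h x\<bar> \<le> C"
  shows "integrable \<eta> h"
  by (rule integrable_const_bound[of _ C]) (use assms in auto)

lemma T_bounded:
  assumes [measurable]: "h \<in> borel_measurable borel" and b: "\<And>x. \<bar>h x\<bar> \<le> C"
  shows "\<bar>T h x\<bar> \<le> C"
proof -
  have "\<bar>T h x\<bar> \<le> (\<integral>u. \<bar>h (x - u)\<bar> \<partial>\<eta>)"
    unfolding T_def by (rule integral_abs_bound)
  also have "\<dots> \<le> (\<integral>u. C \<partial>\<eta>)"
    by (rule integral_mono) (auto intro!: integrable_bounded[of _ C] simp: b)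
  finally show ?thesis by (simp add: prob_space)
qed

lemma T_mono:
  assumes [measurable]: "h \<in> borel_measurable borel" "k \<in> borel_measurable borel"
    and "\<And>x. \<bar>h x\<bar> \<le> C" "\<And>x. \<bar>k x\<bar> \<le> C'" "\<And>x. h x \<le> k x"
  shows "T h x \<le> T k x"
  unfolding T_def
proof (rule integral_mono)
  show "integrable \<eta> (\<lambda>u. h (x - u))" by (rule integrable_bounded[of _ C]) (use assms in auto)
  show "integrable \<eta> (\<lambda>u. k (x - u))" by (rule integrable_bounded[of _ C']) (use assms in auto)
qed (rule assms)

lemma T_nonneg: "(\<And>x. 0 \<le> h x) \<Longrightarrow> 0 \<le> T h x"
  unfolding T_def by (simp add: integral_nonneg_AE)

lemma T_tendsto_0:
  fixes h :: "real \<Rightarrow> real" and C :: real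
  assumes [measurable]: "h \<in> borel_measurable borel" and b: "\<And>x. \<bar>h x\<bar> \<le> C"
    and lim: "(h \<longlongrightarrow> 0) at_top"
  shows "(T h \<longlongrightarrow> 0) at_top"
proof -
  have "((\<lambda>x. \<integral>u. h (x - u) \<partial>\<eta>) \<longlongrightarrow> (\<integral>u. 0 \<partial>\<eta>)) at_top"
  proof (rule integral_dominated_convergence_at_top[where w = "\<lambda>_. C"])
    show "AE u in \<eta>. ((\<lambda>x. h (x - u)) \<longlongrightarrow> 0) at_top"
    proof (intro AE_I2)
      fix u :: real
      have "filterlim (\<lambda>x. x - u) at_top at_top"
        using filterlim_tendsto_add_at_top[OF tendsto_const[of "-u"] filterlim_ident] by simp
      then show "((\<lambda>x. h (x - u)) \<longlongrightarrow> 0) at_top"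
        by (rule filterlim_compose[OF lim])
    qed
  qed (use b in auto)
  then show ?thesis by (simp add: T_def[abs_def])
qed

lemma jensen_square:
  fixes h :: "real \<Rightarrow> real" and C :: real
  assumes [measurable]: "h \<in> borel_measurable borel" and b: "\<And>x. \<bar>h x\<bar> \<le> C"
  shows "(\<integral>u. h u \<partial>\<eta>)\<^sup>2 \<le> (\<integral>u. (h u)\<^sup>2 \<partial>\<eta>)"
proof -
  define c where "c = (\<integral>u. h u \<partial>\<eta>)"
  have C: "0 \<le> C" using b[of 0] by linarith
  have i1: "integrable \<eta> h" by (rule integrable_bounded[of _ C]) (use b in auto)
  have i2: "integrable \<eta> (\<lambda>u. (h u)\<^sup>2)"
    by (rule integrable_bounded[of _ "C\<^sup>2"]) (use b in \<open>auto simp: abs_le_square_iff[symmetric] C\<close>)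
  have "0 \<le> (\<integral>u. (h u - c)\<^sup>2 \<partial>\<eta>)" by simp
  also have "\<dots> = (\<integral>u. (h u)\<^sup>2 - 2 * c * h u + c\<^sup>2 \<partial>\<eta>)"
    by (simp add: power2_diff algebra_simps)
  also have "\<dots> = (\<integral>u. (h u)\<^sup>2 \<partial>\<eta>) - 2 * c * c + c\<^sup>2"
    using i1 i2 by (simp add: c_def prob_space)
  finally show ?thesis by (simp add: c_def power2_eq_square)
qed

text \<open>Jensen's inequality after exchanging the order of two independent steps.\<close>

lemma D_T_le:
  assumes [measurable]: "h \<in> borel_measurable borel" and b: "\<And>x. \<bar>h x\<bar> \<le> C"
  shows "D (T h) x \<le> T (D h) x"
proof -
  have C: "0 \<le> C" using b[of 0] by linarith
  have b2: "\<bar>h y - h z\<bar> \<le> 2 * C" for y z using b[of y] b[of z] by linarith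
  have b3: "(h y - h z)\<^sup>2 \<le> 4 * C\<^sup>2" for y z
    using power_mono[OF b2[of y z], of 2] C by (simp add: power_mult_distrib)
  have i: "integrable \<eta> (\<lambda>v. h (a - v))" for a
    by (rule integrable_bounded[of _ C]) (auto simp: b)
  interpret P: pair_sigma_finite \<eta> \<eta> ..
  interpret PP: prob_space "\<eta> \<Otimes>\<^sub>M \<eta>" by (rule prob_space_pair) unfold_locales
  have int2: "integrable (\<eta> \<Otimes>\<^sub>M \<eta>) (\<lambda>(u, v). (h (x - u - v) - h (x - v))\<^sup>2)"
    by (rule PP.integrable_const_bound[of _ "4 * C\<^sup>2"]) (auto simp: b3)
  have "D (T h) x = (\<integral>u. (\<integral>v. h (x - u - v) - h (x - v) \<partial>\<eta>)\<^sup>2 \<partial>\<eta>)"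
    unfolding D_def T_def by (subst Bochner_Integration.integral_diff) (auto intro: i)
  also have "\<dots> \<le> (\<integral>u. (\<integral>v. (h (x - u - v) - h (x - v))\<^sup>2 \<partial>\<eta>) \<partial>\<eta>)"
  proof (rule integral_mono)
    have j: "\<bar>\<integral>v. h (x - u - v) - h (x - v) \<partial>\<eta>\<bar> \<le> 2 * C" for u
    proof -
      have "\<bar>\<integral>v. h (x - u - v) - h (x - v) \<partial>\<eta>\<bar> \<le> (\<integral>v. \<bar>h (x - u - v) - h (x - v)\<bar> \<partial>\<eta>)"
        by (rule integral_abs_bound)
      also have "\<dots> \<le> (\<integral>v. 2 * C \<partial>\<eta>)"
        by (rule integral_mono) (auto intro!: integrable_bounded[of _ "2*C"] simp: b2)
      finally show ?thesis by (simp add: prob_space)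
    qed
    show "integrable \<eta> (\<lambda>u. (\<integral>v. h (x - u - v) - h (x - v) \<partial>\<eta>)\<^sup>2)"
      by (rule integrable_bounded[of _ "(2*C)\<^sup>2"], measurable, unfold abs_power2, rule abs_sq_le[OF j])
    show "integrable \<eta> (\<lambda>u. \<integral>v. (h (x - u - v) - h (x - v))\<^sup>2 \<partial>\<eta>)"
      using P.integrable_fst'[OF int2] by simp
    show "(\<integral>v. h (x - u - v) - h (x - v) \<partial>\<eta>)\<^sup>2
      \<le> (\<integral>v. (h (x - u - v) - h (x - v))\<^sup>2 \<partial>\<eta>)" for u
      by (rule jensen_square[of _ "2*C"]) (auto simp: b2)
  qed
  also have "\<dots> = (\<integral>v. (\<integral>u. (h (x - u - v) - h (x - v))\<^sup>2 \<partial>\<eta>) \<partial>\<eta>)"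
    using P.Fubini_integral[of "\<lambda>u v. (h (x - u - v) - h (x - v))\<^sup>2"] int2 by simp
  also have "\<dots> = T (D h) x"
    unfolding D_def T_def by (simp add: algebra_simps)
  finally show ?thesis .
qed

lemma D_bounded:
  assumes [measurable]: "h \<in> borel_measurable borel" and b: "\<And>x. \<bar>h x\<bar> \<le> C"
  shows "0 \<le> D h x" "D h x \<le> 4 * C\<^sup>2"
proof -
  have C: "0 \<le> C" using b[of 0] by linarith
  have b2: "\<bar>h y - h z\<bar> \<le> 2 * C" for y z using b[of y] b[of z] by linarith
  have b3: "(h y - h z)\<^sup>2 \<le> 4 * C\<^sup>2" for y z
    using power_mono[OF b2[of y z], of 2] C by (simp add: power_mult_distrib)
  show "0 \<le> D h x" by (simp add: D_def)
  have "D h x \<le> (\<integral>u. 4 * C\<^sup>2 \<partial>\<eta>)"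
    unfolding D_def by (rule integral_mono) (auto intro!: integrable_bounded[of _ "4 * C\<^sup>2"] simp: b3)
  then show "D h x \<le> 4 * C\<^sup>2" by (simp add: prob_space)
qed

text \<open>The perturbation k enters only through its squares. It is applied with k = f - T^n f,
  which vanishes at infinity, to pass from \<open>D\<close> of the iterate back to \<open>D\<close>
  of f.\<close>

lemma D_add_le:
  assumes [measurable]: "h \<in> borel_measurable borel" "k \<in> borel_measurable borel"
    and b: "\<And>x. \<bar>h x\<bar> \<le> C" "\<And>x. \<bar>k x\<bar> \<le> C"
  shows "D (\<lambda>x. h x + k x) x \<le> 2 * D h x + 4 * T (\<lambda>x. (k x)\<^sup>2) x + 4 * (k x)\<^sup>2"
proof -
  have C: "0 \<le> C" using b(1)[of 0] by linarith
  have b2: "\<bar>h y - h z\<bar> \<le> 2 * C" for y z using b(1)[of y] b(1)[of z] by linarith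
  have b3: "(h y - h z)\<^sup>2 \<le> 4 * C\<^sup>2" for y z
    using power_mono[OF b2[of y z], of 2] C by (simp add: power_mult_distrib)
  have b4: "(k y)\<^sup>2 \<le> C\<^sup>2" for y using power_mono[OF b(2), of y 2] by simp
  have b5: "\<bar>(h y + k y) - (h z + k z)\<bar> \<le> 4 * C" for y z
    using b(1)[of y] b(1)[of z] b(2)[of y] b(2)[of z] by linarith
  have b6: "((h y + k y) - (h z + k z))\<^sup>2 \<le> 16 * C\<^sup>2" for y z
    using power_mono[OF b5[of y z], of 2] C by (simp add: power_mult_distrib)
  have i1: "integrable \<eta> (\<lambda>u. (h (x - u) - h x)\<^sup>2)"
    by (rule integrable_bounded[of _ "4*C\<^sup>2"]) (auto simp: b3)
  have i2: "integrable \<eta> (\<lambda>u. (k (x - u))\<^sup>2)"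
    by (rule integrable_bounded[of _ "C\<^sup>2"]) (auto simp: b4)
  have "D (\<lambda>x. h x + k x) x
      \<le> (\<integral>u. 2 * (h (x - u) - h x)\<^sup>2 + 4 * (k (x - u))\<^sup>2 + 4 * (k x)\<^sup>2 \<partial>\<eta>)"
    unfolding D_def
  proof (rule integral_mono)
    show "integrable \<eta> (\<lambda>u. (h (x - u) + k (x - u) - (h x + k x))\<^sup>2)"
      by (rule integrable_bounded[of _ "16*C\<^sup>2"]) (auto simp: b6)
    show "integrable \<eta> (\<lambda>u. 2 * (h (x - u) - h x)\<^sup>2 + 4 * (k (x - u))\<^sup>2 + 4 * (k x)\<^sup>2)"
      using i1 i2 by simp
    have "(p + q - (r + s))\<^sup>2 \<le> 2 * (p - r)\<^sup>2 + 4 * q\<^sup>2 + 4 * s\<^sup>2" for p q r s :: real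
    proof -
      have "2 * (p - r)\<^sup>2 + 4 * q\<^sup>2 + 4 * s\<^sup>2 - (p + q - (r + s))\<^sup>2
        = ((p - r) - (q - s))\<^sup>2 + 2 * (q + s)\<^sup>2" by (simp add: power2_eq_square algebra_simps)
      moreover have "0 \<le> ((p - r) - (q - s))\<^sup>2 + 2 * (q + s)\<^sup>2" by simp
      ultimately show ?thesis by (metis diff_ge_0_iff_ge)
    qed
    then show "(h (x - u) + k (x - u) - (h x + k x))\<^sup>2
      \<le> 2 * (h (x - u) - h x)\<^sup>2 + 4 * (k (x - u))\<^sup>2 + 4 * (k x)\<^sup>2" for u by blast
  qed
  also have "\<dots> = 2 * D h x + 4 * T (\<lambda>x. (k x)\<^sup>2) x + 4 * (k x)\<^sup>2"
    using i1 i2 by (simp add: D_def T_def prob_space)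
  finally show ?thesis .
qed

text \<open>The renewal equation replaces T f by f - g in the expanded square. What remains is T
  (f^2) - f^2, which telescopes under powers of \<open>T\<close>, and a term of the size of
  g.\<close>

lemma D_eq:
  assumes [measurable]: "f \<in> borel_measurable borel" and b: "\<And>x. \<bar>f x\<bar> \<le> C"
    and eq: "\<And>x. f x = g x + T f x"
  shows "D f x = T (\<lambda>x. (f x)\<^sup>2) x - (f x)\<^sup>2 + 2 * f x * g x"
proof -
  have b4: "(f y)\<^sup>2 \<le> C\<^sup>2" for y using power_mono[OF b, of y 2] by simp
  have i1: "integrable \<eta> (\<lambda>u. f (x - u))"
    by (rule integrable_bounded[of _ "C"]) (auto simp: b)
  have i2: "integrable \<eta> (\<lambda>u. (f (x - u))\<^sup>2)"
    by (rule integrable_bounded[of _ "C\<^sup>2"]) (auto simp: b4)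
  have "D f x = (\<integral>u. (f (x - u))\<^sup>2 - 2 * f x * f (x - u) + (f x)\<^sup>2 \<partial>\<eta>)"
    unfolding D_def by (simp add: power2_diff algebra_simps)
  also have "\<dots> = T (\<lambda>x. (f x)\<^sup>2) x - 2 * f x * T f x + (f x)\<^sup>2"
    using i1 i2 by (simp add: T_def prob_space)
  also have "T f x = f x - g x" using eq[of x] by simp
  finally show ?thesis by (simp add: power2_eq_square algebra_simps)
qed

lemma T_add:
  assumes [measurable]: "h \<in> borel_measurable borel" "k \<in> borel_measurable borel"
    and "\<And>x. \<bar>h x\<bar> \<le> C" "\<And>x. \<bar>k x\<bar> \<le> C'"
  shows "T (\<lambda>x. a * h x + b * k x) x = a * T h x + b * T k x"
proof -
  have "integrable \<eta> (\<lambda>u. h (x - u))" by (rule integrable_bounded[of _ C]) (use assms in auto)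
  moreover have "integrable \<eta> (\<lambda>u. k (x - u))"
    by (rule integrable_bounded[of _ C']) (use assms in auto)
  ultimately show ?thesis by (simp add: T_def)
qed

lemma measurable_T_funpow [measurable (raw)]:
  assumes [measurable]: "h \<in> borel_measurable borel"
  shows "(T ^^ n) h \<in> borel_measurable borel"
  by (induction n) (auto intro: measurable_T)

lemma T_funpow_bounded:
  assumes [measurable]: "h \<in> borel_measurable borel" and "\<And>x. \<bar>h x\<bar> \<le> C"
  shows "\<bar>(T ^^ n) h x\<bar> \<le> C"
  by (induction n arbitrary: x) (auto intro!: T_bounded assms(2))

lemma T_funpow_tendsto_0:
  assumes [measurable]: "h \<in> borel_measurable borel" and b: "\<And>x. \<bar>h x\<bar> \<le> C"
    and lim: "(h \<longlongrightarrow> 0) at_top"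
  shows "((T ^^ n) h \<longlongrightarrow> 0) at_top"
proof (induction n)
  case (Suc n)
  then show ?case
    using T_tendsto_0[of "(T ^^ n) h" C] T_funpow_bounded[OF assms(1) b] by auto
qed (use lim in simp)

lemma D_funpow_le:
  assumes [measurable]: "f \<in> borel_measurable borel" and b: "\<And>x. \<bar>f x\<bar> \<le> C"
  shows "D ((T ^^ n) f) x \<le> (T ^^ n) (D f) x"
proof (induction n arbitrary: x)
  case (Suc n)
  have C: "0 \<le> C" using b[of 0] by linarith
  have bn: "\<bar>(T ^^ n) f x\<bar> \<le> C" for x by (rule T_funpow_bounded) (auto simp: b)
  have Db: "\<bar>D f x\<bar> \<le> 4 * C\<^sup>2" for x using D_bounded[OF assms(1) b, of x] by auto
  have "D (T ((T ^^ n) f)) x \<le> T (D ((T ^^ n) f)) x"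
    by (rule D_T_le[of _ C]) (auto simp: bn)
  also have "\<dots> \<le> T ((T ^^ n) (D f)) x"
  proof (rule T_mono)
    show "\<bar>D ((T ^^ n) f) x\<bar> \<le> 4 * C\<^sup>2" for x
      using D_bounded[of "(T ^^ n) f" C x] bn by auto
    show "\<bar>(T ^^ n) (D f) x\<bar> \<le> 4 * C\<^sup>2" for x
      by (rule T_funpow_bounded) (auto simp: Db)
  qed (auto intro: Suc)
  finally show ?case by simp
qed simp

text \<open>Positivity and linearity of \<open>T\<close> propagate the identity for
  \<open>D f\<close> through the powers; bounding f by C beforehand is what leaves only iterates of
  g.\<close>

lemma T_funpow_D_le:
  assumes [measurable]: "f \<in> borel_measurable borel" "g \<in> borel_measurable borel"
    and b: "\<And>x. 0 \<le> f x" "\<And>x. f x \<le> C" and g: "\<And>x. 0 \<le> g x" "\<And>x. g x \<le> C"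
    and eq: "\<And>x. f x = g x + T f x"
  shows "(T ^^ n) (D f) x
    \<le> (T ^^ Suc n) (\<lambda>x. (f x)\<^sup>2) x - (T ^^ n) (\<lambda>x. (f x)\<^sup>2) x + 2 * C * (T ^^ n) g x"
proof (induction n arbitrary: x)
  have fb: "\<bar>f x\<bar> \<le> C" for x using b[of x] by auto
  have C: "0 \<le> C" using fb[of 0] by linarith
  {
    case 0
    have "2 * f x * g x \<le> 2 * C * g x"
      using b[of x] g[of x] by (intro mult_right_mono) auto
    then show ?case using D_eq[OF assms(1) fb eq, of x] by simp
  next
    case (Suc n)
    have sq: "\<bar>(f x)\<^sup>2\<bar> \<le> C\<^sup>2" for x using power_mono[OF fb, of x 2] by simp
    have gb: "\<bar>g x\<bar> \<le> C" for x using g[of x] by auto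
    have Db: "\<bar>D f x\<bar> \<le> 4 * C\<^sup>2" for x using D_bounded[OF assms(1) fb, of x] by auto
    let ?q = "\<lambda>x. (f x)\<^sup>2"
    have m: "?q \<in> borel_measurable borel" by measurable
    have bq: "\<bar>(T ^^ n) ?q x\<bar> \<le> C\<^sup>2" for n x
      by (rule T_funpow_bounded) (use sq in auto)
    have bg: "\<bar>(T ^^ n) g x\<bar> \<le> C" for n x
      by (rule T_funpow_bounded) (auto simp: gb)
    have bq2: "\<bar>1 * (T ^^ Suc n) ?q x + (-1) * (T ^^ n) ?q x\<bar> \<le> 2 * C\<^sup>2" for x
      using bq[of "Suc n" x] bq[of n x] by linarith
    have bg2: "\<bar>2 * C * (T ^^ n) g x\<bar> \<le> 2 * C * C" for x
      using bg[of n x] C by (simp add: abs_mult mult_left_mono)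
    have mm: "(T ^^ n) ?q \<in> borel_measurable borel" "(T ^^ Suc n) ?q \<in> borel_measurable borel"
      "(T ^^ n) g \<in> borel_measurable borel" "(T ^^ n) (D f) \<in> borel_measurable borel"
      by (auto intro!: measurable_T_funpow measurable_T)
    \<comment> \<open>The factors 1 and -1 bring the majorant into the linear form a h + b k of
      \<open>T_add\<close>.\<close>
    have "T ((T ^^ n) (D f)) x \<le> T (\<lambda>x. 1 * (1 * (T ^^ Suc n) ?q x + (-1) * (T ^^ n) ?q x)
        + (2 * C) * (T ^^ n) g x) x"
    proof (rule T_mono[where C = "4 * C\<^sup>2" and C' = "2 * C\<^sup>2 + 2 * C * C"])
      show "(\<lambda>x. 1 * (1 * (T ^^ Suc n) ?q x + (-1) * (T ^^ n) ?q x) + (2 * C) * (T ^^ n) g x)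
          \<in> borel_measurable borel"
        using mm by simp
      show "\<bar>(T ^^ n) (D f) x\<bar> \<le> 4 * C\<^sup>2" for x
        by (rule T_funpow_bounded) (auto simp: Db)
      show "\<bar>1 * (1 * (T ^^ Suc n) ?q x + (-1) * (T ^^ n) ?q x)
        + (2 * C) * (T ^^ n) g x\<bar> \<le> 2 * C\<^sup>2 + 2 * C * C" for x
        by (rule abs_add_le[OF _ bg2], subst mult_1, rule bq2)
      show "(T ^^ n) (D f) x \<le> 1 * (1 * (T ^^ Suc n) ?q x + (-1) * (T ^^ n) ?q x)
        + (2 * C) * (T ^^ n) g x" for x
        using Suc[of x] by simp
    qed (use mm in auto)
    also have "\<dots> = 1 * (T (\<lambda>x. 1 * (T ^^ Suc n) ?q x + (-1) * (T ^^ n) ?q x) x)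
        + (2 * C) * T ((T ^^ n) g) x"
      by (rule T_add[where C = "2 * C\<^sup>2" and C' = C]) (use mm bq2 bg in auto)
    also have "T (\<lambda>x. 1 * (T ^^ Suc n) ?q x + (-1) * (T ^^ n) ?q x) x
      = 1 * T ((T ^^ Suc n) ?q) x + (-1) * T ((T ^^ n) ?q) x"
      by (rule T_add[where C = "C\<^sup>2" and C' = "C\<^sup>2"]) (use mm bq in \<open>auto simp del: funpow.simps\<close>)
    finally show ?case by simp
  }
qed

text \<open>Summing the bounds for T^n (D f) over n < N telescopes to a bound independent of N, whereas each
  summand dominates D (T^n f), which is D f up to a term vanishing at infinity.\<close>

lemma D_tendsto_0:
  assumes [measurable]: "f \<in> borel_measurable borel" "g \<in> borel_measurable borel"
    and b: "\<And>x. 0 \<le> f x" "\<And>x. f x \<le> C" and g: "\<And>x. 0 \<le> g x"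
    and eq: "\<And>x. f x = g x + T f x" and lim: "(g \<longlongrightarrow> 0) at_top"
  shows "(D f \<longlongrightarrow> 0) at_top"
proof -
  have fb: "\<bar>f x\<bar> \<le> C" for x using b[of x] by auto
  have C: "0 \<le> C" using fb[of 0] by linarith
  have g': "g x \<le> C" for x using eq[of x] b[of x] T_nonneg[of f x] b(1) by auto
  have gb: "\<bar>g x\<bar> \<le> C" for x using g'[of x] g[of x] by auto
  \<comment> \<open>By the equation, e (n + 1) = g + T (e n), so e n is the sum of the first n
    iterates of g and dies out at infinity for fixed n.\<close>
  define e where "e n x = f x - (T ^^ n) f x" for n x
  have m: "(T ^^ n) f \<in> borel_measurable borel" "e n \<in> borel_measurable borel" for n
    by (auto intro!: measurable_T_funpow simp: e_def[abs_def])
  have Tb: "\<bar>(T ^^ n) f x\<bar> \<le> C" for n x by (rule T_funpow_bounded) (auto simp: fb)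
  have eb: "\<bar>e n x\<bar> \<le> 2 * C" for n x using Tb[of n x] fb[of x] by (simp add: e_def)
  have elim: "(e n \<longlongrightarrow> 0) at_top" for n
  proof (induction n)
    case 0
    then show ?case by (simp add: e_def[abs_def])
  next
    case (Suc n)
    have "T (\<lambda>x. 1 * f x + (-1) * (T ^^ n) f x) x = 1 * T f x + (-1) * T ((T ^^ n) f) x" for x
      by (rule T_add) (use m fb Tb in auto)
    then have "e (Suc n) = (\<lambda>x. g x + T (e n) x)"
      using eq by (auto simp: e_def[abs_def])
    moreover have "(T (e n) \<longlongrightarrow> 0) at_top"
      by (rule T_tendsto_0[OF m(2) eb Suc])
    ultimately show ?case using tendsto_add[OF lim] by fastforce
  qed
  define r where "r n x = 2 * (2 * C * (T ^^ n) g x) + 4 * T (\<lambda>x. (e n x)\<^sup>2) x + 4 * (e n x)\<^sup>2" for n x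
  have rlim: "(r n \<longlongrightarrow> 0) at_top" for n
  proof -
    have "((\<lambda>x. (e n x)\<^sup>2) \<longlongrightarrow> 0) at_top" using tendsto_power[OF elim, of n 2] by simp
    moreover from this have "(T (\<lambda>x. (e n x)\<^sup>2) \<longlongrightarrow> 0) at_top"
      by (rule T_tendsto_0[where C = "(2 * C)\<^sup>2", rotated 2])
         (use m in simp, unfold abs_power2, rule abs_sq_le[OF eb])
    moreover have "((T ^^ n) g \<longlongrightarrow> 0) at_top"
      by (rule T_funpow_tendsto_0[OF _ gb lim]) simp
    ultimately have "(r n \<longlongrightarrow> 2 * (2 * C * 0) + 4 * 0 + 4 * 0) at_top"
      unfolding r_def[abs_def] by (intro tendsto_intros)
    then show ?thesis by simp
  qed
  have le: "D f x \<le> 2 * ((T ^^ Suc n) (\<lambda>x. (f x)\<^sup>2) x - (T ^^ n) (\<lambda>x. (f x)\<^sup>2) x) + r n x" for n x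
  proof -
    have "D f x = D (\<lambda>x. (T ^^ n) f x + e n x) x" by (simp add: e_def)
    also have "\<dots> \<le> 2 * D ((T ^^ n) f) x + 4 * T (\<lambda>x. (e n x)\<^sup>2) x + 4 * (e n x)\<^sup>2"
      by (rule D_add_le[where C = "2 * C"]) (use m eb in \<open>auto intro: order_trans[OF Tb] simp: C\<close>)
    also have "D ((T ^^ n) f) x \<le> (T ^^ n) (D f) x"
      by (rule D_funpow_le[OF _ fb]) simp
    also have "\<dots> \<le> (T ^^ Suc n) (\<lambda>x. (f x)\<^sup>2) x - (T ^^ n) (\<lambda>x. (f x)\<^sup>2) x + 2 * C * (T ^^ n) g x"
      by (rule T_funpow_D_le[OF _ _ b g g' eq]) auto
    finally show ?thesis by (simp add: r_def)
  qed
  have sum_le: "real N * D f x \<le> 2 * C\<^sup>2 + (\<Sum>n<N. r n x)" for N x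
  proof -
    define a where "a n = (T ^^ n) (\<lambda>x. (f x)\<^sup>2) x" for n
    have le': "D f x \<le> 2 * (a (Suc n) - a n) + r n x" for n
      using le[of x n] by (simp only: a_def)
    have "real N * D f x = (\<Sum>n<N. D f x)" by simp
    also have "\<dots> \<le> (\<Sum>n<N. 2 * (a (Suc n) - a n) + r n x)"
      by (intro sum_mono le')
    also have "\<dots> = 2 * (a N - a 0) + (\<Sum>n<N. r n x)"
      by (simp only: sum.distrib sum_distrib_left[symmetric] sum_lessThan_telescope)
    finally have le'': "real N * D f x \<le> 2 * (a N - a 0) + (\<Sum>n<N. r n x)" .
    have "\<bar>a N\<bar> \<le> C\<^sup>2"
      unfolding a_def by (rule T_funpow_bounded) (auto intro!: abs_sq_le fb)
    moreover have "a 0 \<ge> 0" by (simp add: a_def)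
    ultimately have "2 * (a N - a 0) \<le> 2 * C\<^sup>2" by simp
    then show ?thesis using le'' by (rule add_right_mono[THEN order_trans[rotated]])
  qed
  show ?thesis
  proof (rule tendstoI)
    fix \<epsilon> :: real assume "\<epsilon> > 0"
    \<comment> \<open>N is fixed before x: the telescoped sum contributes at most 2 C^2 / N <
      \<epsilon> / 2 to D f x, and the remainders are finitely many, so they vanish as x
      grows.\<close>
    obtain N :: nat where N: "2 * C\<^sup>2 / (\<epsilon> / 2) < real N" using reals_Archimedean2 by blast
    have N0: "0 < real N"
      using N \<open>\<epsilon> > 0\<close> by (intro le_less_trans[OF _ N]) simp
    have N1: "2 * C\<^sup>2 < real N * (\<epsilon> / 2)"
      using N \<open>\<epsilon> > 0\<close> by (simp add: field_simps)
    have "((\<lambda>x. \<Sum>n<N. r n x) \<longlongrightarrow> (\<Sum>n<N. 0)) at_top"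
      by (intro tendsto_sum rlim)
    then have "\<forall>\<^sub>F x in at_top. (\<Sum>n<N. r n x) < real N * (\<epsilon> / 2)"
      using order_tendstoD(2)[of _ 0 at_top "real N * (\<epsilon> / 2)"] N0 \<open>\<epsilon> > 0\<close> by auto
    then show "\<forall>\<^sub>F x in at_top. dist (D f x) 0 < \<epsilon>"
    proof eventually_elim
      case (elim x)
      then have "real N * D f x < real N * \<epsilon>" using sum_le[of N x] N1 by (simp add: field_simps)
      then show ?case using N0 D_bounded(1)[OF assms(1) fb, of x] by (simp add: dist_real_def)
    qed
  qed
qed

section \<open>The support of the step law and the asymptotic periods\<close>

definition supp :: "real set" where
  "supp = {u. \<forall>r>0. 0 < prob (ball u r)}"

text \<open>An increment of size \<epsilon> at the shift u persists, by the Lipschitz bound, with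
  size \<epsilon> / 2 for all shifts near u. These have positive probability, so D F would stay away
  from zero.\<close>

lemma tendsto_shift_supp:
  assumes [measurable]: "F \<in> borel_measurable borel"
    and b: "\<And>x. \<bar>F x\<bar> \<le> C" and lip: "\<And>x y. \<bar>F x - F y\<bar> \<le> L * \<bar>x - y\<bar>"
    and D: "(D F \<longlongrightarrow> 0) at_top" and u: "u \<in> supp"
  shows "((\<lambda>x. F (x - u) - F x) \<longlongrightarrow> 0) at_top"
proof (rule tendstoI)
  fix \<epsilon> :: real assume e: "\<epsilon> > 0"
  have L0: "L \<ge> 0" using order_trans[OF abs_ge_zero lip[of 0 1]] by simp
  \<comment> \<open>The radius makes L r at most \<epsilon> / 2; L + 1 in place of L covers L =
    0.\<close>
  define r where "r = \<epsilon> / (2 * (L + 1))"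
  have r: "r > 0" using e L0 by (simp add: r_def)
  have Lr: "L * r \<le> \<epsilon> / 2" using e L0 by (simp add: r_def field_simps)
  define p where "p = prob (ball u r)"
  have p: "p > 0" using u r by (simp add: supp_def p_def)
  have "\<forall>\<^sub>F x in at_top. D F x < (\<epsilon> / 2)\<^sup>2 * p"
    using order_tendstoD(2)[OF D] e p by simp
  then show "\<forall>\<^sub>F x in at_top. dist (F (x - u) - F x) 0 < \<epsilon>"
  proof eventually_elim
    case (elim x)
    show ?case
    proof (rule ccontr)
      assume "\<not> ?case"
      then have ge: "\<epsilon> \<le> \<bar>F (x - u) - F x\<bar>" by (simp add: dist_real_def)
      have ge': "(\<epsilon> / 2)\<^sup>2 * indicator (ball u r) v \<le> (F (x - v) - F x)\<^sup>2" for v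
      proof (cases "v \<in> ball u r")
        case True
        then have "\<bar>u - v\<bar> < r" by (simp add: dist_real_def)
        then have "L * \<bar>u - v\<bar> \<le> L * r" using L0 by (intro mult_left_mono) auto
        then have "\<bar>F (x - v) - F (x - u)\<bar> \<le> \<epsilon> / 2"
          using lip[of "x - v" "x - u"] Lr by simp
        then have "\<epsilon> / 2 \<le> \<bar>F (x - v) - F x\<bar>" using ge by linarith
        then have "(\<epsilon> / 2)\<^sup>2 \<le> \<bar>F (x - v) - F x\<bar>\<^sup>2" using e by (intro power_mono) auto
        then show ?thesis using True by simp
      qed simp
      have b2: "\<bar>F y - F z\<bar> \<le> 2 * C" for y z using b[of y] b[of z] by linarith
      have "(\<epsilon> / 2)\<^sup>2 * p = (\<integral>v. (\<epsilon> / 2)\<^sup>2 * indicator (ball u r) v \<partial>\<eta>)"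
        by (simp add: p_def)
      also have "\<dots> \<le> D F x"
        unfolding D_def
      proof (rule integral_mono)
        show "integrable \<eta> (\<lambda>v. (F (x - v) - F x)\<^sup>2)"
          by (rule integrable_bounded[of _ "(2 * C)\<^sup>2"], measurable, unfold abs_power2, rule abs_sq_le[OF b2])
        show "integrable \<eta> (\<lambda>v. (\<epsilon> / 2)\<^sup>2 * indicator (ball u r) v)"
          by (intro integrable_mult_right integrable_bounded[of _ 1] borel_measurable_indicator) auto
      qed (rule ge')
      finally show False using elim by simp
    qed
  qed
qed

text \<open>The complement of the support is covered by the countably many intervals with rational
  endpoints that carry no mass.\<close>

lemma AE_supp: "AE u in \<eta>. u \<in> supp"
proof -
  define I where "I = {(a::real, b::real). a \<in> \<rat> \<and> b \<in> \<rat> \<and> prob {a<..<b} = 0}"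
  have cI: "countable I"
    by (rule countable_subset[of _ "\<rat> \<times> \<rat>"]) (auto simp: I_def countable_rat)
  have "AE u in \<eta>. \<forall>(a, b)\<in>I. u \<notin> {a<..<b}"
  proof (subst AE_ball_countable[OF cI], safe)
    fix a b assume "(a, b) \<in> I"
    then have "{a<..<b} \<in> null_sets \<eta>"
      by (auto simp: I_def null_sets_def emeasure_eq_measure sets_step)
    then show "AE u in \<eta>. u \<notin> {a<..<b}" by (rule AE_not_in)
  qed
  then show ?thesis
  proof (rule AE_mp, intro AE_I2 impI)
    fix u assume *: "\<forall>(a, b)\<in>I. u \<notin> {a<..<b}"
    show "u \<in> supp"
    proof (rule ccontr)
      assume "u \<notin> supp"
      then obtain r where "r > 0" "\<not> 0 < prob (ball u r)" by (auto simp: supp_def)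
      then have r: "r > 0" "prob (ball u r) = 0" using measure_nonneg[of \<eta> "ball u r"] by auto
      obtain a where a: "a \<in> \<rat>" "u - r < a" "a < u" using Rats_dense_in_real[of "u - r" u] r by auto
      obtain b where b: "b \<in> \<rat>" "u < b" "b < u + r" using Rats_dense_in_real[of u "u + r"] r by auto
      have "prob {a<..<b} \<le> prob (ball u r)"
        by (rule finite_measure_mono) (use a b in \<open>auto simp: dist_real_def sets_step\<close>)
      then have "(a, b) \<in> I" using a b r(2) measure_nonneg[of \<eta> "{a<..<b}"] by (auto simp: I_def)
      then show False using * a b by auto
    qed
  qed
qed

text \<open>If distinct points of the support were at least \<epsilon> apart, each cell [k
  \<epsilon>, (k + 1) \<epsilon>) would hold at most one of them. The support would be countable and
  hence null, whereas it carries the whole mass.\<close>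

lemma supp_close_points:
  assumes atomless: "\<And>v. prob {v} = 0" and e: "\<epsilon> > (0::real)"
  obtains u v where "u \<in> supp" "v \<in> supp" "v < u" "u - v < \<epsilon>"
proof (rule ccontr)
  assume "\<not> thesis"
  then have sep: "\<And>u v. u \<in> supp \<Longrightarrow> v \<in> supp \<Longrightarrow> v < u \<Longrightarrow> \<epsilon> \<le> u - v"
    using that by force
  have "inj_on (\<lambda>u. \<lfloor>u / \<epsilon>\<rfloor>) supp"
  proof (rule inj_onI, rule ccontr)
    fix u v assume uv: "u \<in> supp" "v \<in> supp" "\<lfloor>u / \<epsilon>\<rfloor> = \<lfloor>v / \<epsilon>\<rfloor>" "u \<noteq> v"
    have "\<bar>u / \<epsilon> - v / \<epsilon>\<bar> < 1" using uv(3) by linarith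
    then have "\<bar>u - v\<bar> < \<epsilon>" using e by (simp add: diff_divide_distrib[symmetric])
    then show False using sep[of u v] sep[of v u] uv by linarith
  qed
  then have c: "countable supp" by (rule countableI')
  have "AE u in \<eta>. \<forall>v\<in>supp. u \<noteq> v"
  proof (subst AE_ball_countable[OF c], intro ballI)
    fix v
    have "{v} \<in> null_sets \<eta>" using atomless[of v] by (auto simp: null_sets_def emeasure_eq_measure sets_step)
    then show "AE u in \<eta>. u \<noteq> v" using AE_not_in by fastforce
  qed
  with AE_supp have "AE u in \<eta>. False" by eventually_elim auto
  then show False by simp
qed

text \<open>The asymptotic periods of F contain the differences of points of the support, which are
  arbitrarily small when there are no atoms.\<close>

lemma slowly_varying:
  assumes [measurable]: "F \<in> borel_measurable borel"
    and b: "\<And>x. \<bar>F x\<bar> \<le> C" and lip: "\<And>x y. \<bar>F x - F y\<bar> \<le> L * \<bar>x - y\<bar>"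
    and D: "(D F \<longlongrightarrow> 0) at_top" and atomless: "\<And>v. prob {v} = 0" and e: "\<epsilon> > 0"
  shows "\<forall>\<^sub>F x in at_top. \<forall>t. \<bar>t\<bar> \<le> U \<longrightarrow> \<bar>F (x + t) - F x\<bar> \<le> \<epsilon>"
proof -
  have L0: "L \<ge> 0" using order_trans[OF abs_ge_zero lip[of 0 1]] by simp
  have "\<epsilon> / (2 * (L + 1)) > 0" using e L0 by simp
  then obtain u v where uv: "u \<in> supp" "v \<in> supp" "v < u" "u - v < \<epsilon> / (2 * (L + 1))"
    using supp_close_points[OF atomless] by metis
  \<comment> \<open>The period d is so short that F varies by at most \<epsilon> / 2 on intervals of
    length d; multiples of d then approximate every shift.\<close>
  define d where "d = u - v"
  have d: "d > 0" "L * d \<le> \<epsilon> / 2"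
  proof -
    show "d > 0" using uv by (simp add: d_def)
    have "L * d \<le> L * (\<epsilon> / (2 * (L + 1)))" using uv L0 by (intro mult_left_mono) (auto simp: d_def)
    also have "\<dots> \<le> \<epsilon> / 2" using e L0 by (simp add: field_simps)
    finally show "L * d \<le> \<epsilon> / 2" .
  qed
  have lim: "((\<lambda>x. F (x + d) - F x) \<longlongrightarrow> 0) at_top"
  proof -
    have "((\<lambda>x. (F (x - v) - F x) - (F (x - u) - F x)) \<longlongrightarrow> 0 - 0) at_top"
      by (intro tendsto_diff tendsto_shift_supp[OF assms(1) b lip D] uv)
    moreover have "filterlim (\<lambda>x. x + u) at_top at_top"
      using filterlim_tendsto_add_at_top[OF tendsto_const[of u] filterlim_ident] by (simp add: add.commute)
    ultimately have "((\<lambda>x. (F (x + u - v) - F (x + u)) - (F (x + u - u) - F (x + u))) \<longlongrightarrow> 0 - 0) at_top"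
      by (rule filterlim_compose)
    then show ?thesis by (simp add: d_def algebra_simps)
  qed
  \<comment> \<open>At most K steps of length d fit into a shift of size |U|. With an error of
    \<epsilon> / (2 (K + 1)) per step they accumulate at most \<epsilon> / 2.\<close>
  define K where "K = nat \<lceil>\<bar>U\<bar> / d\<rceil>"
  have "\<epsilon> / (2 * real (K + 1)) > 0" using e by simp
  then have "\<forall>\<^sub>F x in at_top. \<bar>F (x + d) - F x\<bar> < \<epsilon> / (2 * real (K + 1))"
    using tendstoD[OF lim] by (simp add: dist_real_def)
  then obtain X where X: "\<And>x. x \<ge> X \<Longrightarrow> \<bar>F (x + d) - F x\<bar> < \<epsilon> / (2 * real (K + 1))"
    by (auto simp: eventually_at_top_linorder)
  have multi: "\<bar>F (x + real k * d) - F x\<bar> \<le> real k * (\<epsilon> / (2 * real (K + 1)))" if "x \<ge> X" for x k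
  proof (induction k)
    case (Suc k)
    define c where "c = \<epsilon> / (2 * real (K + 1))"
    have "x + real k * d \<ge> X" using that d by (intro order_trans[OF that]) simp
    from X[OF this] have "\<bar>F (x + real (Suc k) * d) - F (x + real k * d)\<bar> \<le> c"
      unfolding c_def by (simp add: algebra_simps)
    with Suc show ?case unfolding c_def[symmetric] by (simp add: algebra_simps)
  qed simp
  have main: "\<bar>F (x + t) - F x\<bar> \<le> \<epsilon>" if x: "x \<ge> X" and t: "0 \<le> t" "t \<le> \<bar>U\<bar>" for x t
  proof -
    define k where "k = nat \<lfloor>t / d\<rfloor>"
    have k: "real k * d \<le> t" "t < real k * d + d"
    proof -
      have "real k = of_int \<lfloor>t / d\<rfloor>" using t d by (simp add: k_def)
      then have "real k \<le> t / d" "t / d < real k + 1" by linarith+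
      then show "real k * d \<le> t" "t < real k * d + d" using d by (simp_all add: field_simps)
    qed
    have kK: "k \<le> K"
      unfolding k_def K_def using t d
      by (intro nat_mono order_trans[OF floor_mono floor_le_ceiling] divide_right_mono) auto
    have "real k * (\<epsilon> / (2 * real (K + 1))) \<le> \<epsilon> / 2"
    proof -
      have "real k * (\<epsilon> / (2 * real (K + 1))) \<le> real (K + 1) * (\<epsilon> / (2 * real (K + 1)))"
        using e kK by (intro mult_right_mono) auto
      also have "real (K + 1) * (\<epsilon> / (2 * real (K + 1))) = \<epsilon> / 2"
      proof -
        have "k * (\<epsilon> / (2 * k)) = \<epsilon> / 2" if "k > 0" for k :: real
          using that by (simp add: field_simps)
        from this[of "real (K + 1)"] show ?thesis by simp
      qed
      finally show ?thesis .
    qed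
    with multi[OF x, of k] have "\<bar>F (x + real k * d) - F x\<bar> \<le> \<epsilon> / 2" by linarith
    moreover have "L * \<bar>(x + t) - (x + real k * d)\<bar> \<le> L * d"
      using L0 k by (intro mult_left_mono) auto
    then have "\<bar>F (x + t) - F (x + real k * d)\<bar> \<le> \<epsilon> / 2"
      using lip[of "x + t" "x + real k * d"] d by linarith
    ultimately show ?thesis by linarith
  qed
  show ?thesis
    unfolding eventually_at_top_linorder
  proof (intro exI allI impI)
    \<comment> \<open>The margin |U| serves the negative t: there the argument runs from x + t,
      which still lies beyond X, up to x.\<close>
    fix x t assume x: "X + \<bar>U\<bar> \<le> x" and t: "\<bar>t\<bar> \<le> U"
    show "\<bar>F (x + t) - F x\<bar> \<le> \<epsilon>"
    proof (cases "0 \<le> t")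
      case True
      then show ?thesis using main[of x t] x t by linarith
    next
      case False
      then show ?thesis using main[of "x + t" "- t"] x t by simp
    qed
  qed
qed

end

section \<open>Smoothing the renewal equation, and a uniform bound\<close>

lemma abs_diff_le: "\<bar>a\<bar> \<le> s \<Longrightarrow> \<bar>b\<bar> \<le> t \<Longrightarrow> \<bar>a - b\<bar> \<le> s + t" for a b s t :: real
  by linarith

text \<open>The growth condition holds when exp (- \<kappa> x) f x is decreasing, as for a rescaled tail function.\<close>

locale renewal = real_step +
  fixes f g :: "real \<Rightarrow> real" and s q C0 \<kappa> :: real
  assumes f_meas [measurable]: "f \<in> borel_measurable borel"
    and g_meas [measurable]: "g \<in> borel_measurable borel"
    and step_integrable: "integrable \<eta> (\<lambda>u. u)"
    and step_mean: "0 < (\<integral>u. u \<partial>\<eta>)"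
    and s_pos: "0 < s"
    and exp_integrable: "integrable \<eta> (\<lambda>u. exp (- s * u))"
    and exp_mean: "(\<integral>u. exp (- s * u) \<partial>\<eta>) = q"
    and q_less: "q < 1"
    and atomless: "\<And>v. prob {v} = 0"
    and f_nonneg: "\<And>x. 0 \<le> f x"
    and f_le_exp: "\<And>x. f x \<le> C0 * exp (s * x)"
    and growth: "0 \<le> \<kappa>" "\<And>x y. x \<le> y \<Longrightarrow> f y \<le> exp (\<kappa> * (y - x)) * f x"
    and g_nonneg: "\<And>x. 0 \<le> g x"
    and g_integrable: "integrable lborel g"
    and renewal_eq: "\<And>x. f x = g x + T f x"
begin

text \<open>A window integral, not normalised by \<delta>. It turns integrability of g into decay at
  infinity and boundedness of f into a Lipschitz bound, the two properties on which asymptotic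
  invariance rests.\<close>

definition sm :: "real \<Rightarrow> (real \<Rightarrow> real) \<Rightarrow> real \<Rightarrow> real" where
  "sm \<delta> h x = (\<integral>y. indicator {0..\<delta>} y * h (x + y) \<partial>lborel)"

lemma sm_alt: "sm \<delta> h x = (\<integral>y. indicator {x..x+\<delta>} y * h y \<partial>lborel)"
proof -
  have "(\<integral>y. indicator {x..x+\<delta>} y * h y \<partial>lborel)
    = (\<integral>y. indicator {x..x+\<delta>} (x + 1 * y) * h (x + 1 * y) \<partial>lborel)"
    using lborel_integral_real_affine[of 1 "\<lambda>y. indicator {x..x+\<delta>} y * h y" x] by simp
  also have "\<dots> = sm \<delta> h x"
    unfolding sm_def by (rule Bochner_Integration.integral_cong) (auto split: split_indicator)
  finally show ?thesis by simp
qed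

lemma measurable_sm [measurable (raw)]:
  assumes [measurable]: "h \<in> borel_measurable borel"
  shows "sm \<delta> h \<in> borel_measurable borel"
  unfolding sm_def by measurable

lemma sm_nonneg: "(\<And>x. 0 \<le> h x) \<Longrightarrow> 0 \<le> sm \<delta> h x"
  unfolding sm_def by (simp add: integral_nonneg_AE)

lemma q_nonneg: "0 \<le> q"
  unfolding exp_mean[symmetric] by simp

lemma exp_shift_integrable: "integrable \<eta> (\<lambda>u. c * exp (s * (x - u)))"
proof -
  have "integrable \<eta> (\<lambda>u. c * exp (s * x) * exp (- s * u))"
    using exp_integrable by simp
  then show ?thesis by (simp add: right_diff_distrib exp_diff exp_minus field_simps)
qed

lemma exp_shift_mean: "(\<integral>u. c * exp (s * (x - u)) \<partial>\<eta>) = q * (c * exp (s * x))"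
proof -
  have "(\<integral>u. c * exp (s * (x - u)) \<partial>\<eta>) = (\<integral>u. c * exp (s * x) * exp (- s * u) \<partial>\<eta>)"
    by (simp add: right_diff_distrib exp_diff exp_minus field_simps)
  also have "\<dots> = c * exp (s * x) * q"
    by (simp only: exp_mean integral_mult_right_zero)
  finally show ?thesis by (simp add: mult_ac)
qed

text \<open>Before boundedness is known, domination by exp (s x) is the available control. This
  class is stable under \<open>T\<close>, because exp (- s u) has a finite mean.\<close>

lemma exp_class_integrable:
  assumes [measurable]: "h \<in> borel_measurable borel"
    and "\<And>x. 0 \<le> h x" "\<And>x. h x \<le> c * exp (s * x)"
  shows "integrable \<eta> (\<lambda>u. h (x - u))"
  by (rule Bochner_Integration.integrable_bound[OF exp_shift_integrable[of c x]])
     (use assms in \<open>auto intro: order_trans[OF _ abs_ge_self]\<close>)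

lemma window_integrable:
  assumes [measurable]: "h \<in> borel_measurable borel"
    and "\<And>x. 0 \<le> h x" "\<And>x. h x \<le> c * exp (s * x)"
  shows "integrable lborel (\<lambda>y. indicator {a..b} y * h (x + y))"
proof -
  have c: "0 \<le> c" using order_trans[OF assms(2,3), of 0] by simp
  have "integrable lborel (\<lambda>y. indicator {a..b} y *\<^sub>R h (x + y))"
  proof (rule integrableI_bounded_set_indicator[where B = "c * exp (s * (x + b))"])
    show "AE y in lborel. y \<in> {a..b} \<longrightarrow> norm (h (x + y)) \<le> c * exp (s * (x + b))"
    proof (intro AE_I2 impI)
      fix y assume "y \<in> {a..b}"
      then have "c * exp (s * (x + y)) \<le> c * exp (s * (x + b))"
        using c s_pos by (intro mult_left_mono) auto
      then show "norm (h (x + y)) \<le> c * exp (s * (x + b))"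
        using assms(2)[of "x + y"] assms(3)[of "x + y"] by simp
    qed
  qed (auto simp: emeasure_lborel_Icc_eq)
  then show ?thesis by simp
qed

lemma sm_le_exp:
  assumes [measurable]: "h \<in> borel_measurable borel" and \<delta>: "0 \<le> \<delta>"
    and h: "\<And>x. 0 \<le> h x" "\<And>x. h x \<le> c * exp (s * x)"
  shows "sm \<delta> h x \<le> \<delta> * c * exp (s * \<delta>) * exp (s * x)"
proof -
  have c: "0 \<le> c" using order_trans[OF h, of 0] by simp
  have "sm \<delta> h x \<le> (\<integral>y. indicator {0..\<delta>} y * (c * exp (s * (x + \<delta>))) \<partial>lborel)"
    unfolding sm_def
  proof (rule integral_mono[OF window_integrable[OF assms(1) h]])
    fix y
    show "indicator {0..\<delta>} y * h (x + y) \<le> indicator {0..\<delta>} y * (c * exp (s * (x + \<delta>)))"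
    proof (cases "y \<in> {0..\<delta>}")
      case True
      then have "c * exp (s * (x + y)) \<le> c * exp (s * (x + \<delta>))"
        using c s_pos by (intro mult_left_mono) auto
      then show ?thesis using True h(2)[of "x + y"] by simp
    qed simp
  qed (use \<delta> in \<open>auto intro!: integrable_mult_left\<close>)
  also have "\<dots> = \<delta> * c * exp (s * \<delta>) * exp (s * x)"
    using \<delta> by (simp add: distrib_left exp_add)
  finally show ?thesis .
qed

lemma sm_T:
  assumes [measurable]: "h \<in> borel_measurable borel" and \<delta>: "0 \<le> \<delta>"
    and h: "\<And>x. 0 \<le> h x" "\<And>x. h x \<le> c * exp (s * x)"
  shows "sm \<delta> (T h) x = T (sm \<delta> h) x"
proof -
  interpret P: pair_sigma_finite \<eta> lborel ..
  have "integrable (\<eta> \<Otimes>\<^sub>M lborel) (\<lambda>(u, y). indicator {0..\<delta>} y * h (x - u + y))"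
  proof (rule P.Fubini_integrable)
    show "integrable \<eta> (\<lambda>u. \<integral>y. norm (case (u, y) of (u, y) \<Rightarrow> indicator {0..\<delta>} y * h (x - u + y)) \<partial>lborel)"
    proof -
      have "integrable \<eta> (\<lambda>u. sm \<delta> h (x - u))"
        by (rule exp_class_integrable[OF _ sm_nonneg[OF h(1)] sm_le_exp[OF assms(1) \<delta> h]]) measurable
      then show ?thesis using h(1) by (simp add: sm_def)
    qed
    show "AE u in \<eta>. integrable lborel (\<lambda>y. case (u, y) of (u, y) \<Rightarrow> indicator {0..\<delta>} y * h (x - u + y))"
      using window_integrable[OF assms(1) h] by simp
  qed measurable
  from P.Fubini_integral[OF this]
  have "(\<integral>y. (\<integral>u. indicator {0..\<delta>} y * h (x - u + y) \<partial>\<eta>) \<partial>lborel) = T (sm \<delta> h) x"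
    by (simp add: T_def sm_def)
  then show ?thesis by (simp add: T_def sm_def algebra_simps)
qed

lemma g_le_f: "g x \<le> f x"
  using renewal_eq[of x] T_nonneg[OF f_nonneg] by simp

lemma T_f_le: "T f x \<le> f x"
  using renewal_eq[of x] g_nonneg[of x] by simp

lemma sm_renewal_eq:
  assumes "0 \<le> \<delta>"
  shows "sm \<delta> f x = sm \<delta> g x + T (sm \<delta> f) x"
proof -
  have "sm \<delta> f x = (\<integral>y. indicator {0..\<delta>} y * g (x + y) + indicator {0..\<delta>} y * T f (x + y) \<partial>lborel)"
    unfolding sm_def by (subst renewal_eq) (simp add: distrib_left)
  also have "\<dots> = sm \<delta> g x + sm \<delta> (T f) x"
    unfolding sm_def
  proof (rule Bochner_Integration.integral_add)
    show "integrable lborel (\<lambda>y. indicator {0..\<delta>} y * g (x + y))"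
      by (rule window_integrable[OF _ g_nonneg order_trans[OF g_le_f f_le_exp]]) simp
    show "integrable lborel (\<lambda>y. indicator {0..\<delta>} y * T f (x + y))"
      by (rule window_integrable[OF _ T_nonneg[OF f_nonneg] order_trans[OF T_f_le f_le_exp]]) measurable
  qed
  also have "sm \<delta> (T f) x = T (sm \<delta> f) x"
    by (rule sm_T[OF _ assms f_nonneg f_le_exp]) simp
  finally show ?thesis .
qed

text \<open>The function w is a bounded supersolution that dominates, up to a constant, the renewal measure
  of a window; convolving it with g bounds the smoothed f uniformly.\<close>

definition w :: "real \<Rightarrow> real" where "w x = min 1 (exp (s * x))"

lemma w_bounds: "0 \<le> w x" "w x \<le> 1" "\<bar>w x\<bar> \<le> 1"
  by (auto simp: w_def)

lemma measurable_w [measurable]: "w \<in> borel_measurable borel"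
  unfolding w_def[abs_def] by measurable

text \<open>Both 1 and exp (s x) dominate their images under \<open>T\<close>, the second with the
  factor q, so their minimum is a supersolution. On [-\<delta>, 0] the gap is at least (1 - q) exp
  (s x), which gives the constant.\<close>

lemma w_supersolution:
  assumes "0 \<le> \<delta>"
  shows "(1 - q) * exp (- s * \<delta>) * indicator {-\<delta>..0} x \<le> w x - T w x"
proof -
  have iw: "integrable \<eta> (\<lambda>u. w (x - u))" for x
    by (rule integrable_bounded[of _ 1]) (auto simp: w_bounds)
  have T1: "T w x \<le> 1" using T_bounded[OF measurable_w w_bounds(3), of x] by simp
  have "T w x \<le> (\<integral>u. 1 * exp (s * (x - u)) \<partial>\<eta>)"
    unfolding T_def by (rule integral_mono[OF iw exp_shift_integrable]) (simp add: w_def)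
  then have T2: "T w x \<le> q * exp (s * x)" using exp_shift_mean[of 1 x] by simp
  show ?thesis
  proof (cases "x \<le> 0")
    case True
    then have wx: "w x = exp (s * x)" using s_pos by (simp add: w_def mult_nonneg_nonpos)
    have nn: "0 \<le> (1 - q) * exp (s * x)" using q_less by simp
    have le: "(1 - q) * exp (- s * \<delta>) \<le> (1 - q) * exp (s * x)" if "-\<delta> \<le> x"
      using mult_left_mono[OF that, of s] q_less s_pos by (intro mult_left_mono) auto
    have "(1 - q) * exp (s * x) \<le> w x - T w x" using wx T2 by (simp add: algebra_simps)
    then show ?thesis using True nn le by (cases "-\<delta> \<le> x") auto
  next
    case False
    then have "w x = 1" using s_pos by (simp add: w_def)
    then show ?thesis using False T1 by simp
  qed
qed

definition W :: "real \<Rightarrow> real" where "W x = (\<integral>y. w (x - y) * g y \<partial>lborel)"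

lemma W_integrable: "integrable lborel (\<lambda>y. w (x - y) * g y)"
  by (rule Bochner_Integration.integrable_bound[OF g_integrable])
     (auto simp: abs_mult w_bounds g_nonneg intro!: mult_left_le_one_le)

lemma W_bounds: "0 \<le> W x" "W x \<le> (\<integral>y. g y \<partial>lborel)"
proof -
  show "0 \<le> W x" unfolding W_def by (simp add: integral_nonneg_AE w_bounds g_nonneg)
  show "W x \<le> (\<integral>y. g y \<partial>lborel)"
    unfolding W_def
    by (rule integral_mono[OF W_integrable g_integrable]) (auto simp: w_bounds g_nonneg intro!: mult_left_le_one_le)
qed

lemma measurable_W [measurable]: "W \<in> borel_measurable borel"
  unfolding W_def[abs_def] by measurable

text \<open>Convolving the inequality for \<open>w\<close> with g preserves it, and the convolution
  of the indicator of [-\<delta>, 0] with g is the smoothed g.\<close>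

lemma W_supersolution:
  assumes "0 \<le> \<delta>"
  shows "(1 - q) * exp (- s * \<delta>) * sm \<delta> g x \<le> W x - T W x"
proof -
  interpret P: pair_sigma_finite \<eta> lborel ..
  have Tw: "\<bar>T w x\<bar> \<le> 1" "0 \<le> T w x" for x
    using T_bounded[OF measurable_w w_bounds(3)] T_nonneg[OF w_bounds(1)] by auto
  have int: "integrable (\<eta> \<Otimes>\<^sub>M lborel) (\<lambda>(u, y). w (x - u - y) * g y)"
  proof (rule P.Fubini_integrable)
    have "integrable \<eta> (\<lambda>u. W (x - u))"
      by (rule integrable_bounded[of _ "\<integral>y. g y \<partial>lborel"]) (use W_bounds in auto)
    then show "integrable \<eta> (\<lambda>u. \<integral>y. norm (case (u, y) of (u, y) \<Rightarrow> w (x - u - y) * g y) \<partial>lborel)"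
      by (simp add: W_def w_bounds g_nonneg abs_mult)
    show "AE u in \<eta>. integrable lborel (\<lambda>y. case (u, y) of (u, y) \<Rightarrow> w (x - u - y) * g y)"
      using W_integrable by simp
  qed measurable
  have TW: "T W x = (\<integral>y. T w (x - y) * g y \<partial>lborel)"
    using P.Fubini_integral[OF int] by (simp add: T_def W_def algebra_simps)
  have [measurable]: "T w \<in> borel_measurable borel" by (rule measurable_T) simp
  have ig: "integrable lborel (\<lambda>y. T w (x - y) * g y)"
    by (rule Bochner_Integration.integrable_bound[OF g_integrable])
       (use Tw in \<open>auto simp: abs_mult g_nonneg intro!: mult_left_le_one_le\<close>)
  have isg: "integrable lborel (\<lambda>y. indicator {x..x+\<delta>} y * g y)"
    using window_integrable[OF g_meas g_nonneg order_trans[OF g_le_f f_le_exp], of x "x+\<delta>" 0] by simp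
  have "(1 - q) * exp (- s * \<delta>) * sm \<delta> g x
    = (\<integral>y. (1 - q) * exp (- s * \<delta>) * (indicator {x..x+\<delta>} y * g y) \<partial>lborel)"
    unfolding sm_alt using isg by simp
  also have "\<dots> \<le> (\<integral>y. w (x - y) * g y - T w (x - y) * g y \<partial>lborel)"
  proof (rule integral_mono)
    fix y
    have "(indicator {x..x+\<delta>} y :: real) = indicator {-\<delta>..0} (x - y)"
      by (auto split: split_indicator)
    then have "(1 - q) * exp (- s * \<delta>) * indicator {x..x+\<delta>} y \<le> w (x - y) - T w (x - y)"
      using w_supersolution[OF assms, of "x - y"] by simp
    from mult_right_mono[OF this g_nonneg[of y]]
    show "(1 - q) * exp (- s * \<delta>) * (indicator {x..x+\<delta>} y * g y) \<le> w (x - y) * g y - T w (x - y) * g y"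
      by (simp add: algebra_simps)
  qed (use isg ig W_integrable in \<open>auto\<close>)
  also have "\<dots> = W x - T W x"
    unfolding TW W_def by (rule Bochner_Integration.integral_diff[OF W_integrable ig])
  finally show ?thesis .
qed

text \<open>A comparison principle: the difference h of the scaled smoothed f and \<open>W\<close>
  satisfies h \<le> T h and is at most a multiple of exp (s x). Iterating \<open>T\<close>
  multiplies that bound by q each time, so h \<le> 0.\<close>

lemma sm_f_bounded:
  assumes "0 \<le> \<delta>"
  shows "(1 - q) * exp (- s * \<delta>) * sm \<delta> f x \<le> (\<integral>y. g y \<partial>lborel)"
proof -
  define c where "c = (1 - q) * exp (- s * \<delta>)"
  have c: "0 < c" using q_less by (simp add: c_def)
  define K where "K = c * (\<delta> * C0 * exp (s * \<delta>))"
  have smf: "0 \<le> sm \<delta> f x" "sm \<delta> f x \<le> \<delta> * C0 * exp (s * \<delta>) * exp (s * x)" for x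
    using sm_nonneg[OF f_nonneg] sm_le_exp[OF f_meas assms f_nonneg f_le_exp] by auto
  have i1: "integrable \<eta> (\<lambda>u. sm \<delta> f (x - u))" for x
    by (rule exp_class_integrable[OF _ smf]) simp
  have i2: "integrable \<eta> (\<lambda>u. W (x - u))" for x
    by (rule integrable_bounded[of _ "\<integral>y. g y \<partial>lborel"]) (use W_bounds in auto)
  have step: "c * sm \<delta> f x - W x \<le> K * q ^ n * exp (s * x)" for n x
  proof (induction n arbitrary: x)
    case 0
    have "c * sm \<delta> f x \<le> c * (\<delta> * C0 * exp (s * \<delta>) * exp (s * x))"
      using smf(2)[of x] c by (intro mult_left_mono) auto
    then show ?case using W_bounds(1)[of x] by (simp add: K_def algebra_simps)
  next
    case (Suc n)
    have "c * sm \<delta> f x - W x \<le> c * T (sm \<delta> f) x - T W x"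
      using W_supersolution[OF assms, of x] sm_renewal_eq[OF assms, of x]
      by (simp add: c_def algebra_simps)
    also have "\<dots> = (\<integral>u. c * sm \<delta> f (x - u) - W (x - u) \<partial>\<eta>)"
      unfolding T_def using i1 i2 by simp
    also have "\<dots> \<le> (\<integral>u. (K * q ^ n) * exp (s * (x - u)) \<partial>\<eta>)"
      using i1 i2 Suc by (intro integral_mono exp_shift_integrable) auto
    also have "\<dots> = K * q ^ Suc n * exp (s * x)"
      by (simp only: exp_shift_mean) simp
    finally show ?case .
  qed
  have "(\<lambda>n. K * q ^ n * exp (s * x)) \<longlonglongrightarrow> K * 0 * exp (s * x)"
    by (intro tendsto_intros LIMSEQ_power_zero) (use q_less q_nonneg in auto)
  then have "c * sm \<delta> f x - W x \<le> K * 0 * exp (s * x)"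
    by (rule LIMSEQ_le_const) (use step in auto)
  then show ?thesis using W_bounds(2)[of x] by (simp add: c_def)
qed

text \<open>Across a window f rises at most by the factor exp (\<kappa> \<delta>), so the window
  integral controls the value at its right end. With the counterpart for the left end this undoes
  the smoothing as \<delta> tends to 0.\<close>

lemma sm_f_ge:
  assumes \<delta>: "0 \<le> \<delta>"
  shows "\<delta> * f (x + \<delta>) \<le> exp (\<kappa> * \<delta>) * sm \<delta> f x"
proof -
  have "\<delta> * f (x + \<delta>) = (\<integral>y. indicator {0..\<delta>} y * f (x + \<delta>) \<partial>lborel)"
    using \<delta> by simp
  also have "\<dots> \<le> (\<integral>y. exp (\<kappa> * \<delta>) * (indicator {0..\<delta>} y * f (x + y)) \<partial>lborel)"
  proof (rule integral_mono)
    fix y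
    show "indicator {0..\<delta>} y * f (x + \<delta>) \<le> exp (\<kappa> * \<delta>) * (indicator {0..\<delta>} y * f (x + y))"
    proof (cases "y \<in> {0..\<delta>}")
      case True
      have "f (x + \<delta>) \<le> exp (\<kappa> * (\<delta> - y)) * f (x + y)"
        using growth(2)[of "x + y" "x + \<delta>"] True by simp
      also have "\<dots> \<le> exp (\<kappa> * \<delta>) * f (x + y)"
        using True growth(1) f_nonneg by (intro mult_right_mono) (auto intro!: mult_left_mono)
      finally show ?thesis using True by simp
    qed simp
  qed (use \<delta> window_integrable[OF f_meas f_nonneg f_le_exp] in \<open>auto intro!: integrable_mult_left\<close>)
  also have "\<dots> = exp (\<kappa> * \<delta>) * sm \<delta> f x"
    unfolding sm_def using window_integrable[OF f_meas f_nonneg f_le_exp] by simp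
  finally show ?thesis .
qed

lemma sm_f_le:
  assumes \<delta>: "0 \<le> \<delta>"
  shows "sm \<delta> f x \<le> \<delta> * exp (\<kappa> * \<delta>) * f x"
proof -
  have "sm \<delta> f x \<le> (\<integral>y. indicator {0..\<delta>} y * (exp (\<kappa> * \<delta>) * f x) \<partial>lborel)"
    unfolding sm_def
  proof (rule integral_mono)
    fix y
    show "indicator {0..\<delta>} y * f (x + y) \<le> indicator {0..\<delta>} y * (exp (\<kappa> * \<delta>) * f x)"
    proof (cases "y \<in> {0..\<delta>}")
      case True
      have "f (x + y) \<le> exp (\<kappa> * y) * f x"
        using growth(2)[of x "x + y"] True by simp
      also have "\<dots> \<le> exp (\<kappa> * \<delta>) * f x"
        using True growth(1) f_nonneg by (intro mult_right_mono) (auto intro!: mult_left_mono)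
      finally show ?thesis using True by simp
    qed simp
  qed (use \<delta> window_integrable[OF f_meas f_nonneg f_le_exp] in \<open>auto intro!: integrable_mult_left\<close>)
  then show ?thesis using \<delta> by (simp add: algebra_simps)
qed

lemma f_bounded: "\<exists>C. \<forall>x. f x \<le> C"
proof (intro exI allI)
  fix x
  define c where "c = (1 - q) * exp (- s)"
  have c: "0 < c" using q_less by (simp add: c_def)
  have "c * f x \<le> c * (exp \<kappa> * sm 1 f (x - 1))"
    using sm_f_ge[of 1 "x - 1"] c by (intro mult_left_mono) auto
  also have "\<dots> \<le> exp \<kappa> * (\<integral>y. g y \<partial>lborel)"
    using mult_left_mono[OF sm_f_bounded[of 1 "x - 1"], of "exp \<kappa>"] by (simp add: c_def mult_ac)
  finally show "f x \<le> exp \<kappa> * (\<integral>y. g y \<partial>lborel) / c"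
    using c by (simp add: field_simps)
qed

lemma window_f_integrable: "integrable lborel (\<lambda>y. indicator {a..b} y * f y)"
  using window_integrable[OF f_meas f_nonneg f_le_exp, of a b 0] by simp

text \<open>Moving the window affects the integral only over two strips of width |x - y|, one at
  each end.\<close>

lemma sm_f_lipschitz:
  assumes \<delta>: "0 \<le> \<delta>" and C: "\<And>x. f x \<le> C"
  shows "\<bar>sm \<delta> f x - sm \<delta> f y\<bar> \<le> 2 * C * \<bar>x - y\<bar>"
proof -
  have C0: "0 \<le> C" using order_trans[OF f_nonneg C[of 0]] .
  have le: "\<bar>sm \<delta> f y - sm \<delta> f x\<bar> \<le> 2 * C * (y - x)" if xy: "x \<le> y" for x y
  proof -
    have "\<bar>sm \<delta> f y - sm \<delta> f x\<bar>
      = \<bar>\<integral>z. indicator {y..y+\<delta>} z * f z - indicator {x..x+\<delta>} z * f z \<partial>lborel\<bar>"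
      unfolding sm_alt by (subst Bochner_Integration.integral_diff) (auto intro: window_f_integrable)
    also have "\<dots> \<le> (\<integral>z. \<bar>indicator {y..y+\<delta>} z * f z - indicator {x..x+\<delta>} z * f z\<bar> \<partial>lborel)"
      by (rule integral_abs_bound)
    also have "\<dots> \<le> (\<integral>z. indicator {x..y} z * C + indicator {x+\<delta>..y+\<delta>} z * C \<partial>lborel)"
    proof (rule integral_mono)
      show "\<bar>indicator {y..y+\<delta>} z * f z - indicator {x..x+\<delta>} z * f z\<bar>
        \<le> indicator {x..y} z * C + indicator {x+\<delta>..y+\<delta>} z * C" for z
        using C[of z] f_nonneg[of z] C0 xy \<delta> by (auto split: split_indicator)
      show "integrable lborel (\<lambda>z. indicator {x..y} z * C + indicator {x+\<delta>..y+\<delta>} z * C)"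
        using xy by (auto intro!: integrable_mult_left)
    qed (auto intro!: window_f_integrable integrable_abs Bochner_Integration.integrable_diff)
    also have "\<dots> = (\<integral>z. indicator {x..y} z * C \<partial>lborel) + (\<integral>z. indicator {x+\<delta>..y+\<delta>} z * C \<partial>lborel)"
      using xy by (intro Bochner_Integration.integral_add) (auto intro!: integrable_mult_left)
    also have "\<dots> = 2 * C * (y - x)" using xy by (simp add: algebra_simps)
    finally show ?thesis .
  qed
  show ?thesis
  proof (cases "x \<le> y")
    case True
    then show ?thesis using le[OF True] by (simp add: abs_minus_commute)
  next
    case False
    then show ?thesis using le[of y x] by simp
  qed
qed

text \<open>The moving window eventually leaves every fixed point behind, and g itself
  dominates.\<close>

lemma sm_g_tendsto_0: "(sm \<delta> g \<longlongrightarrow> 0) at_top"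
proof -
  have "((\<lambda>x. \<integral>y. indicator {x..x+\<delta>} y * g y \<partial>lborel) \<longlongrightarrow> integral\<^sup>L lborel (\<lambda>y::real. 0)) at_top"
  proof (rule integral_dominated_convergence_at_top[where w = g])
    show "AE y in lborel. ((\<lambda>x. indicator {x..x+\<delta>} y * g y) \<longlongrightarrow> 0) at_top"
    proof (intro AE_I2 tendsto_eventually)
      fix y
      show "\<forall>\<^sub>F x in at_top. indicator {x..x+\<delta>} y * g y = 0"
        using eventually_gt_at_top[of y] by eventually_elim auto
    qed
  qed (auto simp: g_nonneg g_integrable split: split_indicator)
  then show ?thesis by (simp add: sm_alt[abs_def])
qed

section \<open>Integrating the equation up to x, and the limit\<close>

lemma exp_atMost_integrable: "integrable lborel (\<lambda>y. indicator {..x} y * (c * exp (s * y)))"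
proof -
  \<comment> \<open>The half line is reflected to [-x, \<infinity>), where the exponential decays
    and the antiderivative has the limit 0.\<close>
  have "(\<integral>\<^sup>+y. ennreal (exp (- s * y)) * indicator {-x..} y \<partial>lborel) = ennreal (0 - (- exp (- s * (-x)) / s))"
  proof (rule nn_integral_FTC_atLeast)
    show "((\<lambda>y. - exp (- s * y) / s) has_real_derivative exp (- s * y)) (at y)" for y
      using s_pos by (auto intro!: derivative_eq_intros)
    have "filterlim (\<lambda>y. - s * y) at_bot at_top"
      using s_pos by (simp add: filterlim_uminus_at_bot filterlim_tendsto_pos_mult_at_top[OF tendsto_const _ filterlim_ident])
    then have "((\<lambda>y. - exp (- s * y) / s) \<longlongrightarrow> - 0 / s) at_top"
      using s_pos by (intro tendsto_intros filterlim_compose[OF exp_at_bot]) auto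
    then show "((\<lambda>y. - exp (- s * y) / s) \<longlongrightarrow> 0) at_top" by simp
  qed auto
  also have "(\<integral>\<^sup>+y. ennreal (exp (- s * y)) * indicator {-x..} y \<partial>lborel)
      = (\<integral>\<^sup>+y. ennreal (indicator {-x..} y * exp (- s * y)) \<partial>lborel)"
    by (intro nn_integral_cong) (auto split: split_indicator)
  finally have "(\<integral>\<^sup>+y. ennreal (indicator {-x..} y * exp (- s * y)) \<partial>lborel) < \<infinity>"
    by simp
  then have "integrable lborel (\<lambda>y. indicator {-x..} y * exp (- s * y))"
    by (intro integrableI_bounded) auto
  from lborel_integrable_real_affine[OF this, of "-1" 0]
  have "integrable lborel (\<lambda>y. indicator {-x..} (- y) * exp (s * y))" by simp
  also have "(\<lambda>y. indicator {-x..} (- y) * exp (s * y)) = (\<lambda>y. indicator {..x} y * exp (s * y))"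
    by (auto split: split_indicator)
  finally have "integrable lborel (\<lambda>y. c * (indicator {..x} y * exp (s * y)))" by simp
  then show ?thesis by (simp add: mult_ac)
qed

context
  fixes \<delta> C :: real
  assumes \<delta>: "0 < \<delta>" and C: "\<And>x. f x \<le> C"
begin

abbreviation "F \<equiv> sm \<delta> f"

lemma measurable_F [measurable]:
  "F \<in> borel_measurable borel" "sm \<delta> g \<in> borel_measurable borel" "T F \<in> borel_measurable borel"
  by (auto intro!: measurable_T measurable_sm)

lemma F_bounds: "0 \<le> F x" "F x \<le> \<delta> * exp (\<kappa> * \<delta>) * C" "\<bar>F x\<bar> \<le> \<delta> * exp (\<kappa> * \<delta>) * C"
proof -
  show a: "0 \<le> F x" by (rule sm_nonneg[OF f_nonneg])
  have "\<delta> * exp (\<kappa> * \<delta>) * f x \<le> \<delta> * exp (\<kappa> * \<delta>) * C"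
    using \<delta> C[of x] by (intro mult_left_mono) auto
  then show b: "F x \<le> \<delta> * exp (\<kappa> * \<delta>) * C" using order_trans[OF sm_f_le[of \<delta> x]] \<delta> by simp
  show "\<bar>F x\<bar> \<le> \<delta> * exp (\<kappa> * \<delta>) * C" using a b by simp
qed

lemma F_slowly_varying:
  assumes "\<epsilon> > 0"
  shows "\<forall>\<^sub>F x in at_top. \<forall>t. \<bar>t\<bar> \<le> U \<longrightarrow> \<bar>F (x + t) - F x\<bar> \<le> \<epsilon>"
proof (rule slowly_varying[OF _ F_bounds(3) sm_f_lipschitz])
  show "(D F \<longlongrightarrow> 0) at_top"
    using \<delta> by (intro D_tendsto_0[OF _ _ F_bounds(1,2) sm_nonneg[OF g_nonneg] sm_renewal_eq sm_g_tendsto_0])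
      auto
qed (use \<delta> C atomless assms in auto)

lemma F_le_exp: "F x \<le> (\<delta> * C0 * exp (s * \<delta>)) * exp (s * x)"
  using sm_le_exp[OF f_meas _ f_nonneg f_le_exp, of \<delta>] \<delta> by simp

lemma atMost_integrable:
  assumes [measurable]: "h \<in> borel_measurable borel"
    and "\<And>x. 0 \<le> h x" "\<And>x. h x \<le> c * exp (s * x)"
  shows "integrable lborel (\<lambda>y. indicator {..x} y * h y)"
  by (rule Bochner_Integration.integrable_bound[OF exp_atMost_integrable[of x c]])
     (use assms in \<open>auto intro!: AE_I2 intro: order_trans[OF _ abs_ge_self] split: split_indicator\<close>)

text \<open>A primitive of the smoothed f, finite because of the exponential bound at -\<infinity>.
  Through it the operator \<open>T\<close> becomes an increment over one step.\<close>

definition \<Phi> :: "real \<Rightarrow> real" where "\<Phi> x = (\<integral>y. indicator {..x} y * F y \<partial>lborel)"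

lemma F_atMost_integrable: "integrable lborel (\<lambda>y. indicator {..x} y * F y)"
  by (rule atMost_integrable[OF _ F_bounds(1) F_le_exp]) simp

lemma \<Phi>_nonneg: "0 \<le> \<Phi> x"
  unfolding \<Phi>_def using F_bounds(1) by (simp add: integral_nonneg_AE)

text \<open>The existence of some bound of this form is what matters: it makes \<Phi> (x - u)
  integrable over the steps u.\<close>

lemma \<Phi>_le_exp: "\<exists>K. \<forall>x. \<Phi> x \<le> K * exp (s * x)"
proof (intro exI allI)
  fix x
  let ?c = "\<delta> * C0 * exp (s * \<delta>)"
  have "\<Phi> x \<le> (\<integral>y. indicator {..x} y * (?c * exp (s * y)) \<partial>lborel)"
    unfolding \<Phi>_def
    by (intro integral_mono F_atMost_integrable exp_atMost_integrable mult_left_mono F_le_exp) auto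
  also have "\<dots> = (\<integral>y. indicator {..x} (x + 1 * y) * (?c * exp (s * (x + 1 * y))) \<partial>lborel)"
    using lborel_integral_real_affine[of 1 "\<lambda>y. indicator {..x} y * (?c * exp (s * y))" x] by simp
  also have "\<dots> = (\<integral>y. (indicator {..0} y * (?c * exp (s * y))) * exp (s * x) \<partial>lborel)"
    by (rule Bochner_Integration.integral_cong) (auto simp: distrib_left exp_add split: split_indicator)
  also have "\<dots> = (\<integral>y. indicator {..0} y * (?c * exp (s * y)) \<partial>lborel) * exp (s * x)"
    by (rule integral_mult_left_zero)
  finally show "\<Phi> x \<le> (\<integral>y. indicator {..0} y * (?c * exp (s * y)) \<partial>lborel) * exp (s * x)" .
qed

lemma measurable_\<Phi> [measurable]: "\<Phi> \<in> borel_measurable borel"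
proof -
  \<comment> \<open>The set {..x} varies with x; writing the indicator as a condition on the pair
    (x, y) exhibits joint measurability.\<close>
  have "(\<lambda>x. \<integral>y. (if y \<le> x then F y else 0) \<partial>lborel) \<in> borel_measurable borel" by measurable
  moreover have "\<Phi> x = (\<integral>y. (if y \<le> x then F y else 0) \<partial>lborel)" for x
    unfolding \<Phi>_def by (rule Bochner_Integration.integral_cong) auto
  ultimately show ?thesis by presburger
qed

lemma \<Phi>_diff_integrable: "integrable \<eta> (\<lambda>u. \<Phi> (x - u))"
  using \<Phi>_le_exp exp_class_integrable[OF measurable_\<Phi> \<Phi>_nonneg] by blast

text \<open>F = sm \<delta> g + T F is integrated over {..x}; by Fubini and a translation the last
  term becomes the mean of \<Phi> (x - u).\<close>

lemma \<Phi>_identity: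
  "(\<integral>y. indicator {..x} y * sm \<delta> g y \<partial>lborel) = (\<integral>u. \<Phi> x - \<Phi> (x - u) \<partial>\<eta>)"
proof -
  interpret P: pair_sigma_finite \<eta> lborel ..
  have aff: "(\<integral>y. indicator {..x} y * F (y - u) \<partial>lborel) = \<Phi> (x - u)"
    "integrable lborel (\<lambda>y. indicator {..x} y * F (y - u))" for u
  proof -
    have eq: "(\<lambda>y. indicator {..x - u} (- u + 1 * y) * F (- u + 1 * y)) = (\<lambda>y. indicator {..x} y * F (y - u))"
      by (auto split: split_indicator)
    show "(\<integral>y. indicator {..x} y * F (y - u) \<partial>lborel) = \<Phi> (x - u)"
      unfolding \<Phi>_def eq[symmetric] by (subst lborel_integral_real_affine[of 1 _ "-u"]) auto
    show "integrable lborel (\<lambda>y. indicator {..x} y * F (y - u))"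
      unfolding eq[symmetric] by (rule lborel_integrable_real_affine[OF F_atMost_integrable]) simp
  qed
  have "integrable (\<eta> \<Otimes>\<^sub>M lborel) (\<lambda>(u, y). indicator {..x} y * F (y - u))"
  proof (rule P.Fubini_integrable)
    show "integrable \<eta> (\<lambda>u. \<integral>y. norm (case (u, y) of (u, y) \<Rightarrow> indicator {..x} y * F (y - u)) \<partial>lborel)"
      using \<Phi>_diff_integrable[of x] by (simp add: aff abs_mult F_bounds(1))
    show "AE u in \<eta>. integrable lborel (\<lambda>y. case (u, y) of (u, y) \<Rightarrow> indicator {..x} y * F (y - u))"
      using aff(2) by simp
  qed measurable
  from P.Fubini_integral[OF this]
  have TF: "(\<integral>y. indicator {..x} y * T F y \<partial>lborel) = (\<integral>u. \<Phi> (x - u) \<partial>\<eta>)"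
    by (simp add: T_def aff)
  have smg: "sm \<delta> g y \<le> F y" "T F y \<le> F y" for y
    using sm_renewal_eq[of \<delta> y] \<delta> T_nonneg[of F, OF F_bounds(1)] sm_nonneg[of g, OF g_nonneg, of \<delta> y] by auto
  have "\<Phi> x = (\<integral>y. indicator {..x} y * sm \<delta> g y + indicator {..x} y * T F y \<partial>lborel)"
    unfolding \<Phi>_def using sm_renewal_eq[of \<delta>] \<delta> by (simp add: distrib_left[symmetric])
  also have "\<dots> = (\<integral>y. indicator {..x} y * sm \<delta> g y \<partial>lborel) + (\<integral>y. indicator {..x} y * T F y \<partial>lborel)"
  proof (rule Bochner_Integration.integral_add)
    show "integrable lborel (\<lambda>y. indicator {..x} y * sm \<delta> g y)"
      by (rule atMost_integrable[OF _ sm_nonneg[OF g_nonneg] order_trans[OF smg(1) F_le_exp]]) simp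
    show "integrable lborel (\<lambda>y. indicator {..x} y * T F y)"
      by (rule atMost_integrable[OF _ T_nonneg[OF F_bounds(1)] order_trans[OF smg(2) F_le_exp]]) measurable
  qed
  finally show ?thesis unfolding TF using \<Phi>_diff_integrable[of x] by simp
qed

text \<open>A mean value estimate for the primitive of F, for u of either sign, because steps of
  both signs may occur.\<close>

lemma \<Phi>_increment:
  assumes "\<And>t. \<bar>t\<bar> \<le> \<bar>u\<bar> \<Longrightarrow> \<bar>F (x + t) - F x\<bar> \<le> \<epsilon>"
  shows "\<bar>\<Phi> x - \<Phi> (x - u) - u * F x\<bar> \<le> \<epsilon> * \<bar>u\<bar>"
proof -
  have e: "0 \<le> \<epsilon>" using assms[of 0] by simp
  have *: "\<bar>\<Phi> b - \<Phi> a - (b - a) * y\<bar> \<le> \<epsilon> * (b - a)"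
    if ab: "a \<le> b" and le: "\<And>z. a \<le> z \<Longrightarrow> z \<le> b \<Longrightarrow> \<bar>F z - y\<bar> \<le> \<epsilon>" for a b y
  proof -
    have i: "integrable lborel (\<lambda>z. indicator {a<..b} z * F z)"
    proof -
      have "integrable lborel (\<lambda>z. indicator {..b} z * F z - indicator {..a} z * F z)"
        by (intro Bochner_Integration.integrable_diff F_atMost_integrable)
      also have "(\<lambda>z. indicator {..b} z * F z - indicator {..a} z * F z) = (\<lambda>z. indicator {a<..b} z * F z)"
        using ab by (auto split: split_indicator)
      finally show ?thesis .
    qed
    have j: "integrable lborel (\<lambda>z. indicator {a<..b} z * c)" for c :: real
      using ab by (auto intro!: integrable_mult_left)
    have "\<Phi> b - \<Phi> a = (\<integral>z. indicator {..b} z * F z - indicator {..a} z * F z \<partial>lborel)"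
      unfolding \<Phi>_def by (subst Bochner_Integration.integral_diff) (auto intro: F_atMost_integrable)
    also have "\<dots> = (\<integral>z. indicator {a<..b} z * F z \<partial>lborel)"
      using ab by (intro Bochner_Integration.integral_cong) (auto split: split_indicator)
    finally have "\<Phi> b - \<Phi> a - (b - a) * y = (\<integral>z. indicator {a<..b} z * F z \<partial>lborel) - (\<integral>z. indicator {a<..b} z * y \<partial>lborel)"
      using ab by simp
    also have "\<dots> = (\<integral>z. indicator {a<..b} z * F z - indicator {a<..b} z * y \<partial>lborel)"
      by (rule Bochner_Integration.integral_diff[OF i j, symmetric])
    finally have "\<bar>\<Phi> b - \<Phi> a - (b - a) * y\<bar> \<le> (\<integral>z. \<bar>indicator {a<..b} z * F z - indicator {a<..b} z * y\<bar> \<partial>lborel)"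
      using integral_abs_bound by metis
    also have "\<dots> \<le> (\<integral>z. indicator {a<..b} z * \<epsilon> \<partial>lborel)"
      using i j le by (intro integral_mono) (auto split: split_indicator)
    also have "\<dots> = \<epsilon> * (b - a)" using ab by simp
    finally show ?thesis .
  qed
  show ?thesis
  proof (cases "0 \<le> u")
    case True
    have "\<bar>F z - F x\<bar> \<le> \<epsilon>" if "x - u \<le> z" "z \<le> x" for z
      using assms[of "z - x"] that by auto
    from *[of "x - u" x, OF _ this] True show ?thesis by simp
  next
    case False
    have "\<bar>F z - F x\<bar> \<le> \<epsilon>" if "x \<le> z" "z \<le> x - u" for z
      using assms[of "z - x"] that by auto
    from *[of x "x - u", OF _ this] False show ?thesis by (simp add: abs_minus_commute)
  qed
qed

lemma sm_g_integral:
  "integrable lborel (sm \<delta> g)" "(\<integral>x. sm \<delta> g x \<partial>lborel) = \<delta> * (\<integral>x. g x \<partial>lborel)"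
proof -
  have aff: "integrable lborel (\<lambda>x. g (x + y))" "(\<integral>x. g (x + y) \<partial>lborel) = (\<integral>x. g x \<partial>lborel)" for y
    using lborel_integrable_real_affine[OF g_integrable, of 1 y] lborel_integral_real_affine[of 1 g y]
    by (simp_all add: add.commute)
  have "integrable (lborel \<Otimes>\<^sub>M lborel) (\<lambda>(y, x). indicator {0..\<delta>} y * g (x + y))"
  proof (rule lborel_pair.Fubini_integrable)
    show "integrable lborel (\<lambda>y. \<integral>x. norm (case (y, x) of (y, x) \<Rightarrow> indicator {0..\<delta>} y * g (x + y)) \<partial>lborel)"
      using aff \<delta> by (simp add: abs_mult g_nonneg integrable_mult_left)
    show "AE y in lborel. integrable lborel (\<lambda>x. case (y, x) of (y, x) \<Rightarrow> indicator {0..\<delta>} y * g (x + y))"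
      using aff by simp
  qed measurable
  from lborel_pair.Fubini_integral[OF this] lborel_pair.integrable_snd[OF this]
  show "integrable lborel (sm \<delta> g)" "(\<integral>x. sm \<delta> g x \<partial>lborel) = \<delta> * (\<integral>x. g x \<partial>lborel)"
    using aff \<delta> by (simp_all add: sm_def[abs_def])
qed

text \<open>In \<open>\<Phi>_identity\<close> the left side tends to the integral of the smoothed g,
  while slow variation makes the right side the mean step times F x up to o(1). Convergence of F and
  the value of its limit come together.\<close>

lemma F_tendsto: "(F \<longlongrightarrow> \<delta> * (\<integral>x. g x \<partial>lborel) / (\<integral>u. u \<partial>\<eta>)) at_top"
proof -
  let ?m = "\<integral>u. u \<partial>\<eta>"
  let ?B = "\<delta> * exp (\<kappa> * \<delta>) * C"
  have G: "((\<lambda>x. \<integral>y. indicator {..x} y * sm \<delta> g y \<partial>lborel) \<longlongrightarrow> (\<integral>y. sm \<delta> g y \<partial>lborel)) at_top"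
  proof (rule integral_dominated_convergence_at_top[where w = "sm \<delta> g"])
    show "AE y in lborel. ((\<lambda>x. indicator {..x} y * sm \<delta> g y) \<longlongrightarrow> sm \<delta> g y) at_top"
    proof (intro AE_I2 tendsto_eventually)
      fix y
      show "\<forall>\<^sub>F x in at_top. indicator {..x} y * sm \<delta> g y = sm \<delta> g y"
        using eventually_gt_at_top[of y] by eventually_elim auto
    qed
  qed (use sm_g_integral in \<open>auto simp: sm_nonneg[OF g_nonneg] split: split_indicator\<close>)
  have R: "((\<lambda>x. \<integral>u. \<Phi> x - \<Phi> (x - u) - u * F x \<partial>\<eta>) \<longlongrightarrow> (\<integral>u. 0 \<partial>\<eta>)) at_top"
  \<comment> \<open>Any two values of F differ by at most 2 B, so the error is at most 2 B |u|,
    integrable since the step has a finite mean.\<close>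
  proof (rule integral_dominated_convergence_at_top[where w = "\<lambda>u. 2 * ?B * \<bar>u\<bar>"])
    show "integrable \<eta> (\<lambda>u. 2 * ?B * \<bar>u\<bar>)"
      using step_integrable by (intro integrable_mult_right integrable_abs)
    have "\<bar>\<Phi> x - \<Phi> (x - u) - u * F x\<bar> \<le> 2 * ?B * \<bar>u\<bar>" for x u
    proof (rule \<Phi>_increment)
      show "\<bar>F (x + t) - F x\<bar> \<le> 2 * ?B" for t
        unfolding mult_2 by (rule abs_diff_le[OF F_bounds(3) F_bounds(3)])
    qed
    then show "\<forall>\<^sub>F x in at_top. AE u in \<eta>. norm (\<Phi> x - \<Phi> (x - u) - u * F x) \<le> 2 * ?B * \<bar>u\<bar>"
      by simp
    show "AE u in \<eta>. ((\<lambda>x. \<Phi> x - \<Phi> (x - u) - u * F x) \<longlongrightarrow> 0) at_top"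
    proof (intro AE_I2 tendstoI)
      fix u \<epsilon> :: real assume e: "0 < \<epsilon>"
      define \<epsilon>' where "\<epsilon>' = \<epsilon> / (\<bar>u\<bar> + 1)"
      have e': "0 < \<epsilon>'" "\<epsilon>' * \<bar>u\<bar> < \<epsilon>" using e by (auto simp: \<epsilon>'_def field_simps)
      show "\<forall>\<^sub>F x in at_top. dist (\<Phi> x - \<Phi> (x - u) - u * F x) 0 < \<epsilon>"
        using F_slowly_varying[OF e'(1), of "\<bar>u\<bar>"]
      proof eventually_elim
        case (elim x)
        then show ?case using \<Phi>_increment[of u x \<epsilon>'] e'(2) by (simp add: dist_real_def)
      qed
    qed
  qed auto
  have "(\<integral>u. \<Phi> x - \<Phi> (x - u) - u * F x \<partial>\<eta>)
     = (\<integral>y. indicator {..x} y * sm \<delta> g y \<partial>lborel) - ?m * F x" for x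
    unfolding \<Phi>_identity using \<Phi>_diff_integrable[of x] step_integrable by simp
  with R have "((\<lambda>x. (\<integral>y. indicator {..x} y * sm \<delta> g y \<partial>lborel) - ?m * F x) \<longlongrightarrow> 0) at_top"
    by simp
  from tendsto_diff[OF G this] have "((\<lambda>x. ?m * F x) \<longlongrightarrow> \<delta> * (\<integral>x. g x \<partial>lborel)) at_top"
    by (simp add: sm_g_integral)
  from tendsto_divide[OF this tendsto_const[of ?m]] show ?thesis
    using step_mean by simp
qed

end

theorem f_tendsto: "(f \<longlongrightarrow> (\<integral>x. g x \<partial>lborel) / (\<integral>u. u \<partial>\<eta>)) at_top"
proof -
  let ?c = "(\<integral>x. g x \<partial>lborel) / (\<integral>u. u \<partial>\<eta>)"
  obtain C where C: "\<And>x. f x \<le> C" using f_bounded by blast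
  have c: "0 \<le> ?c" using step_mean by (simp add: integral_nonneg_AE g_nonneg)
  have lim: "((\<lambda>x. sm \<delta> f x / \<delta>) \<longlongrightarrow> ?c) at_top" if "0 < \<delta>" for \<delta>
  proof -
    have "((\<lambda>x. sm \<delta> f x / \<delta>) \<longlongrightarrow> (\<delta> * (\<integral>x. g x \<partial>lborel) / (\<integral>u. u \<partial>\<eta>)) / \<delta>) at_top"
      by (intro tendsto_divide F_tendsto[OF that C] tendsto_const) (use that in auto)
    then show ?thesis using that by simp
  qed
  show ?thesis
  proof (rule order_tendstoI)
    fix a assume a: "a < ?c"
    \<comment> \<open>The window average just to the right of x exceeds f x at most by the factor
      exp (\<kappa> \<delta>), which a small \<delta> makes harmless. The upper bound uses the
      window just to the left of x.\<close>
    have "((\<lambda>\<delta>. exp (\<kappa> * \<delta>) * a) \<longlongrightarrow> exp (\<kappa> * 0) * a) (at_right 0)"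
      by (intro tendsto_intros)
    then have "\<forall>\<^sub>F \<delta> in at_right 0. exp (\<kappa> * \<delta>) * a < ?c"
      by (rule order_tendstoD) (use a in simp)
    moreover have "\<forall>\<^sub>F \<delta> in at_right 0. (0::real) < \<delta>" by (simp add: eventually_at_right_less)
    ultimately obtain \<delta> where \<delta>: "0 < \<delta>" "exp (\<kappa> * \<delta>) * a < ?c"
      using eventually_happens'[OF trivial_limit_at_right_real eventually_conj] by blast
    show "\<forall>\<^sub>F x in at_top. a < f x"
      using order_tendstoD(1)[OF lim[OF \<delta>(1)] \<delta>(2)]
    proof eventually_elim
      case (elim x)
      have "sm \<delta> f x / \<delta> \<le> exp (\<kappa> * \<delta>) * f x"
        using sm_f_le[of \<delta> x] \<delta>(1) by (simp add: field_simps)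
      with elim have "exp (\<kappa> * \<delta>) * a < exp (\<kappa> * \<delta>) * f x" by (rule less_le_trans)
      then show ?case by (subst (asm) mult_less_cancel_left_pos) auto
    qed
  next
    fix a assume a: "?c < a"
    have "((\<lambda>\<delta>. exp (- \<kappa> * \<delta>) * a) \<longlongrightarrow> exp (- \<kappa> * 0) * a) (at_right 0)"
      by (intro tendsto_intros)
    then have "\<forall>\<^sub>F \<delta> in at_right 0. ?c < exp (- \<kappa> * \<delta>) * a"
      by (rule order_tendstoD) (use a in simp)
    moreover have "\<forall>\<^sub>F \<delta> in at_right 0. (0::real) < \<delta>" by (simp add: eventually_at_right_less)
    ultimately obtain \<delta> where \<delta>: "0 < \<delta>" "?c < exp (- \<kappa> * \<delta>) * a"
      using eventually_happens'[OF trivial_limit_at_right_real eventually_conj] by blast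
    have "filterlim (\<lambda>x. x - \<delta>) at_top at_top"
      using filterlim_tendsto_add_at_top[OF tendsto_const[of "-\<delta>"] filterlim_ident] by simp
    from filterlim_compose[OF lim[OF \<delta>(1)] this]
    have "\<forall>\<^sub>F x in at_top. sm \<delta> f (x - \<delta>) / \<delta> < exp (- \<kappa> * \<delta>) * a"
      using \<delta>(2) by (rule order_tendstoD(2))
    then show "\<forall>\<^sub>F x in at_top. f x < a"
    proof eventually_elim
      case (elim x)
      have "f x \<le> exp (\<kappa> * \<delta>) * (sm \<delta> f (x - \<delta>) / \<delta>)"
        using sm_f_ge[of \<delta> "x - \<delta>"] \<delta>(1) by (simp add: field_simps)
      also have "\<dots> < exp (\<kappa> * \<delta>) * (exp (- \<kappa> * \<delta>) * a)"
        using elim by (intro mult_strict_left_mono) auto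
      also have "\<dots> = a" by (simp add: mult.assoc[symmetric] exp_add[symmetric])
      finally show ?case .
    qed
  qed
qed

end

section \<open>Implicit renewal\<close>

lemma one_add_less_exp:
  assumes "x \<noteq> (0::real)"
  shows "1 + x < exp x"
proof (cases "0 \<le> 1 + x / 2")
  case True
  have "1 + x < (1 + x / 2)\<^sup>2" using assms zero_less_power2[of x] by (simp add: power2_eq_square algebra_simps zero_less_mult_iff linorder_neq_iff)
  also have "\<dots> \<le> (exp (x / 2))\<^sup>2" using True by (intro power_mono) auto
  also have "\<dots> = exp x" by (simp add: power2_eq_square exp_add[symmetric])
  finally show ?thesis .
next
  case False
  then have "1 + x < 0" by simp
  also have "0 < exp x" by simp
  finally show ?thesis .
qed

text \<open>With y = a ln x this is 1 - y < exp (- y). Taking means where E A^a = 1 makes the left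
  side vanish, so the tilted step has a positive mean.\<close>

lemma powr_mul_ln_gt:
  assumes "0 < x" "x \<noteq> 1" "0 < (a::real)"
  shows "x powr a - 1 < a * (x powr a * ln x)"
proof -
  define y where "y = a * ln x"
  have y: "- y \<noteq> 0" using assms by (simp add: y_def)
  have "(1 - y) * exp y < exp (- y) * exp y"
    using one_add_less_exp[OF y] by (intro mult_strict_right_mono) auto
  then have "exp y - 1 < y * exp y" by (simp add: exp_add[symmetric] algebra_simps)
  then show ?thesis using assms(1) by (simp add: y_def powr_def mult_ac)
qed

text \<open>Strict convexity of the power in its exponent, between the exponents 0 and a. Taking
  means where E A^a = 1 gives E A^r < 1.\<close>

lemma powr_less_interpolate:
  assumes "0 < x" "x \<noteq> 1" "0 < r" "r < (a::real)"
  shows "x powr r < 1 + r / a * (x powr a - 1)"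
proof -
  define p z where "p = r / a" and "z = a * ln x"
  have p: "0 < p" "p < 1" using assms by (auto simp: p_def)
  have z: "z \<noteq> 0" using assms by (simp add: z_def)
  \<comment> \<open>The tangent line of exp at p z, evaluated at z and at 0; weighted by p and 1 -
    p, the linear terms cancel.\<close>
  have "exp (p * z) = exp (p * z) * (p * (1 + (1 - p) * z) + (1 - p) * (1 + - (p * z)))"
    by (simp add: algebra_simps)
  also have "\<dots> < exp (p * z) * (p * exp ((1 - p) * z) + (1 - p) * exp (- (p * z)))"
    using p z by (intro mult_strict_left_mono add_strict_mono one_add_less_exp) auto
  also have "\<dots> = p * exp z + (1 - p)"
    by (simp add: distrib_left exp_add[symmetric] mult.left_commute algebra_simps)
  finally have "exp (p * z) < 1 + p * (exp z - 1)" by (simp add: algebra_simps)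
  moreover have "p * z = r * ln x" using assms by (simp add: p_def z_def)
  ultimately show ?thesis using assms(1) by (simp add: p_def z_def powr_def)
qed

context prob_space
begin

lemma AE_neq_of_prob_0:
  fixes X :: "'a \<Rightarrow> real"
  assumes [measurable]: "X \<in> borel_measurable M" and "prob {w \<in> space M. X w = v} = 0"
  shows "AE w in M. X w \<noteq> v"
  using assms(2) by (intro AE_I[where N = "{w \<in> space M. X w = v}"]) (auto simp: emeasure_eq_measure)

text \<open>A level set of the quadratic consists of at most two points.\<close>

lemma quadratic_atomless:
  fixes X :: "'a \<Rightarrow> real"
  assumes [measurable]: "X \<in> borel_measurable M" and X: "\<And>x. prob {w \<in> space M. X w = x} = 0"
    and a: "0 < a"
  shows "prob {w \<in> space M. a * (X w)\<^sup>2 + b = v} = 0"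
proof -
  have "AE w in M. w \<notin> {w \<in> space M. a * (X w)\<^sup>2 + b = v}"
    using AE_neq_of_prob_0[OF assms(1) X, of "sqrt ((v - b) / a)"]
      AE_neq_of_prob_0[OF assms(1) X, of "- sqrt ((v - b) / a)"]
  proof eventually_elim
    case (elim w)
    have "a * (X w)\<^sup>2 + b \<noteq> v"
    proof
      assume "a * (X w)\<^sup>2 + b = v"
      then have "(X w)\<^sup>2 = (v - b) / a" using a by (simp add: field_simps)
      then have "\<bar>X w\<bar> = sqrt ((v - b) / a)" by (metis real_sqrt_abs)
      then show False using elim by linarith
    qed
    then show ?case by simp
  qed
  then show ?thesis by (subst prob_eq_0) auto
qed

text \<open>Fubini for the joint law of X and Y, with the product space traded for two integrations
  over \<open>M\<close>.\<close>

lemma integral_indep_var: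
  fixes h :: "'b \<times> 'b \<Rightarrow> real"
  assumes ind: "indep_var S X N Y" and h [measurable]: "h \<in> borel_measurable (S \<Otimes>\<^sub>M N)"
    and int: "integrable M (\<lambda>w. h (X w, Y w))"
  shows "(\<integral>w. h (X w, Y w) \<partial>M) = (\<integral>v. \<integral>w. h (X v, Y w) \<partial>M \<partial>M)"
proof -
  have [measurable]: "X \<in> measurable M S" "Y \<in> measurable M N"
    and D: "distr M S X \<Otimes>\<^sub>M distr M N Y = distr M (S \<Otimes>\<^sub>M N) (\<lambda>w. (X w, Y w))"
    using ind by (auto simp: indep_var_distribution_eq)
  interpret DX: prob_space "distr M S X" by (rule prob_space_distr) simp
  interpret DY: prob_space "distr M N Y" by (rule prob_space_distr) simp
  interpret P: pair_sigma_finite "distr M S X" "distr M N Y" ..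
  have int': "integrable (distr M S X \<Otimes>\<^sub>M distr M N Y) h"
    unfolding D by (subst integrable_distr_eq) (use int in auto)
  have "(\<integral>w. h (X w, Y w) \<partial>M) = (\<integral>z. h z \<partial>(distr M S X \<Otimes>\<^sub>M distr M N Y))"
    unfolding D by (subst integral_distr) auto
  also have "\<dots> = (\<integral>x. \<integral>y. h (x, y) \<partial>distr M N Y \<partial>distr M S X)"
    using P.integral_fst'[OF int'] by simp
  also have "\<dots> = (\<integral>v. \<integral>w. h (X v, Y w) \<partial>M \<partial>M)"
  proof (subst integral_distr)
    show "(\<integral>v. (\<integral>y. h (X v, y) \<partial>distr M N Y) \<partial>M) = (\<integral>v. \<integral>w. h (X v, Y w) \<partial>M \<partial>M)"
    proof (rule Bochner_Integration.integral_cong[OF refl])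
      fix v assume "v \<in> space M"
      then have [measurable]: "X v \<in> space S" by (rule measurable_space[rotated]) simp
      show "(\<integral>y. h (X v, y) \<partial>distr M N Y) = (\<integral>w. h (X v, Y w) \<partial>M)"
        by (rule integral_distr) measurable
    qed
  qed (auto intro!: DY.borel_measurable_lebesgue_integral)
  finally show ?thesis .
qed

lemma prob_distr_cong:
  assumes "distr M borel X = distr M borel Y" "{x. P x} \<in> sets borel"
    "X \<in> borel_measurable M" "Y \<in> borel_measurable M"
  shows "prob {w \<in> space M. P (X w)} = prob {w \<in> space M. P (Y w)}"
proof -
  have "prob {w \<in> space M. P (X w)} = measure (distr M borel X) {x. P x}"
    using assms by (subst measure_distr) (auto intro!: arg_cong[where f = prob])
  also have "\<dots> = prob {w \<in> space M. P (Y w)}"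
    unfolding assms(1) using assms by (subst measure_distr) (auto intro!: arg_cong[where f = prob])
  finally show ?thesis .
qed

text \<open>Provides the contraction factor: q < 1 in the renewal argument and in the moment bounds
  for the partial sums of the volatility series.\<close>

lemma moment_less_1:
  fixes A :: "'a \<Rightarrow> real"
  assumes [measurable]: "A \<in> borel_measurable M" and pos: "\<And>w. 0 < A w"
    and int: "integrable M (\<lambda>w. A w powr \<alpha>)" and one: "(\<integral>w. A w powr \<alpha> \<partial>M) = 1"
    and ne: "prob {w \<in> space M. A w = 1} = 0" and r: "0 < r" "r < \<alpha>"
  shows "integrable M (\<lambda>w. A w powr r)" "(\<integral>w. A w powr r \<partial>M) < 1"
proof -
  have le: "A w powr r \<le> 1 + r / \<alpha> * (A w powr \<alpha> - 1)" for w
    using powr_less_interpolate[OF pos _ r, of w] by (cases "A w = 1") auto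
  have i2: "integrable M (\<lambda>w. 1 + r / \<alpha> * (A w powr \<alpha> - 1))" using int by simp
  show i: "integrable M (\<lambda>w. A w powr r)"
    by (rule Bochner_Integration.integrable_bound[OF i2])
       (use le in \<open>auto intro: order_trans[OF _ abs_ge_self]\<close>)
  have "AE w in M. A w \<noteq> 1" by (rule AE_neq_of_prob_0[OF assms(1) ne])
  then have "AE w in M. A w powr r < 1 + r / \<alpha> * (A w powr \<alpha> - 1)"
    by eventually_elim (use powr_less_interpolate[OF pos _ r] in blast)
  then have "(\<integral>w. A w powr r \<partial>M) < (\<integral>w. 1 + r / \<alpha> * (A w powr \<alpha> - 1) \<partial>M)"
    by (intro integral_less_AE_space[OF i i2]) (auto simp: emeasure_space_1)
  then show "(\<integral>w. A w powr r \<partial>M) < 1"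
    using int one by (simp add: prob_space)
qed

lemma tilted_mean_pos:
  fixes A :: "'a \<Rightarrow> real"
  assumes [measurable]: "A \<in> borel_measurable M" and pos: "\<And>w. 0 < A w"
    and int: "integrable M (\<lambda>w. A w powr \<alpha>)" and one: "(\<integral>w. A w powr \<alpha> \<partial>M) = 1"
    and int2: "integrable M (\<lambda>w. A w powr \<alpha> * ln (A w))"
    and ne: "prob {w \<in> space M. A w = 1} = 0" and \<alpha>: "0 < \<alpha>"
  shows "0 < (\<integral>w. A w powr \<alpha> * ln (A w) \<partial>M)"
proof -
  have "AE w in M. A w \<noteq> 1" by (rule AE_neq_of_prob_0[OF assms(1) ne])
  then have "AE w in M. A w powr \<alpha> - 1 < \<alpha> * (A w powr \<alpha> * ln (A w))"
    by eventually_elim (use powr_mul_ln_gt[OF pos _ \<alpha>] in blast)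
  then have "(\<integral>w. A w powr \<alpha> - 1 \<partial>M) < (\<integral>w. \<alpha> * (A w powr \<alpha> * ln (A w)) \<partial>M)"
    by (intro integral_less_AE_space) (use int int2 in \<open>auto simp: emeasure_space_1\<close>)
  then show ?thesis using int one \<alpha> by (simp add: prob_space zero_less_mult_iff)
qed

text \<open>The limit is proportional to the integral of g, that is, to E[R^\<alpha> - (A R')^\<alpha>].\<close>

theorem implicit_renewal:
  fixes A R R' :: "'a \<Rightarrow> real"
  assumes mA [measurable]: "A \<in> borel_measurable M"
    and mR [measurable]: "R \<in> borel_measurable M" and mR' [measurable]: "R' \<in> borel_measurable M"
    and ind: "indep_var borel A borel R'" and ident: "distr M borel R' = distr M borel R"
    and \<beta>: "0 < \<beta>" "\<And>w. \<beta> \<le> A w"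
    and R': "AE w in M. 0 < R' w" and less: "AE w in M. A w * R' w < R w"
    and \<alpha>: "0 < \<alpha>" and intA: "integrable M (\<lambda>w. A w powr \<alpha>)"
    and oneA: "(\<integral>w. A w powr \<alpha> \<partial>M) = 1"
    and logA: "integrable M (\<lambda>w. A w powr \<alpha> * max (ln (A w)) 0)"
    and atomless: "\<And>v. prob {w \<in> space M. A w = v} = 0"
    and r: "0 < r" "r < \<alpha>" "integrable M (\<lambda>w. R w powr r)"
    and diff: "integrable M (\<lambda>w. R w powr \<alpha> - (A w * R' w) powr \<alpha>)"
  shows "\<exists>c>0. ((\<lambda>x. x powr \<alpha> * prob {w \<in> space M. R w > x}) \<longlongrightarrow> c) at_top"
proof -
  have Apos: "0 < A w" for w using \<beta>(1) \<beta>(2)[of w] by simp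
  define \<eta> where "\<eta> = distr (density M (\<lambda>w. ennreal (A w powr \<alpha>))) borel (\<lambda>w. ln (A w))"
  have int_\<eta>: "(\<integral>u. h u \<partial>\<eta>) = (\<integral>w. A w powr \<alpha> * h (ln (A w)) \<partial>M)"
    if [measurable]: "h \<in> borel_measurable borel" for h :: "real \<Rightarrow> real"
    unfolding \<eta>_def by (subst integral_distr) (auto simp: integral_density)
  have itg_\<eta>: "integrable \<eta> h \<longleftrightarrow> integrable M (\<lambda>w. A w powr \<alpha> * h (ln (A w)))"
    if [measurable]: "h \<in> borel_measurable borel" for h :: "real \<Rightarrow> real"
    unfolding \<eta>_def by (subst integrable_distr_eq) (auto simp: integrable_density)
  have p\<eta>: "prob_space \<eta>"
    unfolding \<eta>_def
  proof (rule prob_space.prob_space_distr[OF prob_spaceI])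
    have "emeasure (density M (\<lambda>w. ennreal (A w powr \<alpha>))) (space M) = (\<integral>\<^sup>+w. ennreal (A w powr \<alpha>) \<partial>M)"
      by (subst emeasure_density) (auto intro!: nn_integral_cong)
    also have "\<dots> = ennreal 1" using intA oneA by (subst nn_integral_eq_integral) auto
    finally show "emeasure (density M (\<lambda>w. ennreal (A w powr \<alpha>)))
      (space (density M (\<lambda>w. ennreal (A w powr \<alpha>)))) = 1" by simp
  qed simp
  interpret E: real_step \<eta>
    by (rule real_step.intro[OF p\<eta>]) (unfold_locales, simp add: \<eta>_def)
  \<comment> \<open>The negative part of ln A is bounded through A \<ge> \<beta>, so control of the
    positive part suffices.\<close>
  have int_ln: "integrable M (\<lambda>w. A w powr \<alpha> * ln (A w))"
  proof (rule Bochner_Integration.integrable_bound)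
    show "integrable M (\<lambda>w. A w powr \<alpha> * max (ln (A w)) 0 + \<bar>ln \<beta>\<bar> * A w powr \<alpha>)"
      using logA intA by simp
    show "AE w in M. norm (A w powr \<alpha> * ln (A w)) \<le> norm (A w powr \<alpha> * max (ln (A w)) 0 + \<bar>ln \<beta>\<bar> * A w powr \<alpha>)"
    proof (intro AE_I2)
      fix w
      have "ln \<beta> \<le> ln (A w)" using \<beta> Apos by simp
      then have "\<bar>ln (A w)\<bar> \<le> max (ln (A w)) 0 + \<bar>ln \<beta>\<bar>" by linarith
      from mult_left_mono[OF this, of "A w powr \<alpha>"]
      show "norm (A w powr \<alpha> * ln (A w)) \<le> norm (A w powr \<alpha> * max (ln (A w)) 0 + \<bar>ln \<beta>\<bar> * A w powr \<alpha>)"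
        by (simp add: abs_mult algebra_simps)
    qed
  qed simp
  \<comment> \<open>Under the tilted law exp (- s u) has the mean E A^(\<alpha> - s) = E A^r, which
    is less than 1.\<close>
  define s where "s = \<alpha> - r"
  have exp_s: "A w powr \<alpha> * exp (- s * ln (A w)) = A w powr r" for w
    using Apos[of w] by (simp add: powr_def s_def exp_add[symmetric] algebra_simps)
  define q where "q = (\<integral>w. A w powr r \<partial>M)"
  define f where "f x = exp (\<alpha> * x) * (\<integral>w. (if exp x < R w then 1 else 0) \<partial>M)" for x
  \<comment> \<open>Since A R' < R almost surely, P(R > e^x) exceeds P(A R' > e^x) exactly by the
    probability that e^x lies in [A R', R). Hence the remainder of the renewal equation is
    nonnegative.\<close>
  define g where "g x = exp (\<alpha> * x) * (\<integral>w. (if A w * R' w \<le> exp x \<and> exp x < R w then 1 else 0) \<partial>M)" for x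
  define C0 where "C0 = (\<integral>w. R w powr r \<partial>M)"
  have ib: "integrable M (\<lambda>w. if P w then 1 else (0::real))" if [measurable]: "Measurable.pred M P" for P
    by (rule integrable_const_bound[of _ 1]) auto
  have f_prob: "f x = exp (\<alpha> * x) * prob {w \<in> space M. exp x < R w}" for x
  proof -
    have "(\<integral>w. (if exp x < R w then 1 else 0) \<partial>M) = (\<integral>w. indicator {w \<in> space M. exp x < R w} w \<partial>M :: real)"
      by (intro Bochner_Integration.integral_cong) (auto simp: indicator_def)
    then show ?thesis by (simp add: f_def)
  qed
  have Rpos: "AE w in M. 0 < R w" using R' less
    by eventually_elim (use Apos in \<open>auto intro: less_trans[rotated]\<close>)
  \<comment> \<open>After the integrals are exchanged, exp (\<alpha> x) is integrated for each
    outcome over the interval from ln (A R') to ln R.\<close>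
  have g_nn: "(\<integral>\<^sup>+x. ennreal (g x) \<partial>lborel) = (\<integral>\<^sup>+w. ennreal ((R w powr \<alpha> - (A w * R' w) powr \<alpha>) / \<alpha>) \<partial>M)"
  proof -
    have "(\<integral>\<^sup>+x. ennreal (g x) \<partial>lborel)
      = (\<integral>\<^sup>+x. \<integral>\<^sup>+w. ennreal (exp (\<alpha> * x) * (if A w * R' w \<le> exp x \<and> exp x < R w then 1 else 0)) \<partial>M \<partial>lborel)"
    proof (rule nn_integral_cong)
      fix x :: real
      have "ennreal (g x) = ennreal (\<integral>w. exp (\<alpha> * x) * (if A w * R' w \<le> exp x \<and> exp x < R w then 1 else 0) \<partial>M)"
        unfolding g_def by (subst integral_mult_right_zero) simp
      also have "\<dots> = (\<integral>\<^sup>+w. ennreal (exp (\<alpha> * x) * (if A w * R' w \<le> exp x \<and> exp x < R w then 1 else 0)) \<partial>M)"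
        by (rule nn_integral_eq_integral[symmetric]) (auto intro!: ib)
      finally show "ennreal (g x) = \<dots>" .
    qed
    also have "\<dots> = (\<integral>\<^sup>+w. \<integral>\<^sup>+x. ennreal (exp (\<alpha> * x) * (if A w * R' w \<le> exp x \<and> exp x < R w then 1 else 0)) \<partial>lborel \<partial>M)"
    proof -
      interpret P: pair_sigma_finite M lborel ..
      show ?thesis by (rule P.Fubini') measurable
    qed
    also have "\<dots> = (\<integral>\<^sup>+w. ennreal ((R w powr \<alpha> - (A w * R' w) powr \<alpha>) / \<alpha>) \<partial>M)"
    proof (rule nn_integral_cong_AE)
      show "AE w in M. (\<integral>\<^sup>+x. ennreal (exp (\<alpha> * x) * (if A w * R' w \<le> exp x \<and> exp x < R w then 1 else 0)) \<partial>lborel)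
        = ennreal ((R w powr \<alpha> - (A w * R' w) powr \<alpha>) / \<alpha>)"
        using R' less
      proof eventually_elim
        case (elim w)
        define a b where "a = A w * R' w" and "b = R w"
        have ab: "0 < a" "a < b" using elim Apos[of w] by (auto simp: a_def b_def)
        have "(\<integral>\<^sup>+x. ennreal (exp (\<alpha> * x) * (if a \<le> exp x \<and> exp x < b then 1 else 0)) \<partial>lborel)
          = (\<integral>\<^sup>+x. ennreal (exp (\<alpha> * x)) * indicator {ln a..ln b} x \<partial>lborel)"
        proof (rule nn_integral_cong_AE)
          show "AE x in lborel. ennreal (exp (\<alpha> * x) * (if a \<le> exp x \<and> exp x < b then 1 else 0))
            = ennreal (exp (\<alpha> * x)) * indicator {ln a..ln b} x"
            using AE_lborel_singleton[of "ln b"]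
          proof eventually_elim
            case (elim x)
            have "a \<le> exp x \<longleftrightarrow> ln a \<le> x" using ab by (metis exp_le_cancel_iff exp_ln)
            moreover have "exp x < b \<longleftrightarrow> x < ln b" using ab by (metis exp_less_cancel_iff exp_ln less_trans)
            ultimately show ?case using elim by (auto simp: indicator_def)
          qed
        qed
        also have "\<dots> = ennreal (exp (\<alpha> * ln b) / \<alpha> - exp (\<alpha> * ln a) / \<alpha>)"
          by (rule nn_integral_FTC_Icc) (use \<alpha> ab in \<open>auto intro!: derivative_eq_intros\<close>)
        also have "\<dots> = ennreal ((b powr \<alpha> - a powr \<alpha>) / \<alpha>)"
          using ab by (simp add: powr_def diff_divide_distrib)
        finally show ?case by (simp only: a_def b_def)
      qed
    qed
    finally show ?thesis .
  qed
  define K where "K = (\<integral>w. (R w powr \<alpha> - (A w * R' w) powr \<alpha>) / \<alpha> \<partial>M)"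
  have dpos: "AE w in M. 0 < (R w powr \<alpha> - (A w * R' w) powr \<alpha>) / \<alpha>"
    using R' less
  proof eventually_elim
    case (elim w)
    then have "(A w * R' w) powr \<alpha> < R w powr \<alpha>"
      using Apos[of w] \<alpha> by (intro powr_less_mono2) auto
    then show ?case using \<alpha> by simp
  qed
  have K: "0 < K"
  proof -
    have "(\<integral>w. 0 \<partial>M) < K"
      unfolding K_def using diff dpos by (intro integral_less_AE_space) (auto simp: emeasure_space_1)
    then show ?thesis by simp
  qed
  have g_nn': "(\<integral>\<^sup>+x. ennreal (g x) \<partial>lborel) = ennreal K"
    unfolding g_nn K_def using diff dpos by (intro nn_integral_eq_integral) (auto elim: eventually_mono)
  have mg [measurable]: "g \<in> borel_measurable borel"
    unfolding g_def[abs_def] by measurable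
  have mf [measurable]: "f \<in> borel_measurable borel"
    unfolding f_def[abs_def] by measurable
  have g0: "0 \<le> g x" for x by (simp add: g_def)
  have g_int: "integrable lborel g" "(\<integral>x. g x \<partial>lborel) = K"
  proof -
    show "integrable lborel g" by (rule integrableI_nonneg) (auto simp: g0 g_nn')
    show "(\<integral>x. g x \<partial>lborel) = K" by (rule integral_eq_nn_integral[THEN trans]) (use K in \<open>auto simp: g0 g_nn'\<close>)
  qed
  have indR: "prob {w \<in> space M. t < R' w} = prob {w \<in> space M. t < R w}" for t
    by (rule prob_distr_cong[OF ident]) auto
  \<comment> \<open>The weight A^\<alpha> of the tilted law cancels the factor exp (- \<alpha> ln A)
    in f (x - ln A), and independence recombines A with R'.\<close>
  have renew: "f x = g x + E.T f x" for x
  proof -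
    have "E.T f x = (\<integral>w. A w powr \<alpha> * f (x - ln (A w)) \<partial>M)"
      unfolding E.T_def by (rule int_\<eta>) simp
    also have "\<dots> = (\<integral>v. exp (\<alpha> * x) * (\<integral>w. (if exp x < A v * R' w then 1 else 0) \<partial>M) \<partial>M)"
    proof (intro Bochner_Integration.integral_cong refl)
      fix v
      have "A v powr \<alpha> * exp (\<alpha> * (x - ln (A v))) = exp (\<alpha> * x)"
        using Apos[of v] by (simp add: powr_def exp_add[symmetric] algebra_simps)
      moreover have "prob {w \<in> space M. exp (x - ln (A v)) < R w} = (\<integral>w. (if exp x < A v * R' w then 1 else 0) \<partial>M)"
      proof -
        have "prob {w \<in> space M. exp (x - ln (A v)) < R w} = (\<integral>w. indicator {w \<in> space M. exp (x - ln (A v)) < R' w} w \<partial>M)"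
          by (simp add: indR)
        also have "\<dots> = (\<integral>w. (if exp x < A v * R' w then 1 else 0) \<partial>M)"
          using Apos[of v] by (intro Bochner_Integration.integral_cong) (auto simp: indicator_def exp_diff field_simps)
        finally show ?thesis .
      qed
      ultimately show "A v powr \<alpha> * f (x - ln (A v)) = exp (\<alpha> * x) * (\<integral>w. (if exp x < A v * R' w then 1 else 0) \<partial>M)"
        unfolding f_prob by (simp add: mult.assoc[symmetric])
    qed
    also have "\<dots> = exp (\<alpha> * x) * (\<integral>v. (\<integral>w. (if exp x < A v * R' w then 1 else 0) \<partial>M) \<partial>M)"
      by (rule integral_mult_right_zero)
    also have "(\<integral>v. (\<integral>w. (if exp x < A v * R' w then 1 else 0) \<partial>M) \<partial>M) = (\<integral>w. (if exp x < A w * R' w then 1 else (0::real)) \<partial>M)"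
      using integral_indep_var[OF ind, of "\<lambda>(a, b). if exp x < a * b then 1 else 0"] by (simp add: ib)
    finally have TF: "E.T f x = exp (\<alpha> * x) * (\<integral>w. (if exp x < A w * R' w then 1 else 0) \<partial>M)" .
    have "(\<integral>w. (if exp x < R w then 1 else 0) \<partial>M)
      = (\<integral>w. (if A w * R' w \<le> exp x \<and> exp x < R w then 1 else 0) + (if exp x < A w * R' w then 1 else (0::real)) \<partial>M)"
    proof (rule integral_cong_AE)
      show "AE w in M. (if exp x < R w then 1 else 0)
        = (if A w * R' w \<le> exp x \<and> exp x < R w then 1 else 0) + (if exp x < A w * R' w then 1 else (0::real))"
        using less by eventually_elim auto
    qed auto
    also have "\<dots> = (\<integral>w. (if A w * R' w \<le> exp x \<and> exp x < R w then 1 else 0) \<partial>M)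
      + (\<integral>w. (if exp x < A w * R' w then 1 else (0::real)) \<partial>M)"
      by (intro Bochner_Integration.integral_add ib) measurable
    finally show ?thesis unfolding TF g_def f_def by (simp add: distrib_left)
  qed
  have "renewal \<eta> f g s q C0 \<alpha>"
  proof (intro renewal.intro renewal_axioms.intro)
    show "real_step \<eta>" by (rule E.real_step_axioms)
    show "integrable \<eta> (\<lambda>u. u)" by (subst itg_\<eta>) (auto simp: int_ln)
    show "0 < (\<integral>u. u \<partial>\<eta>)"
      by (subst int_\<eta>) (auto intro!: tilted_mean_pos Apos intA oneA int_ln atomless \<alpha>)
    show "0 < s" using r by (simp add: s_def)
    show "integrable \<eta> (\<lambda>u. exp (- s * u))"
      by (subst itg_\<eta>, simp, subst exp_s) (rule moment_less_1(1)[OF mA Apos intA oneA atomless r(1,2)])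
    show "(\<integral>u. exp (- s * u) \<partial>\<eta>) = q"
      unfolding q_def by (subst int_\<eta>, simp, subst exp_s) simp
    show "q < 1" unfolding q_def by (rule moment_less_1(2)[OF mA Apos intA oneA atomless r(1,2)])
    show "E.prob {v} = 0" for v
    proof -
      have "E.prob {v} = (\<integral>u. indicator {v} u \<partial>\<eta>)" by simp
      also have "\<dots> = (\<integral>w. A w powr \<alpha> * indicator {v} (ln (A w)) \<partial>M)" by (rule int_\<eta>) simp
      also have "\<dots> = (\<integral>w. 0 \<partial>M)"
      proof (rule integral_cong_AE)
        have "AE w in M. A w \<noteq> exp v" by (rule AE_neq_of_prob_0[OF mA atomless])
        then show "AE w in M. A w powr \<alpha> * indicator {v} (ln (A w)) = 0"
          by eventually_elim (use Apos in \<open>auto simp: indicator_def\<close>)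
      qed auto
      finally show ?thesis by simp
    qed
    show "0 \<le> f x" for x by (simp add: f_prob)
    \<comment> \<open>Markov's inequality for the moment of order r; the exponent left over is
      \<alpha> - r = s.\<close>
    show "f x \<le> C0 * exp (s * x)" for x
    proof -
      have "prob {w \<in> space M. exp x < R w} \<le> prob {w \<in> space M. R w powr r \<ge> exp x powr r}"
        using r by (intro finite_measure_mono) (auto intro!: powr_mono2)
      also have "\<dots> \<le> C0 / exp x powr r"
        unfolding C0_def by (rule integral_Markov_inequality_measure[OF r(3), of "{}"]) auto
      finally have "f x \<le> exp (\<alpha> * x) * (C0 / exp x powr r)"
        unfolding f_prob by (intro mult_left_mono) auto
      also have "\<dots> = C0 * exp (s * x)"
        by (simp add: s_def powr_def left_diff_distrib exp_diff)
      finally show ?thesis .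
    qed
    show "f y \<le> exp (\<alpha> * (y - x)) * f x" if "x \<le> y" for x y
    proof -
      have "exp x \<le> exp y" using that by simp
      then have "prob {w \<in> space M. exp y < R w} \<le> prob {w \<in> space M. exp x < R w}"
        by (intro finite_measure_mono) (auto intro: le_less_trans)
      then have "f y \<le> exp (\<alpha> * y) * prob {w \<in> space M. exp x < R w}"
        unfolding f_prob by (intro mult_left_mono) auto
      also have "\<dots> = exp (\<alpha> * (y - x)) * f x"
        unfolding f_prob by (simp add: mult.assoc[symmetric] exp_add[symmetric] algebra_simps)
      finally show ?thesis .
    qed
  qed (use \<alpha> g0 g_int renew in auto)
  then interpret Rn: renewal \<eta> f g s q C0 \<alpha> .
  let ?c = "K / (\<integral>u. u \<partial>\<eta>)"
  have "((\<lambda>x. f (ln x)) \<longlongrightarrow> ?c) at_top"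
    using filterlim_compose[OF Rn.f_tendsto ln_at_top] by (simp add: g_int)
  moreover have "\<forall>\<^sub>F x in at_top. f (ln x) = x powr \<alpha> * prob {w \<in> space M. R w > x}"
    using eventually_gt_at_top[of 0] by eventually_elim (simp add: f_prob powr_def)
  ultimately have "((\<lambda>x. x powr \<alpha> * prob {w \<in> space M. R w > x}) \<longlongrightarrow> ?c) at_top"
    by (rule Lim_transform_eventually)
  moreover have "0 < ?c" using K Rn.step_mean by simp
  ultimately show ?thesis by blast
qed

end

section \<open>Breiman's lemma and regular variation\<close>

lemma integral_scale_measure:
  fixes f :: "'a \<Rightarrow> real"
  assumes "0 \<le> c" and [measurable]: "f \<in> borel_measurable M"
  shows "(\<integral>x. f x \<partial>scale_measure (ennreal c) M) = c * (\<integral>x. f x \<partial>M)"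
proof -
  have "scale_measure (ennreal c) M = density M (\<lambda>_. ennreal c)"
    by (rule measure_eqI) (auto simp: emeasure_density nn_integral_cmult_indicator)
  then show ?thesis using assms by (simp add: integral_density)
qed

text \<open>Only the norm of y stands in the denominator: an error that is small relative to y moves
  the direction little, without a lower bound on the norm of x.\<close>

lemma dist_normalize_le:
  fixes x y :: "'a::real_normed_vector"
  assumes "x \<noteq> 0" "y \<noteq> 0"
  shows "dist (x /\<^sub>R norm x) (y /\<^sub>R norm y) \<le> 2 * norm (x - y) / norm y"
proof -
  have eq: "x /\<^sub>R norm x - y /\<^sub>R norm y = (inverse (norm x) - inverse (norm y)) *\<^sub>R x + inverse (norm y) *\<^sub>R (x - y)"
    by (simp add: algebra_simps)
  have "(inverse (norm x) - inverse (norm y)) * norm x = (norm y - norm x) / norm y"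
    using assms by (simp add: field_simps)
  then have "\<bar>inverse (norm x) - inverse (norm y)\<bar> * norm x = \<bar>norm y - norm x\<bar> / norm y"
    by (metis abs_divide abs_mult abs_norm_cancel)
  then have "norm (x /\<^sub>R norm x - y /\<^sub>R norm y) \<le> \<bar>norm y - norm x\<bar> / norm y + norm (x - y) / norm y"
    unfolding eq by (intro order_trans[OF norm_triangle_ineq]) (simp add: divide_inverse mult.commute)
  also have "\<dots> \<le> norm (x - y) / norm y + norm (x - y) / norm y"
    using norm_triangle_ineq3[of y x] by (intro add_right_mono divide_right_mono) (auto simp: norm_minus_commute)
  finally show ?thesis unfolding dist_norm by simp
qed

context prob_space
begin

text \<open>Markov's inequality is applied to the moment restricted to the tail event; dominated
  convergence sends that moment to zero, which sharpens the bound O(x^-a) to o(x^-a).\<close>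

lemma tail_moment_tendsto_0:
  fixes E :: "'a \<Rightarrow> 'b::euclidean_space"
  assumes [measurable]: "E \<in> borel_measurable M" and int: "integrable M (\<lambda>w. norm (E w) powr a)"
    and a: "0 < a" and e: "0 < e"
  shows "((\<lambda>x. x powr a * prob {w \<in> space M. e * x < norm (E w)}) \<longlongrightarrow> 0) at_top"
proof -
  let ?J = "\<lambda>x. \<integral>w. norm (E w) powr a * indicator {w \<in> space M. e * x < norm (E w)} w \<partial>M"
  have "(?J \<longlongrightarrow> (\<integral>w. 0 \<partial>M)) at_top"
  proof (rule integral_dominated_convergence_at_top[where w = "\<lambda>w. norm (E w) powr a"])
    show "AE w in M. ((\<lambda>x. norm (E w) powr a * indicator {w \<in> space M. e * x < norm (E w)} w) \<longlongrightarrow> 0) at_top"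
    proof (intro AE_I2 tendsto_eventually)
      fix w
      show "\<forall>\<^sub>F x in at_top. norm (E w) powr a * indicator {w \<in> space M. e * x < norm (E w)} w = 0"
        using eventually_gt_at_top[of "norm (E w) / e"]
        by eventually_elim (use e in \<open>auto simp: field_simps\<close>)
    qed
  qed (auto simp: int split: split_indicator)
  then have J: "((\<lambda>x. ?J x / e powr a) \<longlongrightarrow> 0) at_top"
    using tendsto_divide_zero by fastforce
  show ?thesis
  proof (rule tendsto_sandwich[OF _ _ tendsto_const J])
    show "\<forall>\<^sub>F x in at_top. x powr a * prob {w \<in> space M. e * x < norm (E w)} \<le> ?J x / e powr a"
      using eventually_gt_at_top[of 0]
    proof eventually_elim
      case (elim x)
      have "(e * x) powr a * prob {w \<in> space M. e * x < norm (E w)}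
        = (\<integral>w. (e * x) powr a * indicator {w \<in> space M. e * x < norm (E w)} w \<partial>M)" by simp
      also have "\<dots> \<le> ?J x"
      proof (rule integral_mono)
        show "integrable M (\<lambda>w. norm (E w) powr a * indicator {w \<in> space M. e * x < norm (E w)} w)"
          by (rule Bochner_Integration.integrable_bound[OF int]) (auto split: split_indicator)
        show "integrable M (\<lambda>w. (e * x) powr a * indicator {w \<in> space M. e * x < norm (E w)} w)"
          by (intro integrable_mult_right integrable_real_indicator) (auto simp: emeasure_eq_measure)
      qed (use elim e a in \<open>auto split: split_indicator intro!: powr_mono2\<close>)
      finally show ?case using e elim by (simp add: powr_mult field_simps)
    qed
  qed auto
qed

text \<open>Given \<open>F\<close>, the event reads y > u x / |v|, and the scaled tail function
  there tends to c. The tail is exactly of order x^-a, so the scaled tail function is bounded on the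
  whole half line and a multiple of |v|^a dominates.\<close>

lemma breiman:
  fixes y :: "'c \<Rightarrow> real" and v :: "'c \<Rightarrow> 'b::euclidean_space"
  assumes ind: "indep_var S F S P"
    and [measurable]: "y \<in> borel_measurable S" "v \<in> borel_measurable S"
    and tail: "((\<lambda>x. x powr a * prob {w \<in> space M. y (P w) > x}) \<longlongrightarrow> c) at_top"
    and a: "0 < a" and int: "integrable M (\<lambda>w. norm (v (F w)) powr a)"
    and h [measurable]: "h \<in> borel_measurable borel" and hb: "\<And>z. \<bar>h z\<bar> \<le> B" and u: "0 < u"
  shows "((\<lambda>x. x powr a * (\<integral>w. h (v (F w)) * (if u * x < y (P w) * norm (v (F w)) then 1 else 0) \<partial>M))
    \<longlongrightarrow> c * u powr (- a) * (\<integral>w. h (v (F w)) * norm (v (F w)) powr a \<partial>M)) at_top"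
proof -
  have [measurable]: "P \<in> measurable M S" "F \<in> measurable M S"
    using ind by (auto simp: indep_var_distribution_eq)
  have B: "0 \<le> B" using hb[of undefined] by linarith
  define G where "G t = t powr a * prob {w \<in> space M. y (P w) > t}" for t
  have G0: "0 \<le> G t" for t by (simp add: G_def)
  have [measurable]: "G \<in> borel_measurable borel"
  proof -
    have "G t = t powr a * (\<integral>w. (if t < y (P w) then 1 else 0) \<partial>M)" for t
    proof -
      have "(\<integral>w. (if t < y (P w) then 1 else 0) \<partial>M) = (\<integral>w. indicator {w \<in> space M. y (P w) > t} w \<partial>M :: real)"
        by (intro Bochner_Integration.integral_cong) (auto simp: indicator_def)
      then show ?thesis by (simp add: G_def)
    qed
    moreover have "(\<lambda>t. t powr a * (\<integral>w. (if t < y (P w) then 1 else 0) \<partial>M)) \<in> borel_measurable borel"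
      by measurable
    ultimately show ?thesis by presburger
  qed
  obtain K where K: "\<And>t. 0 < t \<Longrightarrow> G t \<le> K"
  proof -
    have "\<forall>\<^sub>F t in at_top. G t < c + 1"
      using order_tendstoD(2)[OF tail, of "c + 1"] by (simp add: G_def)
    then obtain T where T: "\<And>t. t \<ge> T \<Longrightarrow> G t < c + 1" by (auto simp: eventually_at_top_linorder)
    \<comment> \<open>Beyond T the limit bounds G; below T the probability is at most 1 and the
      power alone is bounded.\<close>
    have "G t \<le> max (c + 1) (\<bar>T\<bar> powr a)" if "0 < t" for t
    proof (cases "T \<le> t")
      case True
      then show ?thesis using T[OF True] by simp
    next
      case False
      have "G t \<le> t powr a * 1" unfolding G_def by (intro mult_left_mono) auto
      also have "\<dots> \<le> \<bar>T\<bar> powr a" using False that a by (auto intro!: powr_mono2)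
      finally show ?thesis by simp
    qed
    then show ?thesis by (rule that)
  qed
  have K0: "0 \<le> K" using order_trans[OF G0 K[of 1]] by simp
  let ?N = "\<lambda>w. norm (v (F w))"
  \<comment> \<open>The integrand after conditioning. Norm 0 is split off because the event is then
    impossible and the quotient u x / 0 carries only a default value.\<close>
  let ?s = "\<lambda>x w. h (v (F w)) * (if ?N w = 0 then 0 else (?N w / u) powr a * G (u * x / ?N w))"
  have lim: "((\<lambda>x. \<integral>w. ?s x w \<partial>M) \<longlongrightarrow> (\<integral>w. h (v (F w)) * (c * u powr (- a) * ?N w powr a) \<partial>M)) at_top"
  proof (rule integral_dominated_convergence_at_top[where w = "\<lambda>w. B * (K * u powr (- a) * ?N w powr a)"])
    show "integrable M (\<lambda>w. B * (K * u powr (- a) * ?N w powr a))" using int by simp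
    show "AE w in M. ((\<lambda>x. ?s x w) \<longlongrightarrow> h (v (F w)) * (c * u powr (- a) * ?N w powr a)) at_top"
    proof (intro AE_I2)
      fix w
      show "((\<lambda>x. ?s x w) \<longlongrightarrow> h (v (F w)) * (c * u powr (- a) * ?N w powr a)) at_top"
      proof (cases "?N w = 0")
        case False
        then have n: "0 < ?N w" by simp
        have fl: "filterlim (\<lambda>x. u * x / ?N w) at_top at_top"
          using filterlim_tendsto_pos_mult_at_top[OF tendsto_const[of "u / ?N w"] _ filterlim_ident] u n
          by simp
        have "((\<lambda>x. G (u * x / ?N w)) \<longlongrightarrow> c) at_top"
          using filterlim_compose[OF tail fl] by (simp add: G_def)
        then have "((\<lambda>x. h (v (F w)) * ((?N w / u) powr a * G (u * x / ?N w))) \<longlongrightarrow> h (v (F w)) * ((?N w / u) powr a * c)) at_top"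
          by (intro tendsto_intros)
        moreover have "(?N w / u) powr a * c = c * u powr (- a) * ?N w powr a"
          using n u by (simp add: powr_divide powr_minus divide_simps)
        ultimately show ?thesis using False by simp
      qed (use a in simp)
    qed
    show "\<forall>\<^sub>F x in at_top. AE w in M. norm (?s x w) \<le> B * (K * u powr (- a) * ?N w powr a)"
      using eventually_gt_at_top[of 0]
    proof (eventually_elim, intro AE_I2)
      fix x :: real and w assume x: "0 < x"
      show "norm (?s x w) \<le> B * (K * u powr (- a) * ?N w powr a)"
      proof (cases "?N w = 0")
        case False
        then have n: "0 < ?N w" by simp
        have "(?N w / u) powr a * G (u * x / ?N w) \<le> (?N w / u) powr a * K"
          using n u x by (intro mult_left_mono K) auto
        also have "\<dots> = K * u powr (- a) * ?N w powr a"
          using n u by (simp add: powr_divide powr_minus divide_simps)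
        finally have le: "(?N w / u) powr a * G (u * x / ?N w) \<le> K * u powr (- a) * ?N w powr a" .
        have "\<bar>h (v (F w))\<bar> * ((?N w / u) powr a * G (u * x / ?N w)) \<le> B * (K * u powr (- a) * ?N w powr a)"
          by (rule mult_mono[OF hb le B mult_nonneg_nonneg[OF powr_ge_zero G0]])
        then show ?thesis using False G0 by (simp add: abs_mult)
      qed (use B K0 in simp)
    qed
  qed measurable
  have eq: "\<forall>\<^sub>F x in at_top. (\<integral>w. ?s x w \<partial>M)
    = x powr a * (\<integral>w. h (v (F w)) * (if u * x < y (P w) * ?N w then 1 else 0) \<partial>M)"
    using eventually_gt_at_top[of 0]
  proof eventually_elim
    case (elim x)
    have "(\<integral>w. h (v (F w)) * (if u * x < y (P w) * ?N w then 1 else 0) \<partial>M)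
      = (\<integral>z. \<integral>w. h (v (F z)) * (if u * x < y (P w) * ?N z then 1 else 0) \<partial>M \<partial>M)"
      using integral_indep_var[OF ind, of "\<lambda>(q, p). h (v q) * (if u * x < y p * norm (v q) then 1 else 0)"]
      by (simp add: split_beta integrable_const_bound[of _ B] hb B)
    also have "x powr a * \<dots> = (\<integral>z. x powr a * (\<integral>w. h (v (F z)) * (if u * x < y (P w) * ?N z then 1 else 0) \<partial>M) \<partial>M)"
      by simp
    also have "\<dots> = (\<integral>z. ?s x z \<partial>M)"
    proof (intro Bochner_Integration.integral_cong refl)
      fix z
      have "(\<integral>w. h (v (F z)) * (if u * x < y (P w) * ?N z then 1 else 0) \<partial>M)
        = h (v (F z)) * (\<integral>w. (if u * x < y (P w) * ?N z then 1 else 0) \<partial>M)" by simp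
      also have "x powr a * \<dots> = ?s x z"
      proof (cases "?N z = 0")
        case True
        moreover have "\<not> u * x < 0" using u elim by (simp add: not_less)
        ultimately show ?thesis by simp
      next
        case False
        then have n: "0 < ?N z" by simp
        have "(\<integral>w. (if u * x < y (P w) * ?N z then 1 else 0) \<partial>M)
          = (\<integral>w. indicator {w \<in> space M. y (P w) > u * x / ?N z} w \<partial>M :: real)"
          using n by (intro Bochner_Integration.integral_cong) (auto simp: indicator_def field_simps)
        then have "(\<integral>w. (if u * x < y (P w) * ?N z then 1 else 0) \<partial>M) = prob {w \<in> space M. y (P w) > u * x / ?N z}"
          by simp
        moreover have "(?N z / u) powr a * (u * x / ?N z) powr a = x powr a"
          using n u elim by (simp add: powr_mult[symmetric])
        ultimately show ?thesis using False by (simp add: G_def mult_ac)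
      qed
      finally show "x powr a * (\<integral>w. h (v (F z)) * (if u * x < y (P w) * ?N z then 1 else 0) \<partial>M) = ?s x z" .
    qed
    finally show ?case by simp
  qed
  have "(\<integral>w. h (v (F w)) * (c * u powr (- a) * ?N w powr a) \<partial>M)
    = c * u powr (- a) * (\<integral>w. h (v (F w)) * ?N w powr a \<partial>M)"
    by (simp add: integral_mult_right_zero[symmetric] mult_ac del: integral_mult_right_zero)
  with Lim_transform_eventually[OF lim eq] show ?thesis by simp
qed

text \<open>Outside an event of probability o(x^-a) the error is at most \<epsilon> x. Then u x is
  exceeded by both vectors or by neither, except when the norm of the product lies in a shell around
  u x whose scaled mass is small with \<epsilon>; if both exceed it, their directions nearly
  agree.\<close>

lemma breiman_perturbed:
  fixes y :: "'c \<Rightarrow> real" and v :: "'c \<Rightarrow> 'b::euclidean_space" and X :: "'a \<Rightarrow> 'b"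
  assumes ind: "indep_var S F S P"
    and my [measurable]: "y \<in> borel_measurable S" and mv [measurable]: "v \<in> borel_measurable S"
    and tail: "((\<lambda>x. x powr a * prob {w \<in> space M. y (P w) > x}) \<longlongrightarrow> c) at_top"
    and c: "0 < c" and y0: "AE w in M. 0 \<le> y (P w)"
    and a: "0 < a" and int: "integrable M (\<lambda>w. norm (v (F w)) powr a)"
    and mX [measurable]: "X \<in> borel_measurable M"
    and E: "integrable M (\<lambda>w. norm (X w - y (P w) *\<^sub>R v (F w)) powr a)"
    and f: "continuous_on (sphere 0 1) f" and u: "0 < u"
  shows "((\<lambda>x. x powr a * (\<integral>w. indicator (sphere 0 1) (X w /\<^sub>R norm (X w)) * f (X w /\<^sub>R norm (X w))
        * (if u * x < norm (X w) then 1 else 0) \<partial>M))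
    \<longlongrightarrow> c * u powr (- a) * (\<integral>w. indicator (sphere 0 1) (v (F w) /\<^sub>R norm (v (F w)))
        * f (v (F w) /\<^sub>R norm (v (F w))) * norm (v (F w)) powr a \<partial>M)) at_top"
    (is "(?L \<longlongrightarrow> ?l) at_top")
proof -
  have [measurable]: "P \<in> measurable M S" "F \<in> measurable M S"
    using ind by (auto simp: indep_var_distribution_eq)
  \<comment> \<open>Extended by zero off the sphere, f is bounded and Borel. The zero vector has the
    direction 0 by convention and so contributes nothing.\<close>
  define f0 where "f0 z = indicator (sphere 0 1) z * f z" for z
  have mf0 [measurable]: "f0 \<in> borel_measurable borel"
    using borel_measurable_continuous_on_indicator[OF _ f] by (simp add: f0_def[abs_def])
  have cs: "compact (sphere (0::'b) 1)" by simp
  obtain B where B: "\<And>z. \<bar>f0 z\<bar> \<le> B" "0 \<le> B"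
  proof -
    have "bounded (f ` sphere 0 1)"
      by (intro compact_imp_bounded compact_continuous_image[OF f cs])
    then obtain B where "\<forall>z\<in>sphere 0 1. \<bar>f z\<bar> \<le> B" unfolding bounded_iff by auto
    then have "\<bar>f0 z\<bar> \<le> \<bar>B\<bar>" for z
      by (cases "z \<in> sphere 0 1") (auto simp del: mem_sphere simp: f0_def intro: order_trans[OF _ abs_ge_self])
    then show ?thesis using that[of "\<bar>B\<bar>"] by simp
  qed
  define V where "V w = v (F w)" for w
  define Wv where "Wv w = y (P w) *\<^sub>R V w" for w
  have [measurable]: "V \<in> borel_measurable M" "Wv \<in> borel_measurable M"
    by (simp_all add: V_def[abs_def] Wv_def[abs_def])
  define n where "n z = z /\<^sub>R norm z" for z :: 'b
  have [measurable]: "n \<in> borel_measurable borel" by (simp add: n_def[abs_def])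
  define m where "m = (\<integral>w. norm (V w) powr a \<partial>M)"
  have m0: "0 \<le> m" by (simp add: m_def)
  let ?I = "\<lambda>b. if b then 1 else (0::real)"
  have ib: "integrable M (\<lambda>w. g w * ?I (Q w))"
    if [measurable]: "g \<in> borel_measurable M" "Measurable.pred M Q" and "\<And>w. \<bar>g w\<bar> \<le> B'" "0 \<le> B'" for g Q B'
    by (rule integrable_const_bound[of _ B']) (use that in auto)
  have ibI: "integrable M (\<lambda>w. ?I (Q w))" if [measurable]: "Measurable.pred M Q" for Q
    using ib[of "\<lambda>_. 1" Q 1] by simp
  have normW: "AE w in M. norm (Wv w) = y (P w) * norm (V w)"
    using y0 by eventually_elim (simp add: Wv_def)
  have dirW: "AE w in M. norm (Wv w) > 0 \<longrightarrow> n (Wv w) = n (V w)"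
    using y0 by eventually_elim (auto simp: Wv_def n_def zero_less_mult_iff)
  have J: "((\<lambda>x. x powr a * (\<integral>w. f0 (n (Wv w)) * ?I (u * x < norm (Wv w)) \<partial>M)) \<longlongrightarrow> ?l) at_top"
  proof -
    have "((\<lambda>x. x powr a * (\<integral>w. f0 (n (v (F w))) * ?I (u * x < y (P w) * norm (v (F w))) \<partial>M)) \<longlongrightarrow>
       c * u powr (- a) * (\<integral>w. f0 (n (v (F w))) * norm (v (F w)) powr a \<partial>M)) at_top"
      by (rule breiman[OF ind my mv tail a int _ B(1) u]) measurable
    also have "c * u powr (- a) * (\<integral>w. f0 (n (v (F w))) * norm (v (F w)) powr a \<partial>M) = ?l"
      by (simp add: f0_def n_def)
    finally show ?thesis
    proof (rule Lim_transform_eventually)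
      show "\<forall>\<^sub>F x in at_top. x powr a * (\<integral>w. f0 (n (v (F w))) * ?I (u * x < y (P w) * norm (v (F w))) \<partial>M)
        = x powr a * (\<integral>w. f0 (n (Wv w)) * ?I (u * x < norm (Wv w)) \<partial>M)"
        using eventually_gt_at_top[of 0]
      proof eventually_elim
        case (elim x)
        have "(\<integral>w. f0 (n (v (F w))) * ?I (u * x < y (P w) * norm (v (F w))) \<partial>M)
          = (\<integral>w. f0 (n (Wv w)) * ?I (u * x < norm (Wv w)) \<partial>M)"
        proof (rule integral_cong_AE)
          show "AE w in M. f0 (n (v (F w))) * ?I (u * x < y (P w) * norm (v (F w)))
            = f0 (n (Wv w)) * ?I (u * x < norm (Wv w))"
            using normW dirW
          proof eventually_elim
            fix w assume w: "norm (Wv w) = y (P w) * norm (V w)" "norm (Wv w) > 0 \<longrightarrow> n (Wv w) = n (V w)"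
            have "0 < u * x" using elim u by simp
            then have "u * x < norm (Wv w) \<Longrightarrow> n (Wv w) = n (V w)" using w(2) by (meson less_trans)
            then show "f0 (n (v (F w))) * ?I (u * x < y (P w) * norm (v (F w)))
              = f0 (n (Wv w)) * ?I (u * x < norm (Wv w))"
              using w(1) by (auto simp: V_def)
          qed
        qed measurable
        then show ?case by simp
      qed
    qed
  qed
  have Pr: "((\<lambda>x. x powr a * (\<integral>w. ?I (u' * x < norm (Wv w)) \<partial>M)) \<longlongrightarrow> c * u' powr (- a) * m) at_top"
    if u': "0 < u'" for u'
  proof -
    have "((\<lambda>x. x powr a * (\<integral>w. 1 * ?I (u' * x < y (P w) * norm (v (F w))) \<partial>M)) \<longlongrightarrow>
       c * u' powr (- a) * (\<integral>w. 1 * norm (v (F w)) powr a \<partial>M)) at_top"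
      by (rule breiman[OF ind my mv tail a int, where h = "\<lambda>_. 1" and B = 1]) (use u' in auto)
    moreover have "(\<integral>w. 1 * ?I (u' * x < y (P w) * norm (v (F w))) \<partial>M) = (\<integral>w. ?I (u' * x < norm (Wv w)) \<partial>M)" for x
    proof (rule integral_cong_AE)
      show "AE w in M. 1 * ?I (u' * x < y (P w) * norm (v (F w))) = ?I (u' * x < norm (Wv w))"
        using normW by eventually_elim (simp add: V_def)
    qed measurable
    ultimately show ?thesis by (simp add: m_def V_def)
  qed
  have "((\<lambda>x. ?L x - x powr a * (\<integral>w. f0 (n (Wv w)) * ?I (u * x < norm (Wv w)) \<partial>M)) \<longlongrightarrow> 0) at_top"
  proof (rule tendstoI)
    fix \<eta> :: real assume \<eta>: "0 < \<eta>"
    \<comment> \<open>\<omega> is the allowed oscillation of f; its cost is \<omega> times the limit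
      mass c u^-a m and must stay below a third of \<eta>. The summand 1 covers m = 0.\<close>
    define \<omega> where "\<omega> = \<eta> / (4 * (c * u powr (- a) * m + 1))"
    have p1: "0 \<le> c * u powr (- a) * m" using c m0 by simp
    have \<omega>: "0 < \<omega>" "\<omega> * (c * u powr (- a) * m) < \<eta> / 3"
    proof -
      show "0 < \<omega>" using \<eta> p1 by (simp add: \<omega>_def)
      define k where "k = c * u powr (- a) * m"
      have k: "0 \<le> k" using p1 by (simp add: k_def)
      have "\<omega> * k = \<eta> * k / (4 * (k + 1))" by (simp add: \<omega>_def k_def)
      also have "\<dots> < \<eta> / 3"
        using \<eta> k mult_nonneg_nonneg[of \<eta> k] by (simp add: divide_simps)
      finally show "\<omega> * (c * u powr (- a) * m) < \<eta> / 3" by (simp add: k_def)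
    qed
    have "uniformly_continuous_on (sphere 0 1) f" by (rule compact_uniformly_continuous[OF f cs])
    then obtain \<delta> where \<delta>: "0 < \<delta>"
      and uc: "\<And>z z'. z \<in> sphere 0 1 \<Longrightarrow> z' \<in> sphere 0 1 \<Longrightarrow> dist z z' < \<delta> \<Longrightarrow> \<bar>f z - f z'\<bar> < \<omega>"
      using \<omega>(1) unfolding uniformly_continuous_on_def dist_real_def by blast
    have "((\<lambda>\<epsilon>. B * (c * (u - \<epsilon>) powr (- a) * m - c * (u + \<epsilon>) powr (- a) * m)) \<longlongrightarrow>
        B * (c * (u - 0) powr (- a) * m - c * (u + 0) powr (- a) * m)) (at_right 0)"
      by (intro tendsto_intros) (use u in auto)
    then have "\<forall>\<^sub>F \<epsilon> in at_right 0. B * (c * (u - \<epsilon>) powr (- a) * m - c * (u + \<epsilon>) powr (- a) * m) < \<eta> / 3"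
      by (rule order_tendstoD) (use \<eta> in simp)
    moreover have "\<forall>\<^sub>F \<epsilon> in at_right 0. 0 < \<epsilon> \<and> \<epsilon> < min u (\<delta> * u / 2)"
      using u \<delta> by (auto simp: eventually_at_right_field intro!: exI[of _ "min u (\<delta> * u / 2)"])
    \<comment> \<open>For \<epsilon> < \<delta> u / 2 the directions differ by at most 2 \<epsilon>
      / u < \<delta>; the last condition bounds the scaled mass of the shell.\<close>
    ultimately obtain \<epsilon> where \<epsilon>: "0 < \<epsilon>" "\<epsilon> < u" "\<epsilon> < \<delta> * u / 2"
      and Be: "B * (c * (u - \<epsilon>) powr (- a) * m - c * (u + \<epsilon>) powr (- a) * m) < \<eta> / 3"
      using eventually_happens'[OF trivial_limit_at_right_real eventually_conj] by (metis (lifting) min_less_iff_conj)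
    let ?E = "\<lambda>w. X w - Wv w"
    let ?R = "\<lambda>x. 2 * B * (x powr a * prob {w \<in> space M. \<epsilon> * x < norm (?E w)})
      + B * (x powr a * (\<integral>w. ?I ((u - \<epsilon>) * x < norm (Wv w)) \<partial>M) - x powr a * (\<integral>w. ?I ((u + \<epsilon>) * x < norm (Wv w)) \<partial>M))
      + \<omega> * (x powr a * (\<integral>w. ?I (u * x < norm (Wv w)) \<partial>M))"
    have "(?R \<longlongrightarrow> 2 * B * 0 + B * (c * (u - \<epsilon>) powr (- a) * m - c * (u + \<epsilon>) powr (- a) * m)
        + \<omega> * (c * u powr (- a) * m)) at_top"
      using E \<epsilon> u by (intro tendsto_intros Pr tail_moment_tendsto_0 a) (auto simp: Wv_def V_def)
    then have ev: "\<forall>\<^sub>F x in at_top. ?R x < \<eta>"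
    proof (rule order_tendstoD(2))
      show "2 * B * 0 + B * (c * (u - \<epsilon>) powr (- a) * m - c * (u + \<epsilon>) powr (- a) * m)
        + \<omega> * (c * u powr (- a) * m) < \<eta>"
        using add_strict_mono[OF Be \<omega>(2)] \<eta> by simp
    qed
    \<comment> \<open>The three terms answer for a large error, for a threshold exceeded by one
      vector alone, and for a common exceedance with different directions.\<close>
    have ptw: "\<bar>f0 (n (X w)) * ?I (u * x < norm (X w)) - f0 (n (Wv w)) * ?I (u * x < norm (Wv w))\<bar>
      \<le> 2 * B * ?I (\<epsilon> * x < norm (?E w)) + B * (?I ((u - \<epsilon>) * x < norm (Wv w)) - ?I ((u + \<epsilon>) * x < norm (Wv w)))
        + \<omega> * ?I (u * x < norm (Wv w))" if x: "0 < x" for x w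
    proof -
      have ux: "0 < u * x" "0 < \<epsilon> * x" using x u \<epsilon> by auto
      have nn1: "0 \<le> B * (?I ((u - \<epsilon>) * x < norm (Wv w)) - ?I ((u + \<epsilon>) * x < norm (Wv w)))"
        using B(2) ux by (auto simp: algebra_simps)
      have nn2: "0 \<le> \<omega> * ?I (u * x < norm (Wv w))" using \<omega>(1) by simp
      have b1: "\<bar>f0 z * ?I b\<bar> \<le> B" for z b using B by auto
      show ?thesis
      proof (cases "\<epsilon> * x < norm (?E w)")
        case True
        have "\<bar>f0 (n (X w)) * ?I (u * x < norm (X w)) - f0 (n (Wv w)) * ?I (u * x < norm (Wv w))\<bar> \<le> B + B"
          by (rule abs_diff_le[OF b1 b1])
        then show ?thesis using True nn1 nn2 by simp
      next
        case False
        then have Ee: "norm (?E w) \<le> \<epsilon> * x" by simp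
        have t1: "norm (X w) \<le> norm (Wv w) + \<epsilon> * x" "norm (Wv w) \<le> norm (X w) + \<epsilon> * x"
          using Ee norm_triangle_sub[of "X w" "Wv w"] norm_triangle_sub[of "Wv w" "X w"]
          by (auto simp: norm_minus_commute)
        show ?thesis
        proof (cases "u * x < norm (Wv w)")
          case TW: True
          show ?thesis
          proof (cases "u * x < norm (X w)")
            case TX: True
            have nz: "X w \<noteq> 0" "Wv w \<noteq> 0" using TW TX ux by auto
            then have sp: "n (X w) \<in> sphere 0 1" "n (Wv w) \<in> sphere 0 1" by (auto simp: n_def)
            have "dist (n (X w)) (n (Wv w)) \<le> 2 * norm (?E w) / norm (Wv w)"
              unfolding n_def by (rule dist_normalize_le[OF nz])
            also have "\<dots> \<le> 2 * (\<epsilon> * x) / (u * x)"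
              using Ee TW ux by (intro frac_le) auto
            also have "\<dots> < \<delta>" using \<epsilon> u x by (simp add: field_simps)
            finally have "\<bar>f (n (X w)) - f (n (Wv w))\<bar> < \<omega>" by (rule uc[OF sp])
            then show ?thesis using TW TX nn1 sp False by (simp add: f0_def)
          next
            case FX: False
            then have "\<not> (u + \<epsilon>) * x < norm (Wv w)" using t1 by (simp add: algebra_simps)
            moreover have "(u - \<epsilon>) * x < norm (Wv w)" using TW ux by (simp add: algebra_simps)
            ultimately show ?thesis using TW FX False B \<omega>(1) by (simp add: order_trans[OF B(1)])
          qed
        next
          case FW: False
          then have nu: "\<not> (u + \<epsilon>) * x < norm (Wv w)" using ux by (simp add: algebra_simps)
          show ?thesis
          proof (cases "u * x < norm (X w)")
            case TX: True
            then have "(u - \<epsilon>) * x < norm (Wv w)" using t1 by (simp add: algebra_simps)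
            then show ?thesis using FW TX nu False B by simp
          next
            case FX: False
            then show ?thesis using FW False nn1 by simp
          qed
        qed
      qed
    qed
    show "\<forall>\<^sub>F x in at_top. dist (?L x - x powr a * (\<integral>w. f0 (n (Wv w)) * ?I (u * x < norm (Wv w)) \<partial>M)) 0 < \<eta>"
      using ev eventually_gt_at_top[of 0]
    proof eventually_elim
      case (elim x)
      have i1: "integrable M (\<lambda>w. f0 (n (X w)) * ?I (u * x < norm (X w)))"
        by (rule ib[of _ _ B]) (use B in auto)
      have i2: "integrable M (\<lambda>w. f0 (n (Wv w)) * ?I (u * x < norm (Wv w)))"
        by (rule ib[of _ _ B]) (use B in auto)
      have "\<bar>(\<integral>w. f0 (n (X w)) * ?I (u * x < norm (X w)) \<partial>M) - (\<integral>w. f0 (n (Wv w)) * ?I (u * x < norm (Wv w)) \<partial>M)\<bar>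
        = \<bar>\<integral>w. f0 (n (X w)) * ?I (u * x < norm (X w)) - f0 (n (Wv w)) * ?I (u * x < norm (Wv w)) \<partial>M\<bar>"
        using i1 i2 by simp
      also have "\<dots> \<le> (\<integral>w. \<bar>f0 (n (X w)) * ?I (u * x < norm (X w)) - f0 (n (Wv w)) * ?I (u * x < norm (Wv w))\<bar> \<partial>M)"
        by (rule integral_abs_bound)
      also have "\<dots> \<le> (\<integral>w. 2 * B * ?I (\<epsilon> * x < norm (?E w)) + B * (?I ((u - \<epsilon>) * x < norm (Wv w)) - ?I ((u + \<epsilon>) * x < norm (Wv w)))
        + \<omega> * ?I (u * x < norm (Wv w)) \<partial>M)"
        by (rule integral_mono) (use i1 i2 ptw[OF elim(2)] in \<open>auto intro!: ibI integrable_abs Bochner_Integration.integrable_add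
          Bochner_Integration.integrable_diff integrable_mult_right\<close>)
      also have "\<dots> = 2 * B * (\<integral>w. ?I (\<epsilon> * x < norm (?E w)) \<partial>M)
        + B * ((\<integral>w. ?I ((u - \<epsilon>) * x < norm (Wv w)) \<partial>M) - (\<integral>w. ?I ((u + \<epsilon>) * x < norm (Wv w)) \<partial>M))
        + \<omega> * (\<integral>w. ?I (u * x < norm (Wv w)) \<partial>M)"
      proof -
        let ?a = "\<lambda>w. ?I (\<epsilon> * x < norm (?E w))" and ?b = "\<lambda>w. ?I ((u - \<epsilon>) * x < norm (Wv w))"
          and ?c = "\<lambda>w. ?I ((u + \<epsilon>) * x < norm (Wv w))" and ?d = "\<lambda>w. ?I (u * x < norm (Wv w))"
        have "integrable M ?a" "integrable M ?b" "integrable M ?c" "integrable M ?d"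
          by (rule ibI, measurable)+
        then show ?thesis
          by (simp only: Bochner_Integration.integral_add Bochner_Integration.integral_diff integral_mult_right_zero
            Bochner_Integration.integrable_add Bochner_Integration.integrable_diff integrable_mult_right)
      qed
      also have "(\<integral>w. ?I (\<epsilon> * x < norm (?E w)) \<partial>M) = prob {w \<in> space M. \<epsilon> * x < norm (?E w)}"
      proof -
        have "(\<integral>w. ?I (\<epsilon> * x < norm (?E w)) \<partial>M) = (\<integral>w. indicator {w \<in> space M. \<epsilon> * x < norm (?E w)} w \<partial>M)"
          by (intro Bochner_Integration.integral_cong) (auto simp: indicator_def)
        then show ?thesis by simp
      qed
      finally have "x powr a * \<bar>(\<integral>w. f0 (n (X w)) * ?I (u * x < norm (X w)) \<partial>M) - (\<integral>w. f0 (n (Wv w)) * ?I (u * x < norm (Wv w)) \<partial>M)\<bar>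
        \<le> x powr a * (2 * B * prob {w \<in> space M. \<epsilon> * x < norm (?E w)}
        + B * ((\<integral>w. ?I ((u - \<epsilon>) * x < norm (Wv w)) \<partial>M) - (\<integral>w. ?I ((u + \<epsilon>) * x < norm (Wv w)) \<partial>M))
        + \<omega> * (\<integral>w. ?I (u * x < norm (Wv w)) \<partial>M))"
        by (rule mult_left_mono) simp
      also have "\<dots> = ?R x" by (simp only: distrib_left right_diff_distrib mult_ac)
      also have "\<dots> < \<eta>" by (rule elim(1))
      finally show ?case by (simp add: dist_real_def f0_def n_def right_diff_distrib[symmetric] abs_mult)
    qed
  qed
  from tendsto_add[OF this J] show ?thesis by simp
qed

text \<open>The ratio of the asymptotics for (f, u) and for (1, 1): the power of x and the constant
  c cancel, and \<open>law\<close> recognises the remaining quotient as an integral against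
  Q.\<close>

lemma mrvI:
  fixes y :: "'c \<Rightarrow> real" and v :: "'c \<Rightarrow> 'b::euclidean_space" and X :: "'a \<Rightarrow> 'b"
  assumes ind: "indep_var S F S P"
    and my: "y \<in> borel_measurable S" and mv [measurable]: "v \<in> borel_measurable S"
    and tail: "((\<lambda>x. x powr a * prob {w \<in> space M. y (P w) > x}) \<longlongrightarrow> c) at_top"
    and c: "0 < c" and y0: "AE w in M. 0 \<le> y (P w)"
    and a: "0 < a" and int: "integrable M (\<lambda>w. norm (v (F w)) powr a)"
    and mX [measurable]: "X \<in> borel_measurable M"
    and E: "integrable M (\<lambda>w. norm (X w - y (P w) *\<^sub>R v (F w)) powr a)"
    and pos: "0 < (\<integral>w. norm (v (F w)) powr a \<partial>M)"
    and Q: "prob_space Q" "sets Q = sets borel" "AE z in Q. z \<in> sphere 0 1"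
    and law: "\<And>f. continuous_on (sphere 0 1) f \<Longrightarrow>
      (\<integral>z. indicator (sphere 0 1) z * f z \<partial>Q) = (\<integral>w. indicator (sphere 0 1) (v (F w) /\<^sub>R norm (v (F w)))
        * f (v (F w) /\<^sub>R norm (v (F w))) * norm (v (F w)) powr a \<partial>M) / (\<integral>w. norm (v (F w)) powr a \<partial>M)"
  shows "mrv_with_spectral_measure M X a Q"
  unfolding mrv_with_spectral_measure_def vague_conv_on_def
proof (intro conjI allI impI)
  fix u :: real and f :: "'b \<Rightarrow> real"
  assume u: "0 < u" and f: "continuous_on (sphere 0 1) f"
  let ?m = "\<integral>w. norm (v (F w)) powr a \<partial>M"
  let ?mf = "\<integral>w. indicator (sphere 0 1) (v (F w) /\<^sub>R norm (v (F w)))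
        * f (v (F w) /\<^sub>R norm (v (F w))) * norm (v (F w)) powr a \<partial>M"
  let ?If = "\<lambda>x. \<integral>w. indicator (sphere 0 1) (X w /\<^sub>R norm (X w)) * f (X w /\<^sub>R norm (X w))
        * (if u * x < norm (X w) then 1 else 0) \<partial>M"
  have mf0 [measurable]: "(\<lambda>z. indicator (sphere 0 1) z * f z) \<in> borel_measurable borel"
    using borel_measurable_continuous_on_indicator[OF _ f] by simp
  have T: "(LINT z:sphere 0 1|tail_direction_measure M X u x. f z) = ?If x / prob {w \<in> space M. x < norm (X w)}" for x
  proof -
    let ?p = "prob {w \<in> space M. x < norm (X w)}"
    let ?N = "distr (density M (indicator {w \<in> space M. u * x < norm (X w)})) borel (\<lambda>w. X w /\<^sub>R norm (X w))"
    have "(LINT z:sphere 0 1|tail_direction_measure M X u x. f z) = (1 / ?p) * (\<integral>z. indicator (sphere 0 1) z * f z \<partial>?N)"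
      unfolding set_lebesgue_integral_def tail_direction_measure_def real_scaleR_def
      by (subst integral_scale_measure) auto
    also have "(\<integral>z. indicator (sphere 0 1) z * f z \<partial>?N)
      = (\<integral>w. indicator (sphere 0 1) (X w /\<^sub>R norm (X w)) * f (X w /\<^sub>R norm (X w))
        \<partial>density M (indicator {w \<in> space M. u * x < norm (X w)}))"
      by (subst integral_distr) auto
    also have "density M (indicator {w \<in> space M. u * x < norm (X w)})
      = density M (\<lambda>w. ennreal (indicator {w \<in> space M. u * x < norm (X w)} w))"
      by (intro density_cong) (auto simp: indicator_def)
    also have "(\<integral>w. indicator (sphere 0 1) (X w /\<^sub>R norm (X w)) * f (X w /\<^sub>R norm (X w)) \<partial>\<dots>)
      = (\<integral>w. indicator {w \<in> space M. u * x < norm (X w)} w *\<^sub>R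
          (indicator (sphere 0 1) (X w /\<^sub>R norm (X w)) * f (X w /\<^sub>R norm (X w))) \<partial>M)"
    proof (rule integral_density)
      show "(\<lambda>w. indicator (sphere 0 1) (X w /\<^sub>R norm (X w)) * f (X w /\<^sub>R norm (X w))) \<in> borel_measurable M"
        using measurable_compose[OF _ mf0, of "\<lambda>w. X w /\<^sub>R norm (X w)" M] by simp
    qed auto
    also have "\<dots> = ?If x"
      by (intro Bochner_Integration.integral_cong) (auto simp: indicator_def)
    finally show ?thesis by simp
  qed
  have Iu: "((\<lambda>x. x powr a * ?If x) \<longlongrightarrow> c * u powr (- a) * ?mf) at_top"
    by (rule breiman_perturbed[OF ind my mv tail c y0 a int mX E f u])
  have I1: "((\<lambda>x. x powr a * prob {w \<in> space M. x < norm (X w)}) \<longlongrightarrow> c * ?m) at_top"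
  proof -
    have l: "((\<lambda>x. x powr a * (\<integral>w. indicator (sphere 0 1) (X w /\<^sub>R norm (X w)) * 1
        * (if 1 * x < norm (X w) then 1 else 0) \<partial>M)) \<longlongrightarrow> c * 1 powr (- a) * (\<integral>w. indicator (sphere 0 1) (v (F w) /\<^sub>R norm (v (F w)))
        * 1 * norm (v (F w)) powr a \<partial>M)) at_top"
      by (rule breiman_perturbed[OF ind my mv tail c y0 a int mX E]) auto
    have e1: "(\<integral>w. indicator (sphere 0 1) (v (F w) /\<^sub>R norm (v (F w))) * 1 * norm (v (F w)) powr a \<partial>M) = ?m"
    proof (rule Bochner_Integration.integral_cong[OF refl])
      fix w
      show "indicator (sphere 0 1) (v (F w) /\<^sub>R norm (v (F w))) * 1 * norm (v (F w)) powr a = norm (v (F w)) powr a"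
        using a by (cases "v (F w) = 0") auto
    qed
    have e2: "\<forall>\<^sub>F x in at_top. x powr a * (\<integral>w. indicator (sphere 0 1) (X w /\<^sub>R norm (X w)) * 1
        * (if 1 * x < norm (X w) then 1 else 0) \<partial>M) = x powr a * prob {w \<in> space M. x < norm (X w)}"
      using eventually_gt_at_top[of 0]
    proof eventually_elim
      case (elim x)
      have "(\<integral>w. indicator (sphere 0 1) (X w /\<^sub>R norm (X w)) * 1 * (if 1 * x < norm (X w) then 1 else 0) \<partial>M)
        = (\<integral>w. indicator {w \<in> space M. x < norm (X w)} w \<partial>M :: real)"
      proof (rule Bochner_Integration.integral_cong[OF refl])
        fix w assume "w \<in> space M"
        then show "indicator (sphere 0 1) (X w /\<^sub>R norm (X w)) * 1 * (if 1 * x < norm (X w) then 1 else 0)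
          = (indicator {w \<in> space M. x < norm (X w)} w :: real)"
          using elim by (cases "X w = 0") (auto simp: indicator_def)
      qed
      then show ?case by simp
    qed
    show ?thesis using Lim_transform_eventually[OF l e2] unfolding e1 by simp
  qed
  have "((\<lambda>x. (x powr a * ?If x) / (x powr a * prob {w \<in> space M. x < norm (X w)}))
      \<longlongrightarrow> (c * u powr (- a) * ?mf) / (c * ?m)) at_top"
    by (intro tendsto_divide Iu I1) (use c pos in simp)
  moreover have "\<forall>\<^sub>F x in at_top. (x powr a * ?If x) / (x powr a * prob {w \<in> space M. x < norm (X w)})
    = (LINT z:sphere 0 1|tail_direction_measure M X u x. f z)"
    using eventually_gt_at_top[of 0] by eventually_elim (simp add: T)
  ultimately have "((\<lambda>x. LINT z:sphere 0 1|tail_direction_measure M X u x. f z)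
      \<longlongrightarrow> (c * u powr (- a) * ?mf) / (c * ?m)) at_top"
    by (rule Lim_transform_eventually)
  also have "(c * u powr (- a) * ?mf) / (c * ?m) = (LINT z:sphere 0 1|scale_measure (ennreal (u powr - a)) Q. f z)"
    unfolding set_lebesgue_integral_def real_scaleR_def
    using c Q(2) by (subst integral_scale_measure) (auto simp: law[OF f] cong: measurable_cong_sets)
  finally show "((\<lambda>x. LINT z:sphere 0 1|tail_direction_measure M X u x. f z)
    \<longlongrightarrow> (LINT z:sphere 0 1|scale_measure (ennreal (u powr - a)) Q. f z)) at_top" .
qed (use a Q in auto)

end

section \<open>Independent innovations and random signs\<close>

lemma borel_measurable_vec [measurable (raw)]:
  fixes f :: "'i::finite \<Rightarrow> 'a \<Rightarrow> real"
  assumes "\<And>i. f i \<in> borel_measurable M"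
  shows "(\<lambda>x. \<chi> i. f i x) \<in> borel_measurable M"
  using assms by (subst borel_measurable_euclidean_space) (auto simp: Basis_vec_def inner_axis)

lemma borel_measurable_nth [measurable (raw)]:
  fixes f :: "'a \<Rightarrow> real ^ 'n"
  assumes "f \<in> borel_measurable M"
  shows "(\<lambda>x. f x $ i) \<in> borel_measurable M"
  using borel_measurable_inner[OF assms borel_measurable_const[of "axis i 1"]] by (simp add: inner_axis)

context prob_space
begin

text \<open>Reading an i.i.d. family along any injection yields the same product law. This gives
  both stationarity in time and invariance under sign changes.\<close>

lemma distr_iid_reindex:
  fixes Z :: "int \<Rightarrow> 'a \<Rightarrow> 'b::topological_space" and f :: "nat \<Rightarrow> int"
  assumes ind: "indep_vars (\<lambda>_. borel) Z UNIV" and id: "\<And>t. distr M borel (Z t) = \<nu>" and "inj f"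
  shows "distr M (\<Pi>\<^sub>M k\<in>UNIV. borel) (\<lambda>w k. Z (f k) w) = (\<Pi>\<^sub>M k\<in>UNIV. \<nu>)"
proof -
  have rv [measurable]: "Z t \<in> borel_measurable M" for t using ind by (auto simp: indep_vars_def)
  interpret N: prob_space \<nu> unfolding id[of 0, symmetric] by (rule prob_space_distr) simp
  have sN [measurable_cong]: "sets \<nu> = sets borel" unfolding id[of 0, symmetric] by simp
  have D: "distr M (\<Pi>\<^sub>M i\<in>UNIV. borel) (\<lambda>w i. Z i w) = (\<Pi>\<^sub>M i\<in>UNIV. \<nu>)"
    using indep_vars_iff_distr_eq_PiM'[where I = UNIV and M' = "\<lambda>_. borel" and X = Z] ind rv by (simp add: id restrict_def)
  have s: "sets (\<Pi>\<^sub>M k\<in>UNIV. \<nu>) = sets (\<Pi>\<^sub>M k\<in>(UNIV :: nat set). borel)"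
    by (intro sets_PiM_cong) (auto simp: sN)
  have "distr M (\<Pi>\<^sub>M k\<in>UNIV. borel) (\<lambda>w k. Z (f k) w)
    = distr (distr M (\<Pi>\<^sub>M i\<in>UNIV. borel) (\<lambda>w i. Z i w)) (\<Pi>\<^sub>M k\<in>UNIV. borel) (\<lambda>z k. z (f k))"
    by (subst distr_distr) (auto simp: comp_def intro!: measurable_PiM_single')
  also have "\<dots> = distr (\<Pi>\<^sub>M i\<in>UNIV. \<nu>) (\<Pi>\<^sub>M k\<in>UNIV. \<nu>) (\<lambda>z k. z (f k))"
    unfolding D by (rule distr_cong) (auto simp: s)
  also have "\<dots> = (\<Pi>\<^sub>M k\<in>UNIV. \<nu>)"
    using distr_PiM_reindex[of UNIV "\<lambda>_. \<nu>" f UNIV] N.prob_space_axioms \<open>inj f\<close>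
    by (simp add: restrict_def)
  finally show ?thesis .
qed

text \<open>The index sets {t..} and {..<t} are disjoint. Both blocks are recoded as sequences over
  the naturals, so past and future share one state space.\<close>

lemma indep_future_past:
  fixes Z :: "int \<Rightarrow> 'a \<Rightarrow> 'b::topological_space"
  assumes ind: "indep_vars (\<lambda>_. borel) Z UNIV"
  shows "indep_var (\<Pi>\<^sub>M k\<in>UNIV. borel) (\<lambda>w k. Z (t + int k) w)
    (\<Pi>\<^sub>M k\<in>UNIV. borel) (\<lambda>w k. Z (t - 1 - int k) w)"
proof -
  have "indep_var (PiM {t..} (\<lambda>_. borel)) (\<lambda>w. restrict (\<lambda>i. Z i w) {t..})
    (PiM {..<t} (\<lambda>_. borel)) (\<lambda>w. restrict (\<lambda>i. Z i w) {..<t})"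
    by (rule indep_var_restrict[OF ind]) auto
  then have "indep_var (\<Pi>\<^sub>M k\<in>UNIV. borel) ((\<lambda>z k. z (t + int k)) \<circ> (\<lambda>w. restrict (\<lambda>i. Z i w) {t..}))
    (\<Pi>\<^sub>M k\<in>UNIV. borel) ((\<lambda>z k. z (t - 1 - int k)) \<circ> (\<lambda>w. restrict (\<lambda>i. Z i w) {..<t}))"
    by (rule indep_var_compose) (auto intro!: measurable_PiM_single' measurable_component_singleton)
  then show ?thesis by (simp add: comp_def)
qed

text \<open>Each innovation has the law of its negative, so the family with deterministic signs
  attached is again i.i.d. with the same marginal.\<close>

lemma distr_iid_signs:
  fixes Z :: "int \<Rightarrow> 'a \<Rightarrow> 'b::euclidean_space"
  assumes ind: "indep_vars (\<lambda>_. borel) Z UNIV" and id: "\<And>t. distr M borel (Z t) = \<nu>"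
    and sym: "\<And>t. distr M borel (\<lambda>w. - Z t w) = distr M borel (Z t)"
    and r: "\<And>k. r k = 1 \<or> r k = (-1::real)"
  shows "distr M (\<Pi>\<^sub>M k\<in>UNIV. borel) (\<lambda>w k. r k *\<^sub>R Z (t + int k) w)
    = distr M (\<Pi>\<^sub>M k\<in>UNIV. borel) (\<lambda>w k. Z (t + int k) w)"
proof -
  \<comment> \<open>Indices below t all receive the sign r 0, an arbitrary choice: only the indices
    t + k are read.\<close>
  define Z' where "Z' i w = r (nat (i - t)) *\<^sub>R Z i w" for i w
  have inj: "inj (\<lambda>k. t + int k)" by (simp add: inj_def)
  have ind': "indep_vars (\<lambda>_. borel) Z' UNIV"
    unfolding Z'_def[abs_def] by (rule indep_vars_compose2[OF ind]) simp
  have id': "distr M borel (Z' i) = \<nu>" for i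
    using r[of "nat (i - t)"] sym[of i] id[of i] by (auto simp: Z'_def[abs_def])
  have "distr M (\<Pi>\<^sub>M k\<in>UNIV. borel) (\<lambda>w k. r k *\<^sub>R Z (t + int k) w)
    = distr M (\<Pi>\<^sub>M k\<in>UNIV. borel) (\<lambda>w k. Z' (t + int k) w)" by (simp add: Z'_def)
  then show ?thesis
    by (simp add: distr_iid_reindex[OF ind' id' inj] distr_iid_reindex[OF ind id inj])
qed

end

text \<open>Each coordinate map permutes {-1, 1}. This lets the random signs absorb any fixed sign
  pattern, in particular that of V at a given outcome.\<close>

lemma distr_PiM_uniform_signs:
  fixes s :: "'n::finite \<Rightarrow> real"
  assumes s: "\<And>j. s j = 1 \<or> s j = -1"
  defines "R \<equiv> \<Pi>\<^sub>M j\<in>UNIV. measure_pmf (pmf_of_set {-1, 1 :: real})"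
  shows "distr R R (\<lambda>r j. s j * r j) = R"
proof -
  let ?\<mu> = "measure_pmf (pmf_of_set {-1, 1 :: real})"
  interpret product_prob_space "\<lambda>j::'n. ?\<mu>" UNIV ..
  have m: "(\<lambda>r j. s j * r j) \<in> measurable R R"
  proof -
    have "(\<lambda>r. s j * r j) \<in> measurable R ?\<mu>" for j
      unfolding R_def by (rule measurable_compose[where g = "\<lambda>x. s j * x", OF measurable_component_singleton]) auto
    then show ?thesis unfolding R_def by (intro measurable_PiM_single') auto
  qed
  have img: "emeasure ?\<mu> ((\<lambda>x. s j * x) -` A) = emeasure ?\<mu> A" for j A
  proof -
    have "inj_on (\<lambda>x. s j * x) {-1, 1}" using s[of j] by (auto simp: inj_on_def)
    then have "map_pmf (\<lambda>x. s j * x) (pmf_of_set {-1, 1}) = pmf_of_set ((\<lambda>x. s j * x) ` {-1, 1})"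
      by (rule map_pmf_of_set_inj) auto
    also have "(\<lambda>x. s j * x) ` {-1, 1} = {-1, 1}" using s[of j] by auto
    finally have eq: "map_pmf (\<lambda>x. s j * x) (pmf_of_set {-1, 1}) = pmf_of_set {-1, 1}" .
    have "emeasure ?\<mu> A = emeasure (measure_pmf (map_pmf (\<lambda>x. s j * x) (pmf_of_set {-1, 1}))) A"
      by (simp only: eq)
    then show ?thesis by (simp add: emeasure_map_pmf)
  qed
  show ?thesis
    unfolding R_def
  proof (rule PiM_eqI)
    fix A :: "'n \<Rightarrow> real set"
    have eq: "(\<lambda>r j. s j * r j) -` (Pi\<^sub>E UNIV A) \<inter> space R = Pi\<^sub>E UNIV (\<lambda>j. (\<lambda>x. s j * x) -` A j)"
      by (auto simp: R_def space_PiM PiE_def)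
    have "emeasure (distr R R (\<lambda>r j. s j * r j)) (Pi\<^sub>E UNIV A) = emeasure R (Pi\<^sub>E UNIV (\<lambda>j. (\<lambda>x. s j * x) -` A j))"
      using emeasure_distr[OF m, of "Pi\<^sub>E UNIV A"] eq by (simp add: R_def sets_PiM_I_finite)
    also have "\<dots> = (\<Prod>j\<in>UNIV. emeasure ?\<mu> ((\<lambda>x. s j * x) -` A j))"
      unfolding R_def by (rule emeasure_PiM) auto
    finally show "emeasure (distr (Pi\<^sub>M UNIV (\<lambda>j. ?\<mu>)) (Pi\<^sub>M UNIV (\<lambda>j. ?\<mu>)) (\<lambda>r j. s j * r j)) (Pi\<^sub>E UNIV A)
      = (\<Prod>i\<in>UNIV. emeasure ?\<mu> (A i))" by (simp add: img R_def)
  qed auto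
qed

lemma norm_sign_vec:
  fixes x :: "real ^ 'n"
  assumes "\<And>j. r j = 1 \<or> r j = -1"
  shows "norm (\<chi> j. r j * x $ j) = norm x"
proof -
  have "r j * x $ j * (r j * x $ j) = x $ j * x $ j" for j using assms[of j] by auto
  then show ?thesis
    unfolding norm_eq_sqrt_inner inner_vec_def by (simp only: vec_lambda_beta inner_real_def)
qed

section \<open>Factoring uniform signs out of the directional law\<close>

context prob_space
begin

lemma prob_space_weighted_direction_law:
  fixes Y :: "'a \<Rightarrow> real ^ 'n"
  assumes [measurable]: "Y \<in> borel_measurable M" and int: "integrable M (\<lambda>w. norm (Y w) powr a)"
    and pos: "0 < (\<integral>w. norm (Y w) powr a \<partial>M)"
  shows "prob_space (weighted_direction_law M Y a)"
  unfolding weighted_direction_law_def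
proof (rule prob_space.prob_space_distr[OF prob_spaceI])
  let ?m = "\<integral>w. norm (Y w) powr a \<partial>M"
  have "(\<integral>\<^sup>+w. ennreal (norm (Y w) powr a / ?m) \<partial>M) = ennreal (\<integral>w. norm (Y w) powr a / ?m \<partial>M)"
    using int pos by (intro nn_integral_eq_integral) auto
  also have "\<dots> = 1" using pos by simp
  finally show "emeasure (density M (\<lambda>w. ennreal (norm (Y w) powr a / ?m)))
      (space (density M (\<lambda>w. ennreal (norm (Y w) powr a / ?m)))) = 1"
    by (subst emeasure_density) (auto simp: nn_integral_set_ennreal cong: nn_integral_cong_simp)
qed simp

text \<open>At a fixed outcome, Y and V differ by a sign pattern, which averaging over r absorbs; at
  fixed r, the sign change is absorbed by the symmetry \<open>flip\<close> of the law of V. Passing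
  between the two views exchanges the integrals twice.\<close>

lemma random_sign_law:
  fixes V Y :: "'a \<Rightarrow> real ^ 'n"
  assumes mV [measurable]: "V \<in> borel_measurable M" and mY [measurable]: "Y \<in> borel_measurable M"
    and Y: "\<And>w j. Y w $ j = \<bar>V w $ j\<bar>"
    and a: "0 < a" and int: "integrable M (\<lambda>w. norm (V w) powr a)"
    and pos: "0 < (\<integral>w. norm (V w) powr a \<partial>M)"
    and flip: "\<And>r. (\<And>j. r j = 1 \<or> r j = -1) \<Longrightarrow>
      distr M borel (\<lambda>w. \<chi> j. r j * V w $ j) = distr M borel V"
  defines "Q \<equiv> random_sign_law (weighted_direction_law M Y a)"
  shows "prob_space Q" "sets Q = sets borel" "AE z in Q. z \<in> sphere 0 1"
    and "\<And>f. continuous_on (sphere 0 1) f \<Longrightarrow>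
      (\<integral>z. indicator (sphere 0 1) z * f z \<partial>Q) = (\<integral>w. indicator (sphere 0 1) (V w /\<^sub>R norm (V w))
        * f (V w /\<^sub>R norm (V w)) * norm (V w) powr a \<partial>M) / (\<integral>w. norm (V w) powr a \<partial>M)"
proof -
  define T where "T = weighted_direction_law M Y a"
  define R where "R = (\<Pi>\<^sub>M j\<in>(UNIV :: 'n set). measure_pmf (pmf_of_set {-1, 1 :: real}))"
  define m where "m = (\<integral>w. norm (V w) powr a \<partial>M)"
  define act where "act r x = (\<chi> j. r j * x $ j)" for r and x :: "real ^ 'n"
  have nY: "norm (Y w) = norm (V w)" for w
    by (simp add: norm_eq_sqrt_inner inner_vec_def Y)
  interpret T: prob_space T
    unfolding T_def by (rule prob_space_weighted_direction_law) (use int pos in \<open>auto simp: nY\<close>)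
  have sT [measurable_cong]: "sets T = sets borel" by (simp add: T_def weighted_direction_law_def)
  interpret R: prob_space R
    unfolding R_def by (rule prob_space_PiM) (rule measure_pmf.prob_space_axioms)
  interpret TR: pair_prob_space T R ..
  interpret MR: pair_prob_space M R ..
  have comp: "(\<lambda>r. r j) \<in> borel_measurable R" for j
  proof -
    have "(\<lambda>r. r j) \<in> measurable R (measure_pmf (pmf_of_set {-1, 1 :: real}))"
      unfolding R_def by (rule measurable_component_singleton) simp
    then show ?thesis by (rule measurable_compose) simp
  qed
  have mact: "(\<lambda>x. act (g x) (h x)) \<in> borel_measurable N"
    if "g \<in> measurable N R" and [measurable]: "h \<in> borel_measurable N" for g h and N :: "'x measure"
  proof -
    have [measurable]: "(\<lambda>x. g x j) \<in> borel_measurable N" for j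
      by (rule measurable_compose[OF that(1) comp])
    show ?thesis unfolding act_def by measurable
  qed
  have mactc: "act r \<in> borel_measurable borel" for r
    unfolding act_def[abs_def] by measurable
  \<comment> \<open>The product space consists of all real families; the components are signs only
    almost surely.\<close>
  have AE_R: "AE r in R. \<forall>j. r j = 1 \<or> r j = -1"
  proof -
    have "AE r in R. r j = 1 \<or> r j = -1" for j
      unfolding R_def
      by (rule AE_PiM_component[where P = "\<lambda>x. x = 1 \<or> x = -1"])
         (auto simp: AE_measure_pmf_iff measure_pmf.prob_space_axioms)
    then show ?thesis by (subst AE_all_countable) auto
  qed
  have Q: "Q = distr (T \<Otimes>\<^sub>M R) borel (\<lambda>(\<theta>, r). act r \<theta>)"
    by (simp add: Q_def random_sign_law_def T_def R_def act_def)
  have mp: "(\<lambda>(\<theta>, r). act r \<theta>) \<in> borel_measurable (T \<Otimes>\<^sub>M R)"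
    unfolding split_beta by (rule mact) auto
  show sQ: "sets Q = sets borel" by (simp add: Q)
  show "prob_space Q"
    unfolding Q by (rule TR.prob_space_distr[OF mp])
  have main: "(\<integral>z. h z \<partial>Q) = (\<integral>w. h (V w /\<^sub>R norm (V w)) * norm (V w) powr a \<partial>M) / m"
    if mh [measurable]: "h \<in> borel_measurable borel" and hb: "\<And>z. \<bar>h z\<bar> \<le> B" for h B
  proof -
    have B: "0 \<le> B" using hb[of 0] by linarith
    let ?n = "\<lambda>x :: real ^ 'n. x /\<^sub>R norm x"
    let ?d = "\<lambda>w. norm (V w) powr a / m"
    \<comment> \<open>Stated for a generic U, since it is applied to Y in one direction and to V in
      the other.\<close>
    have swap: "(\<integral>w. \<integral>r. ?d w * h (act r (?n (U w))) \<partial>R \<partial>M) = (\<integral>r. \<integral>w. ?d w * h (act r (?n (U w))) \<partial>M \<partial>R)"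
        if [measurable]: "U \<in> borel_measurable M" for U
      proof -
        have ma [measurable]: "(\<lambda>p. h (act (snd p) (?n (U (fst p))))) \<in> borel_measurable (M \<Otimes>\<^sub>M R)"
          by (rule measurable_compose[OF mact mh]) auto
        have "integrable (M \<Otimes>\<^sub>M R) (\<lambda>(w, r). ?d w * h (act r (?n (U w))))"
        proof (rule MR.Fubini_integrable)
          show "(\<lambda>(w, r). ?d w * h (act r (?n (U w)))) \<in> borel_measurable (M \<Otimes>\<^sub>M R)"
            unfolding split_beta by (intro borel_measurable_times ma) measurable
          have mr: "(\<lambda>r. h (act r x)) \<in> borel_measurable R" for x
            by (rule measurable_compose[OF mact mh]) auto
          have ih: "integrable R (\<lambda>r. h (act r x))" for x
            by (rule R.integrable_const_bound[of _ B]) (auto intro: mr hb)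
          show "AE w in M. integrable R (\<lambda>r. case (w, r) of (w, r) \<Rightarrow> ?d w * h (act r (?n (U w))))"
            unfolding split by (intro AE_I2 integrable_mult_right ih)
          have "integrable M (\<lambda>w. ?d w * B)" using int by simp
          then show "integrable M (\<lambda>w. \<integral>r. norm (case (w, r) of (w, r) \<Rightarrow> ?d w * h (act r (?n (U w)))) \<partial>R)"
          proof (rule Bochner_Integration.integrable_bound)
            have "(\<lambda>p. norm (?d (fst p) * h (act (snd p) (?n (U (fst p)))))) \<in> borel_measurable (M \<Otimes>\<^sub>M R)"
              by measurable
            then show "(\<lambda>w. \<integral>r. norm (case (w, r) of (w, r) \<Rightarrow> ?d w * h (act r (?n (U w)))) \<partial>R) \<in> borel_measurable M"
              by (intro R.borel_measurable_lebesgue_integral) (simp add: split_beta)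
            show "AE w in M. norm (\<integral>r. norm (case (w, r) of (w, r) \<Rightarrow> ?d w * h (act r (?n (U w)))) \<partial>R) \<le> norm (?d w * B)"
            proof (intro AE_I2)
              fix w
              have d: "0 \<le> ?d w" using pos by (simp add: m_def)
              have "(\<integral>r. norm (?d w * h (act r (?n (U w)))) \<partial>R) \<le> (\<integral>r. ?d w * B \<partial>R)"
              proof (rule integral_mono)
                show "norm (?d w * h (act r (?n (U w)))) \<le> ?d w * B" for r
                  unfolding real_norm_def abs_mult[of "?d w"] abs_of_nonneg[OF d] by (rule mult_left_mono[OF hb d])
              qed (intro integrable_norm integrable_mult_right ih, simp)
              also have "(\<integral>r. ?d w * B \<partial>R) = ?d w * B" by (simp only: lebesgue_integral_const R.prob_space) simp
              finally have le: "(\<integral>r. norm (?d w * h (act r (?n (U w)))) \<partial>R) \<le> ?d w * B" .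
              have "0 \<le> (\<integral>r. norm (?d w * h (act r (?n (U w)))) \<partial>R)" by (rule integral_nonneg_AE) simp
              then show "norm (\<integral>r. norm (case (w, r) of (w, r) \<Rightarrow> ?d w * h (act r (?n (U w)))) \<partial>R) \<le> norm (?d w * B)"
                unfolding split using le by (simp only: real_norm_def)
            qed
          qed
        qed
        from MR.Fubini_integral[OF this] show ?thesis by (rule sym)
      qed
    have "(\<integral>z. h z \<partial>Q) = (\<integral>p. h (act (snd p) (fst p)) \<partial>(T \<Otimes>\<^sub>M R))"
      unfolding Q by (subst integral_distr[OF mp]) (auto simp: split_beta)
    also have "\<dots> = (\<integral>r. \<integral>\<theta>. h (act r \<theta>) \<partial>T \<partial>R)"
    proof -
      have "(\<lambda>p. h (act (snd p) (fst p))) \<in> borel_measurable (T \<Otimes>\<^sub>M R)"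
        by (rule measurable_compose[OF mact mh]) auto
      then have "integrable (T \<Otimes>\<^sub>M R) (\<lambda>(\<theta>, r). h (act r \<theta>))"
        unfolding split_beta by (intro TR.P.integrable_const_bound[of _ B]) (auto simp: hb)
      from TR.integral_snd[OF this] show ?thesis by (simp add: case_prod_unfold)
    qed
    also have "\<dots> = (\<integral>r. \<integral>w. ?d w * h (act r (?n (Y w))) \<partial>M \<partial>R)"
    proof (rule Bochner_Integration.integral_cong[OF refl])
      fix r
      have mr [measurable]: "(\<lambda>\<theta>. h (act r \<theta>)) \<in> borel_measurable borel"
        by (rule measurable_compose[OF mactc mh])
      have "(\<integral>\<theta>. h (act r \<theta>) \<partial>T) = (\<integral>w. h (act r (?n (Y w))) \<partial>density M (\<lambda>w. ennreal (norm (Y w) powr a / (\<integral>v. norm (Y v) powr a \<partial>M))))"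
        unfolding T_def weighted_direction_law_def by (subst integral_distr) auto
      also have "\<dots> = (\<integral>w. ?d w *\<^sub>R h (act r (?n (Y w))) \<partial>M)"
        unfolding nY m_def[symmetric]
        by (rule integral_density) (use pos in \<open>auto simp: m_def intro!: measurable_compose[OF _ mr]\<close>)
      finally show "(\<integral>\<theta>. h (act r \<theta>) \<partial>T) = (\<integral>w. ?d w * h (act r (?n (Y w))) \<partial>M)" by simp
    qed
    also have "\<dots> = (\<integral>w. \<integral>r. ?d w * h (act r (?n (Y w))) \<partial>R \<partial>M)"
      by (rule swap[OF mY, symmetric])
    also have "\<dots> = (\<integral>w. \<integral>r. ?d w * h (act r (?n (V w))) \<partial>R \<partial>M)"
    proof (rule Bochner_Integration.integral_cong[OF refl])
      fix w
      \<comment> \<open>The pattern that turns |V| into V componentwise; a zero component may carry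
        either sign.\<close>
      define s where "s j = (if V w $ j < 0 then -1 else (1::real))" for j
      have s: "s j = 1 \<or> s j = -1" for j by (simp add: s_def)
      have sR: "distr R R (\<lambda>r j. s j * r j) = R"
        unfolding R_def by (rule distr_PiM_uniform_signs[OF s])
      have ms: "(\<lambda>r j. s j * r j) \<in> measurable R R"
        unfolding R_def
      proof (intro measurable_PiM_single')
        show "(\<lambda>r. s j * r j) \<in> measurable (\<Pi>\<^sub>M j\<in>UNIV. measure_pmf (pmf_of_set {-1, 1})) (measure_pmf (pmf_of_set {-1, 1}))" for j
          by (rule measurable_compose[where g = "\<lambda>x. s j * x", OF measurable_component_singleton]) auto
      qed auto
      have "(\<integral>r. ?d w * h (act r (?n (V w))) \<partial>R) = (\<integral>r. ?d w * h (act r (?n (V w))) \<partial>distr R R (\<lambda>r j. s j * r j))"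
        by (simp only: sR)
      also have "\<dots> = (\<integral>r. ?d w * h (act (\<lambda>j. s j * r j) (?n (V w))) \<partial>R)"
        by (rule integral_distr[OF ms])
           (intro borel_measurable_times borel_measurable_const measurable_compose[OF mact mh] measurable_ident_sets[OF refl])
      also have "\<dots> = (\<integral>r. ?d w * h (act r (?n (Y w))) \<partial>R)"
      proof -
        have "act (\<lambda>j. s j * r j) (?n (V w)) = act r (?n (Y w))" for r
          unfolding act_def nY by (simp add: vec_eq_iff Y s_def)
        then show ?thesis by (simp only:)
      qed
      finally show "(\<integral>r. ?d w * h (act r (?n (Y w))) \<partial>R) = (\<integral>r. ?d w * h (act r (?n (V w))) \<partial>R)" by (rule sym)
    qed
    also have "\<dots> = (\<integral>r. \<integral>w. ?d w * h (act r (?n (V w))) \<partial>M \<partial>R)"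
      by (rule swap[OF mV])
    also have "\<dots> = (\<integral>r. (\<integral>w. ?d w * h (?n (V w)) \<partial>M) \<partial>R)"
    proof (rule integral_cong_AE)
      show "AE r in R. (\<integral>w. ?d w * h (act r (?n (V w))) \<partial>M) = (\<integral>w. ?d w * h (?n (V w)) \<partial>M)"
        using AE_R
      proof eventually_elim
        case (elim r)
        have n: "norm (act r x) = norm x" for x
          unfolding act_def by (rule norm_sign_vec) (use elim in blast)
        have D: "distr M borel (\<lambda>w. act r (V w)) = distr M borel V"
          unfolding act_def by (rule flip) (use elim in blast)
        have [measurable]: "(\<lambda>w. act r (V w)) \<in> borel_measurable M"
          by (rule measurable_compose[OF mV mactc])
        have act_n: "act r (?n x) = ?n (act r x)" for x
          unfolding n by (simp add: act_def vec_eq_iff mult.left_commute)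
        let ?g = "\<lambda>x. norm x powr a / m * h (?n x)"
        have "(\<integral>w. ?d w * h (act r (?n (V w))) \<partial>M) = (\<integral>w. ?g (act r (V w)) \<partial>M)"
          by (simp only: act_n n)
        also have "\<dots> = (\<integral>x. ?g x \<partial>distr M borel (\<lambda>w. act r (V w)))"
          by (subst integral_distr) auto
        also have "\<dots> = (\<integral>w. ?g (V w) \<partial>M)"
          unfolding D by (subst integral_distr) auto
        finally show ?case .
      qed
      have "(\<lambda>p. h (act (fst p) (?n (V (snd p))))) \<in> borel_measurable (R \<Otimes>\<^sub>M M)"
        by (rule measurable_compose[OF mact mh]) auto
      then show "(\<lambda>r. \<integral>w. ?d w * h (act r (?n (V w))) \<partial>M) \<in> borel_measurable R"
        by (intro borel_measurable_lebesgue_integral) (simp add: split_beta)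
    qed simp
    also have "\<dots> = (\<integral>w. h (?n (V w)) * norm (V w) powr a / m \<partial>M)"
      by (simp add: R.prob_space mult.commute)
    finally show ?thesis by simp
  qed
  have ind1: "(\<lambda>z. indicator (sphere 0 1) z * (f z :: real)) \<in> borel_measurable borel"
    if "continuous_on (sphere 0 1) f" for f :: "real ^ 'n \<Rightarrow> real"
    using borel_measurable_continuous_on_indicator[OF _ that] by simp
  show "(\<integral>z. indicator (sphere 0 1) z * f z \<partial>Q) = (\<integral>w. indicator (sphere 0 1) (V w /\<^sub>R norm (V w))
        * f (V w /\<^sub>R norm (V w)) * norm (V w) powr a \<partial>M) / (\<integral>w. norm (V w) powr a \<partial>M)"
    if f: "continuous_on (sphere 0 1) f" for f
  proof -
    have "bounded (f ` sphere 0 1)"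
      by (intro compact_imp_bounded compact_continuous_image[OF f]) simp
    then obtain B where "\<forall>z\<in>sphere 0 1. \<bar>f z\<bar> \<le> B" unfolding bounded_iff by auto
    then have "\<bar>indicator (sphere 0 1) z * f z\<bar> \<le> \<bar>B\<bar>" for z
      by (cases "z \<in> sphere 0 1") (auto simp del: mem_sphere intro: order_trans[OF _ abs_ge_self])
    from main[OF ind1[OF f] this] show ?thesis by (simp add: m_def)
  qed
  show "AE z in Q. z \<in> sphere 0 1"
  proof -
    interpret Q: prob_space Q by fact
    have sp: "sphere 0 1 \<in> sets Q" by (simp add: sQ)
    \<comment> \<open>The identity for the indicator of the sphere: outcomes with V = 0 have weight
      0, so the mean is m / m.\<close>
    have "(\<integral>z. indicator (sphere 0 1) z \<partial>Q) = (\<integral>w. indicator (sphere 0 1) (V w /\<^sub>R norm (V w)) * norm (V w) powr a \<partial>M) / m"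
      by (rule main[of _ 1]) (auto split: split_indicator intro!: borel_measurable_indicator borel_closed)
    also have "(\<integral>w. indicator (sphere 0 1) (V w /\<^sub>R norm (V w)) * norm (V w) powr a \<partial>M) = m"
      unfolding m_def
    proof (rule Bochner_Integration.integral_cong[OF refl])
      fix w
      show "indicator (sphere 0 1) (V w /\<^sub>R norm (V w)) * norm (V w) powr a = norm (V w) powr a"
        using a by (cases "V w = 0") auto
    qed
    also have "m / m = 1" using pos by (simp add: m_def)
    finally have "Q.prob (sphere 0 1) = 1" using sp by simp
    then show ?thesis using Q.prob_eq_1[OF sp] by simp
  qed
qed

end

section \<open>Volatility recursions\<close>

text \<open>Makes the difference of \<alpha>-th powers integrable although each power alone has an
  infinite mean. If y exceeds x^\<theta>, then y^p controls (x + y)^\<alpha>; otherwise the first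
  order bound x^(\<alpha> - 1) y is at most x^(\<alpha> - 1 + \<theta>), of order below \<alpha>.
  Arguments below 1 are left to the constant.\<close>

lemma powr_increment_bound:
  assumes "0 < \<alpha>" "\<alpha> < (p::real)"
  shows "\<exists>C r. 0 \<le> C \<and> 0 < r \<and> r < \<alpha> \<and>
    (\<forall>x y. 0 \<le> x \<longrightarrow> 0 \<le> y \<longrightarrow> (x + y) powr \<alpha> - x powr \<alpha> \<le> C * (1 + y powr p + x powr r))"
proof -
  \<comment> \<open>At y = x^\<theta> the powers y^p and x^\<alpha> are equal.\<close>
  define \<theta> where "\<theta> = \<alpha> / p"
  have \<theta>: "0 < \<theta>" "\<theta> < 1" using assms by (auto simp: \<theta>_def)
  \<comment> \<open>The exponent \<alpha> - 1 + \<theta> may be zero or negative; the maximum with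
    \<alpha> / 2 keeps r strictly between 0 and \<alpha>.\<close>
  define r where "r = max (\<alpha> - 1 + \<theta>) (\<alpha> / 2)"
  have r: "0 < r" "r < \<alpha>" using assms \<theta> by (auto simp: r_def)
  define C where "C = max (2 powr p) (\<alpha> * exp \<alpha>)"
  have C: "0 \<le> C" "2 powr p \<le> C" "\<alpha> * exp \<alpha> \<le> C"
    by (auto simp: C_def intro: order_trans[of _ "2 powr p"])
  have main: "(x + y) powr \<alpha> - x powr \<alpha> \<le> C * (1 + y powr p + x powr r)" if x: "0 \<le> x" and y: "0 \<le> y" for x y
  proof -
    have two: "2 powr \<alpha> \<le> C" by (rule order_trans[OF _ C(2)]) (use assms in simp)
    consider "max x y < 1" | "1 \<le> max x y" "x powr \<theta> < y" | "1 \<le> max x y" "y \<le> x powr \<theta>" by linarith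
    then have "(x + y) powr \<alpha> - x powr \<alpha> \<le> C * 1 \<or> (x + y) powr \<alpha> - x powr \<alpha> \<le> C * y powr p
      \<or> (x + y) powr \<alpha> - x powr \<alpha> \<le> C * x powr r"
    proof cases
      case 1
      have "(x + y) powr \<alpha> \<le> 2 powr \<alpha>" using 1 x y assms by (intro powr_mono2) auto
      then have "(x + y) powr \<alpha> \<le> C * 1" using order_trans[OF _ two] by simp
      then show ?thesis using powr_ge_zero[of x \<alpha>] by linarith
    next
      case 2
      have y1: "1 \<le> y"
      proof (rule ccontr)
        assume "\<not> 1 \<le> y"
        then have "1 \<le> x" using 2 by auto
        then have "1 \<le> x powr \<theta>" using \<theta> by (simp add: ge_one_powr_ge_zero)
        then show False using 2 \<open>\<not> 1 \<le> y\<close> by simp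
      qed
      have py: "1 \<le> p / \<alpha>" using assms by simp
      have "x \<le> y powr (p / \<alpha>)"
      proof (cases "x = 0")
        case False
        have "x = (x powr \<theta>) powr (p / \<alpha>)" using x False assms by (simp add: powr_powr \<theta>_def)
        also have "\<dots> \<le> y powr (p / \<alpha>)" using 2 assms by (intro powr_mono2) auto
        finally show ?thesis .
      qed simp
      moreover have "y \<le> y powr (p / \<alpha>)" using y1 powr_mono[OF py y1] by simp
      ultimately have "(x + y) powr \<alpha> \<le> (2 * y powr (p / \<alpha>)) powr \<alpha>"
        using x y assms by (intro powr_mono2) auto
      also have "\<dots> = 2 powr \<alpha> * y powr p" using y assms by (simp add: powr_mult powr_powr)
      also have "\<dots> \<le> C * y powr p" using two by (intro mult_right_mono) auto
      finally show ?thesis using powr_ge_zero[of x \<alpha>] by linarith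
    next
      case 3
      have x1: "1 \<le> x"
      proof (rule ccontr)
        assume "\<not> 1 \<le> x"
        then have "1 \<le> x powr \<theta>" using 3 by (auto simp: max_def split: if_splits)
        moreover have "x powr \<theta> < 1"
          using \<open>\<not> 1 \<le> x\<close> x \<theta> powr_less_mono2[of \<theta> x 1] by simp
        ultimately show False by simp
      qed
      define t where "t = y / x"
      have t: "0 \<le> t" "t \<le> 1"
      proof -
        show "0 \<le> t" using x y by (simp add: t_def)
        have "x powr \<theta> \<le> x powr 1" using x1 \<theta> by (intro powr_mono) auto
        then show "t \<le> 1" using 3 x1 by (simp add: t_def)
      qed
      have "x + y = x * (1 + t)" using x1 by (simp add: t_def field_simps)
      then have eq: "(x + y) powr \<alpha> = x powr \<alpha> * (1 + t) powr \<alpha>"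
        using x t by (simp add: powr_mult)
      have "(1 + t) powr \<alpha> \<le> exp t powr \<alpha>" using t assms by (intro powr_mono2) auto
      also have "\<dots> = exp (\<alpha> * t)" by (simp add: powr_def)
      finally have le1: "(1 + t) powr \<alpha> \<le> exp (\<alpha> * t)" .
      have "exp (\<alpha> * t) * (1 + - (\<alpha> * t)) \<le> exp (\<alpha> * t) * exp (- (\<alpha> * t))"
        by (intro mult_left_mono exp_ge_add_one_self) auto
      then have "exp (\<alpha> * t) - 1 \<le> (\<alpha> * t) * exp (\<alpha> * t)"
        by (simp add: exp_minus algebra_simps)
      also have "\<dots> \<le> (\<alpha> * t) * exp \<alpha>" using assms t by (intro mult_left_mono) (auto simp: mult_left_le)
      finally have "(1 + t) powr \<alpha> - 1 \<le> \<alpha> * exp \<alpha> * t" using le1 by (simp add: mult_ac)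
      then have "x powr \<alpha> * ((1 + t) powr \<alpha> - 1) \<le> x powr \<alpha> * (\<alpha> * exp \<alpha> * t)"
        by (intro mult_left_mono) auto
      then have "(x + y) powr \<alpha> - x powr \<alpha> \<le> \<alpha> * exp \<alpha> * (x powr \<alpha> * t)"
        unfolding eq by (simp add: algebra_simps)
      also have "x powr \<alpha> * t \<le> x powr r"
      proof -
        have "x powr \<alpha> * t = x powr (\<alpha> - 1) * y" using x1 by (simp add: t_def powr_diff)
        also have "\<dots> \<le> x powr (\<alpha> - 1) * x powr \<theta>" using 3 by (intro mult_left_mono) auto
        also have "\<dots> = x powr (\<alpha> - 1 + \<theta>)" by (simp add: powr_add)
        also have "\<dots> \<le> x powr r" using x1 by (intro powr_mono) (auto simp: r_def)
        finally show ?thesis .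
      qed
      then have "\<alpha> * exp \<alpha> * (x powr \<alpha> * t) \<le> C * x powr r"
        using C t by (intro mult_mono) auto
      finally show ?thesis by simp
    qed
    moreover have "0 \<le> C * y powr p" "0 \<le> C * x powr r" using C by auto
    ultimately show ?thesis using C(1) unfolding distrib_left mult_1_right by linarith
  qed
  show ?thesis using C(1) r main by blast
qed

lemma powr_add_le_2:
  assumes "0 \<le> x" "0 \<le> y" "0 \<le> (a::real)"
  shows "(x + y) powr a \<le> 2 powr a * (x powr a + y powr a)"
proof -
  have "(x + y) powr a \<le> (2 * max x y) powr a" using assms by (intro powr_mono2) auto
  also have "\<dots> = 2 powr a * max x y powr a" using assms by (simp add: powr_mult)
  also have "\<dots> \<le> 2 powr a * (x powr a + y powr a)" by (intro mult_left_mono) (auto simp: max_def)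
  finally show ?thesis .
qed

lemma sqrt_powr_double: "0 \<le> x \<Longrightarrow> sqrt x powr (2 * a) = x powr a"
  by (simp add: powr_half_sqrt[symmetric] powr_powr)

lemma (in prob_space) integrable_norm_vec_powr:
  fixes V :: "'a \<Rightarrow> real ^ 'n"
  assumes [measurable]: "V \<in> borel_measurable M" and q: "0 \<le> q"
    and int: "\<And>j. integrable M (\<lambda>w. \<bar>V w $ j\<bar> powr q)"
  shows "integrable M (\<lambda>w. norm (V w) powr q)"
proof (rule Bochner_Integration.integrable_bound)
  let ?n = "real CARD('n)"
  show "integrable M (\<lambda>w. ?n powr q * (\<Sum>j\<in>UNIV. \<bar>V w $ j\<bar> powr q))"
    by (intro integrable_mult_right Bochner_Integration.integrable_sum int)
  show "AE w in M. norm (norm (V w) powr q) \<le> norm (?n powr q * (\<Sum>j\<in>UNIV. \<bar>V w $ j\<bar> powr q))"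
  proof (intro AE_I2)
    fix w
    let ?S = "(\<lambda>j. \<bar>V w $ j\<bar>) ` UNIV"
    have "Max ?S \<in> ?S" by (rule Max_in) auto
    then obtain j where j: "Max ?S = \<bar>V w $ j\<bar>" by (rule imageE)
    have "norm (V w) \<le> (\<Sum>i\<in>UNIV. \<bar>V w $ i\<bar>)" by (rule norm_le_l1_cart)
    also have "\<dots> \<le> (\<Sum>i\<in>(UNIV::'n set). \<bar>V w $ j\<bar>)"
      unfolding j[symmetric] by (intro sum_mono Max_ge) auto
    also have "\<dots> = ?n * \<bar>V w $ j\<bar>" by simp
    finally have "norm (V w) powr q \<le> (?n * \<bar>V w $ j\<bar>) powr q" using q by (intro powr_mono2) auto
    also have "\<dots> = ?n powr q * \<bar>V w $ j\<bar> powr q" by (simp add: powr_mult)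
    also have "\<dots> \<le> ?n powr q * (\<Sum>j\<in>UNIV. \<bar>V w $ j\<bar> powr q)"
      by (intro mult_left_mono member_le_sum) auto
    finally show "norm (norm (V w) powr q) \<le> norm (?n powr q * (\<Sum>j\<in>UNIV. \<bar>V w $ j\<bar> powr q))"
      by (simp add: sum_nonneg)
  qed
qed simp

section \<open>Functionals of the past and of the future of the innovations\<close>

locale iid_innovations = prob_space +
  fixes Z :: "int \<Rightarrow> 'a \<Rightarrow> 'b::euclidean_space"
  assumes Z_indep: "indep_vars (\<lambda>_. borel) Z UNIV"
    and Z_ident: "\<And>s t. distr M borel (Z s) = distr M borel (Z t)"
begin

abbreviation "PN \<equiv> \<Pi>\<^sub>M k\<in>(UNIV :: nat set). (borel :: 'b measure)"

definition past :: "int \<Rightarrow> 'a \<Rightarrow> nat \<Rightarrow> 'b" where "past t w k = Z (t - 1 - int k) w"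

definition future :: "int \<Rightarrow> 'a \<Rightarrow> nat \<Rightarrow> 'b" where "future t w k = Z (t + int k) w"

lemma Z_meas [measurable]: "Z t \<in> borel_measurable M"
  using Z_indep by (auto simp: indep_vars_def)

lemma past_meas [measurable]: "past t \<in> measurable M PN"
  unfolding past_def[abs_def] by (intro measurable_PiM_single') auto

lemma future_meas [measurable]: "future t \<in> measurable M PN"
  unfolding future_def[abs_def] by (intro measurable_PiM_single') auto

lemma indep_fp: "indep_var PN (future t) PN (past t)"
  using indep_future_past[OF Z_indep, of t] by (simp add: future_def[abs_def] past_def[abs_def])

lemma distr_past: "distr M PN (past t) = distr M PN (past s)"
proof -
  have "distr M PN (past t) = (\<Pi>\<^sub>M k\<in>UNIV. distr M borel (Z 0))" for t
    unfolding past_def[abs_def] by (rule distr_iid_reindex[OF Z_indep Z_ident]) (simp add: inj_def)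
  then show ?thesis by simp
qed

text \<open>The form in which stationarity is used: successive volatilities are one functional
  applied to shifted pasts.\<close>

lemma distr_past_compose:
  assumes [measurable]: "h \<in> borel_measurable PN"
  shows "distr M borel (\<lambda>w. h (past t w)) = distr M borel (\<lambda>w. h (past s w))"
proof -
  have "distr M borel (\<lambda>w. h (past t w)) = distr (distr M PN (past t)) borel h" for t
    by (subst distr_distr) (auto simp: comp_def)
  then show ?thesis using distr_past[of t s] by simp
qed

lemma indep_Z_past:
  assumes [measurable]: "g \<in> borel_measurable borel" "h \<in> borel_measurable PN"
  shows "indep_var borel (\<lambda>w. g (Z t w)) borel (\<lambda>w. h (past t w))"
proof -
  have "indep_var borel ((\<lambda>z. g (z 0)) \<circ> future t) borel (h \<circ> past t)"
    by (rule indep_var_compose[OF indep_fp]) auto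
  then show ?thesis by (simp add: comp_def future_def)
qed

lemma integrable_Z_past:
  fixes g :: "'b \<Rightarrow> real"
  assumes "g \<in> borel_measurable borel" "h \<in> borel_measurable PN"
    and "integrable M (\<lambda>w. g (Z t w))" "integrable M (\<lambda>w. h (past t w))"
  shows "integrable M (\<lambda>w. g (Z t w) * h (past t w))"
  by (rule indep_var_integrable[OF indep_Z_past[OF assms(1,2)] assms(3,4)])

lemma shift_meas: "(\<lambda>z k. z (Suc k)) \<in> measurable PN PN"
  by (intro measurable_PiM_single') (auto intro!: measurable_component_singleton)

lemma past_shift: "(\<lambda>k. past t w (Suc k)) = past (t - 1) w"
  by (auto simp: past_def algebra_simps)

end

text \<open>In the applications c picks a coordinate. The volatility at time t and the additive term
  of its recursion are the functions phi and psi of the past innovations Z (t - 1), Z (t - 2), ....\<close>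

locale garch_innovations = iid_innovations +
  fixes c :: "'b \<Rightarrow> real" and a b :: real
begin

definition A :: "int \<Rightarrow> 'a \<Rightarrow> real" where "A t w = a * (c (Z (t - 1) w))\<^sup>2 + b"

end

text \<open>What the two coordinates have in common. The orders of the moments are the point: below
  \<alpha> for the volatility, strictly above \<alpha> for the additive term.\<close>

locale garch_component = garch_innovations +
  fixes \<alpha> p :: real and \<phi> \<psi> :: "(nat \<Rightarrow> 'b) \<Rightarrow> real"
  assumes Z_sym: "\<And>t. distr M borel (\<lambda>w. - Z t w) = distr M borel (Z t)"
    and c_meas [measurable]: "c \<in> borel_measurable borel"
    and c_minus: "\<And>z. c (- z) = - c z"
    and param_pos: "0 < a" "0 < b" "0 < \<alpha>" "\<alpha> < p"
    and \<phi>_meas [measurable]: "\<phi> \<in> borel_measurable (\<Pi>\<^sub>M k\<in>UNIV. borel)"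
    and \<psi>_meas [measurable]: "\<psi> \<in> borel_measurable (\<Pi>\<^sub>M k\<in>UNIV. borel)"
    and atomless: "\<And>t v. prob {w \<in> space M. c (Z t w) = v} = 0"
    and recursion: "\<And>t. AE w in M. \<phi> (past t w) = A t w * \<phi> (past (t - 1) w) + \<psi> (past t w)"
    and \<phi>_pos: "\<And>t. AE w in M. 0 < \<phi> (past t w)"
    and \<psi>_pos: "\<And>t. AE w in M. 0 < \<psi> (past t w)"
    and \<phi>_moment: "\<And>t r. 0 < r \<Longrightarrow> r < \<alpha> \<Longrightarrow> integrable M (\<lambda>w. \<phi> (past t w) powr r)"
    and \<psi>_moment: "\<And>t. integrable M (\<lambda>w. \<psi> (past t w) powr p)"
    and A_moment: "\<And>t. integrable M (\<lambda>w. A t w powr \<alpha>)" "\<And>t. (\<integral>w. A t w powr \<alpha> \<partial>M) = 1"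
    and A_log_moment: "\<And>t. integrable M (\<lambda>w. A t w powr \<alpha> * max (ln (A t w)) 0)"
begin

lemma A_meas [measurable]: "A t \<in> borel_measurable M"
  unfolding A_def[abs_def] by measurable

lemma A_ge: "b \<le> A t w" and A_pos: "0 < A t w"
proof -
  show "b \<le> A t w" using param_pos by (simp add: A_def)
  then show "0 < A t w" using param_pos by linarith
qed

lemma A_powr_past_integrable:
  assumes [measurable]: "h \<in> borel_measurable PN" and r: "integrable M (\<lambda>w. A t w powr r)"
    and h: "integrable M (\<lambda>w. h (past (t - 1) w))"
  shows "integrable M (\<lambda>w. A t w powr r * h (past (t - 1) w))"
  using integrable_Z_past[of "\<lambda>z. (a * (c z)\<^sup>2 + b) powr r" h "t - 1"] r h by (simp add: A_def)

lemma A_atomless: "prob {w \<in> space M. A t w = v} = 0"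
  unfolding A_def by (rule quadratic_atomless[OF _ atomless param_pos(1)]) simp

lemma \<phi>_tail: "\<exists>\<kappa>>0. ((\<lambda>x. x powr \<alpha> * prob {w \<in> space M. \<phi> (past t w) > x}) \<longlongrightarrow> \<kappa>) at_top"
proof -
  obtain C r where C: "0 \<le> C" and r: "0 < r" "r < \<alpha>"
    and bound: "\<And>x y. 0 \<le> x \<Longrightarrow> 0 \<le> y \<Longrightarrow> (x + y) powr \<alpha> - x powr \<alpha> \<le> C * (1 + y powr p + x powr r)"
    using powr_increment_bound[OF param_pos(3,4)] by blast
  have Ar: "integrable M (\<lambda>w. A t w powr r)"
    by (rule moment_less_1(1)[OF A_meas A_pos A_moment A_atomless r])
  show ?thesis
  proof (rule implicit_renewal[where A = "A t" and R' = "\<lambda>w. \<phi> (past (t - 1) w)" and \<beta> = b and r = r])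
    show "indep_var borel (A t) borel (\<lambda>w. \<phi> (past (t - 1) w))"
      using indep_Z_past[of "\<lambda>z. a * (c z)\<^sup>2 + b" \<phi> "t - 1"] by (simp add: A_def[abs_def])
    show "distr M borel (\<lambda>w. \<phi> (past (t - 1) w)) = distr M borel (\<lambda>w. \<phi> (past t w))"
      by (rule distr_past_compose) simp
    show "AE w in M. A t w * \<phi> (past (t - 1) w) < \<phi> (past t w)"
      using recursion[of t] \<psi>_pos[of t] by eventually_elim simp
    show "integrable M (\<lambda>w. \<phi> (past t w) powr \<alpha> - (A t w * \<phi> (past (t - 1) w)) powr \<alpha>)"
    proof (rule Bochner_Integration.integrable_bound)
      \<comment> \<open>\<open>A t\<close> and the earlier volatility are independent and both have
        moments of the order r < \<alpha>, so their product has one as well.\<close>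
      show "integrable M (\<lambda>w. C * (1 + \<psi> (past t w) powr p + A t w powr r * \<phi> (past (t - 1) w) powr r))"
        by (intro integrable_mult_right Bochner_Integration.integrable_add \<psi>_moment
            A_powr_past_integrable[where h = "\<lambda>z. \<phi> z powr r"] Ar \<phi>_moment r) auto
      show "AE w in M. norm (\<phi> (past t w) powr \<alpha> - (A t w * \<phi> (past (t - 1) w)) powr \<alpha>)
        \<le> norm (C * (1 + \<psi> (past t w) powr p + A t w powr r * \<phi> (past (t - 1) w) powr r))"
        using recursion[of t] \<psi>_pos[of t] \<phi>_pos[of "t - 1"]
      proof eventually_elim
        case (elim w)
        let ?x = "A t w * \<phi> (past (t - 1) w)"
        have x: "0 < ?x" using elim A_pos[of t w] by simp
        have "0 \<le> \<phi> (past t w) powr \<alpha> - ?x powr \<alpha>"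
          using elim x param_pos by (simp add: powr_mono2)
        moreover have "\<phi> (past t w) powr \<alpha> - ?x powr \<alpha> \<le> C * (1 + \<psi> (past t w) powr p + ?x powr r)"
          using bound[of ?x "\<psi> (past t w)"] x elim by simp
        moreover have "?x powr r = A t w powr r * \<phi> (past (t - 1) w) powr r"
          using elim A_pos[of t w] by (simp add: powr_mult)
        ultimately show ?case by simp
      qed
    qed measurable
  qed (use param_pos A_ge A_moment A_log_moment A_atomless r \<phi>_pos \<phi>_moment in auto)
qed

text \<open>The volatility n steps ahead is dn times the current one plus qn.\<close>

primrec dn :: "nat \<Rightarrow> (nat \<Rightarrow> 'b) \<Rightarrow> real" where
  "dn 0 z = 1"
| "dn (Suc n) z = (a * (c (z 0))\<^sup>2 + b) * dn n (\<lambda>k. z (Suc k))"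

primrec qn :: "nat \<Rightarrow> (nat \<Rightarrow> 'b) \<Rightarrow> real" where
  "qn 0 z = 0"
| "qn (Suc n) z = (a * (c (z 0))\<^sup>2 + b) * qn n (\<lambda>k. z (Suc k)) + \<psi> z"

lemma dn_meas [measurable]: "dn n \<in> borel_measurable PN"
proof (induction n)
  case (Suc n)
  have [measurable]: "(\<lambda>z. dn n (\<lambda>k. z (Suc k))) \<in> borel_measurable PN"
    by (rule measurable_compose[OF shift_meas Suc])
  show ?case unfolding dn.simps[abs_def] by measurable
qed simp

lemma qn_meas [measurable]: "qn n \<in> borel_measurable PN"
proof (induction n)
  case (Suc n)
  have [measurable]: "(\<lambda>z. qn n (\<lambda>k. z (Suc k))) \<in> borel_measurable PN"
    by (rule measurable_compose[OF shift_meas Suc])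
  show ?case unfolding qn.simps[abs_def] by measurable
qed simp

lemma dn_past_Suc: "dn (Suc n) (past t w) = A t w * dn n (past (t - 1) w)"
  unfolding dn.simps past_shift by (simp add: A_def past_def)

lemma qn_past_Suc: "qn (Suc n) (past t w) = A t w * qn n (past (t - 1) w) + \<psi> (past t w)"
  unfolding qn.simps past_shift by (simp add: A_def past_def)

lemma dn_pos: "0 < dn n (past t w)"
  by (induction n arbitrary: t) (auto simp: dn_past_Suc A_pos simp del: dn.simps(2))

lemma dn_eq_prod: "dn n (past (int n) w) = (\<Prod>k = 1..n. A (int k) w)"
proof (induction n)
  case (Suc n)
  then show ?case by (simp add: dn_past_Suc mult.commute del: dn.simps(2))
qed simp

lemma dn_moment: "integrable M (\<lambda>w. dn n (past t w) powr \<alpha>)"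
proof (induction n arbitrary: t)
  case (Suc n)
  have "integrable M (\<lambda>w. A t w powr \<alpha> * dn n (past (t - 1) w) powr \<alpha>)"
    by (rule A_powr_past_integrable[where h = "\<lambda>z. dn n z powr \<alpha>"]) (auto intro: A_moment Suc)
  then show ?case using A_pos dn_pos less_imp_le by (simp add: dn_past_Suc powr_mult del: dn.simps(2))
qed simp

lemma qn_nonneg: "AE w in M. 0 \<le> qn n (past t w)"
proof (induction n arbitrary: t)
  case (Suc n)
  show ?case using Suc[of "t - 1"] \<psi>_pos[of t]
    by eventually_elim (simp add: qn_past_Suc A_pos less_imp_le del: qn.simps(2))
qed simp

lemma qn_moment: "integrable M (\<lambda>w. qn n (past t w) powr \<alpha>)"
proof (induction n arbitrary: t)
  case (Suc n)
  have i1: "integrable M (\<lambda>w. A t w powr \<alpha> * qn n (past (t - 1) w) powr \<alpha>)"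
    by (rule A_powr_past_integrable[where h = "\<lambda>z. qn n z powr \<alpha>"]) (auto intro: A_moment Suc)
  show ?case
  proof (rule Bochner_Integration.integrable_bound)
    show "integrable M (\<lambda>w. 2 powr \<alpha> * (A t w powr \<alpha> * qn n (past (t - 1) w) powr \<alpha> + (1 + \<psi> (past t w) powr p)))"
      by (intro integrable_mult_right Bochner_Integration.integrable_add i1 \<psi>_moment) simp
    show "AE w in M. norm (qn (Suc n) (past t w) powr \<alpha>)
      \<le> norm (2 powr \<alpha> * (A t w powr \<alpha> * qn n (past (t - 1) w) powr \<alpha> + (1 + \<psi> (past t w) powr p)))"
      using qn_nonneg[of n "t - 1"] \<psi>_pos[of t]
    proof eventually_elim
      case (elim w)
      let ?y = "\<psi> (past t w)"
      have "?y powr \<alpha> \<le> 1 + ?y powr p"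
      proof (cases "?y \<le> 1")
        case True
        then have "?y powr \<alpha> \<le> 1 powr \<alpha>" using elim param_pos by (intro powr_mono2) auto
        then show ?thesis by (simp add: add_increasing2)
      next
        case False
        then have "?y powr \<alpha> \<le> ?y powr p" using param_pos by (intro powr_mono) auto
        then show ?thesis by simp
      qed
      then have "qn (Suc n) (past t w) powr \<alpha> \<le> 2 powr \<alpha> * ((A t w * qn n (past (t - 1) w)) powr \<alpha> + (1 + ?y powr p))"
        unfolding qn_past_Suc using elim A_pos[of t w] param_pos
        by (intro order_trans[OF powr_add_le_2]) (auto simp: less_imp_le)
      then show ?case using elim A_pos[of t w] by (simp add: powr_mult)
    qed
  qed (simp del: qn.simps(2))
qed simp

lemma \<phi>_expansion:
  "AE w in M. \<phi> (past (t + int n) w) = dn n (past (t + int n) w) * \<phi> (past t w) + qn n (past (t + int n) w)"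
proof (induction n)
  case (Suc n)
  show ?case using Suc recursion[of "t + int (Suc n)"]
    by eventually_elim (simp add: dn_past_Suc qn_past_Suc algebra_simps del: dn.simps(2) qn.simps(2))
qed simp

text \<open>a (c (Z t))^2 is at most A (t + 1), since Z t drives the coefficient one time step
  later.\<close>

lemma cZ_moment: "integrable M (\<lambda>w. \<bar>c (Z t w)\<bar> powr (2 * \<alpha>))"
proof (rule Bochner_Integration.integrable_bound)
  show "integrable M (\<lambda>w. (1 / a) powr \<alpha> * A (t + 1) w powr \<alpha>)"
    by (intro integrable_mult_right A_moment)
  show "AE w in M. norm (\<bar>c (Z t w)\<bar> powr (2 * \<alpha>)) \<le> norm ((1 / a) powr \<alpha> * A (t + 1) w powr \<alpha>)"
  proof (intro AE_I2)
    fix w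
    have "\<bar>c (Z t w)\<bar> powr (2 * \<alpha>) = ((c (Z t w))\<^sup>2) powr \<alpha>"
      using sqrt_powr_double[of "(c (Z t w))\<^sup>2" \<alpha>] by simp
    also have "\<dots> \<le> (1 / a * A (t + 1) w) powr \<alpha>"
      using param_pos by (intro powr_mono2) (auto simp: A_def field_simps)
    also have "\<dots> = (1 / a) powr \<alpha> * A (t + 1) w powr \<alpha>"
      by (rule powr_mult)
    finally show "norm (\<bar>c (Z t w)\<bar> powr (2 * \<alpha>)) \<le> norm ((1 / a) powr \<alpha> * A (t + 1) w powr \<alpha>)"
      by simp
  qed
qed simp

theorem mrv_component:
  fixes idx :: "'h::finite \<Rightarrow> nat"
  assumes idx: "inj idx"
    and X: "\<And>w. X w = (\<chi> j. sqrt (\<phi> (past (int (idx j)) w)) * c (Z (int (idx j)) w))"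
    and Y: "\<And>w. Y w = (\<chi> j. \<bar>c (Z (int (idx j)) w)\<bar> * sqrt (\<Prod>k = 1..idx j. A (int k) w))"
  shows "mrv_with_spectral_measure M X (2 * \<alpha>) (random_sign_law (weighted_direction_law M Y (2 * \<alpha>)))"
proof -
  \<comment> \<open>The signed version of Y as a function of Z 0, Z 1, ...: the factor A k is driven
    by Z (k - 1), hence the shifted index.\<close>
  define v where "v z = (\<chi> j. c (z (idx j)) * sqrt (\<Prod>k = 1..idx j. a * (c (z (k - 1)))\<^sup>2 + b))"
    for z :: "nat \<Rightarrow> 'b"
  define V where "V w = v (future 0 w)" for w
  have V: "V w $ j = c (Z (int (idx j)) w) * sqrt (dn (idx j) (past (int (idx j)) w))" for w j
  proof -
    have "(\<Prod>k = 1..idx j. a * (c (Z (int (k - 1)) w))\<^sup>2 + b) = (\<Prod>k = 1..idx j. A (int k) w)"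
      by (rule prod.cong) (auto simp: A_def of_nat_diff)
    then show ?thesis by (simp add: V_def v_def future_def dn_eq_prod)
  qed
  have mv [measurable]: "v \<in> borel_measurable PN" unfolding v_def[abs_def] by measurable
  have mV [measurable]: "V \<in> borel_measurable M" unfolding V_def[abs_def] by measurable
  have mX [measurable]: "X \<in> borel_measurable M" unfolding X[abs_def] by measurable
  have mY [measurable]: "Y \<in> borel_measurable M" unfolding Y[abs_def] by measurable
  have YV: "Y w $ j = \<bar>V w $ j\<bar>" for w j
    by (simp add: Y V abs_mult dn_eq_prod real_sqrt_ge_0_iff prod_nonneg A_pos less_imp_le)
  obtain \<kappa> where \<kappa>: "0 < \<kappa>" "((\<lambda>x. x powr \<alpha> * prob {w \<in> space M. \<phi> (past 0 w) > x}) \<longlongrightarrow> \<kappa>) at_top"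
    using \<phi>_tail[of 0] by blast
  \<comment> \<open>Taking the square root doubles the tail index.\<close>
  have tail: "((\<lambda>x. x powr (2 * \<alpha>) * prob {w \<in> space M. sqrt (\<phi> (past 0 w)) > x}) \<longlongrightarrow> \<kappa>) at_top"
  proof (rule Lim_transform_eventually[OF filterlim_compose[OF \<kappa>(2) filterlim_pow_at_top[of 2, OF _ filterlim_ident]]])
    show "\<forall>\<^sub>F x in at_top. (x ^ 2) powr \<alpha> * prob {w \<in> space M. \<phi> (past 0 w) > x ^ 2}
      = x powr (2 * \<alpha>) * prob {w \<in> space M. sqrt (\<phi> (past 0 w)) > x}"
      using eventually_gt_at_top[of 0]
    proof eventually_elim
      case (elim x)
      have "x < sqrt y \<longleftrightarrow> x ^ 2 < y" for y
        using elim by (metis less_le_not_le real_less_rsqrt real_sqrt_le_iff real_sqrt_less_iff real_sqrt_abs abs_of_pos)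
      moreover have "(x ^ 2) powr \<alpha> = x powr (2 * \<alpha>)"
        using sqrt_powr_double[of "x\<^sup>2" \<alpha>] elim by simp
      ultimately show ?case by simp
    qed
  qed simp
  have V_mom: "integrable M (\<lambda>w. norm (V w) powr (2 * \<alpha>))"
  proof (rule integrable_norm_vec_powr)
    fix j
    have "integrable M (\<lambda>w. \<bar>c (Z (int (idx j)) w)\<bar> powr (2 * \<alpha>) * dn (idx j) (past (int (idx j)) w) powr \<alpha>)"
      using integrable_Z_past[of "\<lambda>z. \<bar>c z\<bar> powr (2 * \<alpha>)" "\<lambda>z. dn (idx j) z powr \<alpha>"] cZ_moment dn_moment by simp
    then show "integrable M (\<lambda>w. \<bar>V w $ j\<bar> powr (2 * \<alpha>))"
      by (simp add: V abs_mult powr_mult sqrt_powr_double dn_pos less_imp_le)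
  qed (use param_pos in auto)
  have Vpos: "0 < (\<integral>w. norm (V w) powr (2 * \<alpha>) \<partial>M)"
  proof -
    fix j :: 'h
    have "AE w in M. c (Z (int (idx j)) w) \<noteq> 0"
      by (rule AE_neq_of_prob_0[OF _ atomless]) simp
    then have "AE w in M. 0 < norm (V w) powr (2 * \<alpha>)"
    proof eventually_elim
      case (elim w)
      then have "V w $ j \<noteq> 0" using dn_pos[of "idx j" "int (idx j)" w] by (simp add: V)
      then have "V w \<noteq> 0" by auto
      then show ?case by simp
    qed
    then have "(\<integral>w. 0 \<partial>M) < (\<integral>w. norm (V w) powr (2 * \<alpha>) \<partial>M)"
      by (intro integral_less_AE_space V_mom) (auto simp: emeasure_space_1)
    then show ?thesis by simp
  qed
  \<comment> \<open>Subadditivity of the square root bounds sqrt (d f + q) - sqrt (d f) by sqrt q.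
    Component j of the error is therefore at most |c (Z t)| sqrt q with t = idx j, a product of
    independent factors with finite moments of order 2 \<alpha>.\<close>
  have E: "integrable M (\<lambda>w. norm (X w - sqrt (\<phi> (past 0 w)) *\<^sub>R V w) powr (2 * \<alpha>))"
  proof (rule integrable_norm_vec_powr)
    fix j
    let ?n = "idx j" and ?t = "int (idx j)"
    have i: "integrable M (\<lambda>w. \<bar>c (Z ?t w)\<bar> powr (2 * \<alpha>) * qn ?n (past ?t w) powr \<alpha>)"
      using integrable_Z_past[of "\<lambda>z. \<bar>c z\<bar> powr (2 * \<alpha>)" "\<lambda>z. qn ?n z powr \<alpha>"] cZ_moment qn_moment by simp
    show "integrable M (\<lambda>w. \<bar>(X w - sqrt (\<phi> (past 0 w)) *\<^sub>R V w) $ j\<bar> powr (2 * \<alpha>))"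
    proof (rule Bochner_Integration.integrable_bound[OF i])
      show "AE w in M. norm (\<bar>(X w - sqrt (\<phi> (past 0 w)) *\<^sub>R V w) $ j\<bar> powr (2 * \<alpha>))
        \<le> norm (\<bar>c (Z ?t w)\<bar> powr (2 * \<alpha>) * qn ?n (past ?t w) powr \<alpha>)"
        using \<phi>_expansion[of 0 ?n] qn_nonneg[of ?n ?t] \<phi>_pos[of 0]
      proof eventually_elim
        case (elim w)
        define d q f where "d = dn ?n (past ?t w)" and "q = qn ?n (past ?t w)" and "f = \<phi> (past 0 w)"
        have nn: "0 < d" "0 \<le> q" "0 < f" using elim dn_pos by (auto simp: d_def q_def f_def)
        have ph: "\<phi> (past ?t w) = d * f + q" using elim by (simp add: d_def q_def f_def)
        have "sqrt (d * f) \<le> sqrt (d * f + q)" "sqrt (d * f + q) \<le> sqrt (d * f) + sqrt q"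
          using nn by (auto intro!: sqrt_add_le_add_sqrt)
        then have "\<bar>sqrt (d * f + q) - sqrt f * sqrt d\<bar> \<le> sqrt q"
          by (simp add: real_sqrt_mult mult.commute)
        then have "\<bar>c (Z ?t w)\<bar> * \<bar>sqrt (d * f + q) - sqrt f * sqrt d\<bar> \<le> \<bar>c (Z ?t w)\<bar> * sqrt q"
          by (rule mult_left_mono) simp
        moreover have "(X w - sqrt f *\<^sub>R V w) $ j = c (Z ?t w) * (sqrt (d * f + q) - sqrt f * sqrt d)"
          by (simp add: X V ph d_def[symmetric] algebra_simps)
        ultimately have "\<bar>(X w - sqrt f *\<^sub>R V w) $ j\<bar> powr (2 * \<alpha>) \<le> (\<bar>c (Z ?t w)\<bar> * sqrt q) powr (2 * \<alpha>)"
          using param_pos by (intro powr_mono2) (auto simp: abs_mult)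
        also have "\<dots> = \<bar>c (Z ?t w)\<bar> powr (2 * \<alpha>) * q powr \<alpha>"
          using nn by (simp add: powr_mult sqrt_powr_double)
        finally show ?case by (simp add: f_def q_def)
      qed
    qed measurable
  qed (use param_pos in auto)
  have flip: "distr M borel (\<lambda>w. \<chi> j. r j * V w $ j) = distr M borel V"
    if r: "\<And>j. r j = 1 \<or> r j = -1" for r :: "'h \<Rightarrow> real"
  proof -
    \<comment> \<open>Moves the pattern from vector components to time indices; times that no
      component uses keep the sign 1.\<close>
    define r' where "r' k = (if k \<in> range idx then r (inv idx k) else 1)" for k
    have r': "r' k = 1 \<or> r' k = -1" for k using r by (simp add: r'_def)
    have r'i: "r' (idx j) = r j" for j by (simp add: r'_def idx)
    have cr: "c (r' k *\<^sub>R z) = r' k * c z" for k z using r'[of k] c_minus[of z] by auto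
    have cr2: "(c (r' k *\<^sub>R z))\<^sup>2 = (c z)\<^sup>2" for k z using r'[of k] by (auto simp: cr)
    \<comment> \<open>Under the products the innovations enter squared, so only the leading factor
      feels the sign.\<close>
    have vr: "v (\<lambda>k. r' k *\<^sub>R z k) = (\<chi> j. r j * v z $ j)" for z
      by (simp only: v_def cr2, simp only: cr, simp only: r'i mult.assoc vec_lambda_beta)
    have [measurable]: "(\<lambda>w k. r' k *\<^sub>R Z (int k) w) \<in> measurable M PN"
      by (intro measurable_PiM_single') auto
    have "distr M borel (\<lambda>w. \<chi> j. r j * V w $ j)
      = distr (distr M PN (\<lambda>w k. r' k *\<^sub>R Z (0 + int k) w)) borel v"
      by (subst distr_distr) (auto simp: comp_def vr V_def future_def[abs_def])
    also have "distr M PN (\<lambda>w k. r' k *\<^sub>R Z (0 + int k) w) = distr M PN (\<lambda>w k. Z (0 + int k) w)"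
      by (rule distr_iid_signs[OF Z_indep Z_ident[of _ 0] Z_sym r'])
    also have "distr (distr M PN (\<lambda>w k. Z (0 + int k) w)) borel v = distr M borel V"
      using future_meas[of 0] by (subst distr_distr) (auto simp: comp_def V_def[abs_def] future_def[abs_def])
    finally show ?thesis .
  qed
  have two: "0 < 2 * \<alpha>" using param_pos by simp
  have flip': "distr M borel (\<lambda>w. \<chi> j. r j * V w $ j) = distr M borel V"
    if "\<And>j. r j = 1 \<or> r j = -1" for r :: "'h \<Rightarrow> real" by (rule flip) (rule that)
  show ?thesis
  proof (rule mrvI[where y = "\<lambda>z. sqrt (\<phi> z)" and v = v and c = \<kappa> and F = "future 0" and P = "past 0"])
    show "AE w in M. 0 \<le> sqrt (\<phi> (past 0 w))"
      using \<phi>_pos[of 0] by eventually_elim simp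
    show "integrable M (\<lambda>w. norm (v (future 0 w)) powr (2 * \<alpha>))"
      "integrable M (\<lambda>w. norm (X w - sqrt (\<phi> (past 0 w)) *\<^sub>R v (future 0 w)) powr (2 * \<alpha>))"
      "0 < (\<integral>w. norm (v (future 0 w)) powr (2 * \<alpha>) \<partial>M)"
      using V_mom E Vpos by (simp_all only: V_def)
    fix f :: "real ^ 'h \<Rightarrow> real" assume "continuous_on (sphere 0 1) f"
    from random_sign_law(4)[OF mV mY YV two V_mom Vpos flip' this]
    show "(\<integral>z. indicator (sphere 0 1) z * f z \<partial>random_sign_law (weighted_direction_law M Y (2 * \<alpha>)))
      = (\<integral>w. indicator (sphere 0 1) (v (future 0 w) /\<^sub>R norm (v (future 0 w)))
        * f (v (future 0 w) /\<^sub>R norm (v (future 0 w))) * norm (v (future 0 w)) powr (2 * \<alpha>) \<partial>M)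
        / (\<integral>w. norm (v (future 0 w)) powr (2 * \<alpha>) \<partial>M)"
      unfolding V_def .
  qed (rule indep_fp mv tail \<kappa>(1) two mX random_sign_law(1-3)[OF mV mY YV two V_mom Vpos flip'] | simp)+
qed

end

text \<open>The constant in front of x^s can be taken as close to 1 as desired, at the price of a
  large one in front of y^s. The factor 2^s of \<open>powr_add_le_2\<close> could destroy the
  contraction E A^s < 1.\<close>

lemma powr_add_split:
  assumes "0 \<le> x" "0 \<le> y" "0 \<le> s" "0 < (\<epsilon>::real)"
  shows "(x + y) powr s \<le> (1 + \<epsilon>) powr s * x powr s + (1 + 1 / \<epsilon>) powr s * y powr s"
proof (cases "y \<le> \<epsilon> * x")
  case True
  then have "(x + y) powr s \<le> ((1 + \<epsilon>) * x) powr s"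
    using assms by (intro powr_mono2) (auto simp: algebra_simps)
  then show ?thesis by (simp add: powr_mult add_increasing2)
next
  case False
  then have "x \<le> y / \<epsilon>" using assms by (simp add: field_simps)
  then have "(x + y) powr s \<le> ((1 + 1 / \<epsilon>) * y) powr s"
    using assms by (intro powr_mono2) (auto simp: algebra_simps)
  then show ?thesis by (simp add: powr_mult add_increasing)
qed

section \<open>Moments and almost sure convergence of the volatility series\<close>

context prob_space
begin

text \<open>By independence the s-th moment of F at level n + 1 is at most p q times the bound at
  level n plus a constant, where p is close enough to 1 that p q < 1. The argument covers s on
  either side of 1.\<close>

lemma recursion_moment_bound:
  fixes A :: "int \<Rightarrow> 'a \<Rightarrow> real" and F G :: "nat \<Rightarrow> int \<Rightarrow> 'a \<Rightarrow> real"
  assumes s: "0 < s" and F0: "\<And>t w. F 0 t w = 0"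
    and rec: "\<And>n t w. F (Suc n) t w = A t w * F n (t - 1) w + G n t w"
    and pos: "\<And>t w. 0 \<le> A t w" "\<And>n t w. 0 \<le> F n t w" "\<And>n t w. 0 \<le> G n t w"
    and ind: "\<And>n t. indep_var borel (\<lambda>w. A t w powr s) borel (\<lambda>w. F n (t - 1) w powr s)"
    and A: "\<And>t. integrable M (\<lambda>w. A t w powr s)" "\<And>t. (\<integral>w. A t w powr s \<partial>M) \<le> q" "q < 1"
    and G: "\<And>n t. integrable M (\<lambda>w. G n t w powr s)" "\<And>n t. (\<integral>w. G n t w powr s \<partial>M) \<le> K"
    and F [measurable]: "\<And>n t. F n t \<in> borel_measurable M"
  shows "\<exists>K'. \<forall>n t. integrable M (\<lambda>w. F n t w powr s) \<and> (\<integral>w. F n t w powr s \<partial>M) \<le> K'"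
proof -
  have q0: "0 \<le> q" using order_trans[OF _ A(2)[of 0]] by simp
  have K0: "0 \<le> K" using order_trans[OF _ G(2)[of 0 0]] by simp
  have "((\<lambda>\<epsilon>. (1 + \<epsilon>) powr s * q) \<longlongrightarrow> (1 + 0) powr s * q) (at_right 0)"
    by (intro tendsto_intros) auto
  then have "\<forall>\<^sub>F \<epsilon> in at_right 0. (1 + \<epsilon>) powr s * q < 1"
    by (rule order_tendstoD) (use A(3) in simp)
  moreover have "\<forall>\<^sub>F \<epsilon> in at_right 0. (0::real) < \<epsilon>" by (simp add: eventually_at_right_less)
  ultimately obtain \<epsilon> where \<epsilon>: "0 < \<epsilon>" "(1 + \<epsilon>) powr s * q < 1"
    using eventually_happens'[OF trivial_limit_at_right_real eventually_conj] by blast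
  define p where "p = (1 + \<epsilon>) powr s"
  define C where "C = (1 + 1 / \<epsilon>) powr s"
  have pC: "0 \<le> p" "0 \<le> C" "p * q < 1" using \<epsilon> by (auto simp: p_def C_def)
  \<comment> \<open>The fixed point of the affine map x \<mapsto> p q x + C K, so the induction step
    reproduces it.\<close>
  define K' where "K' = C * K / (1 - p * q)"
  have K': "0 \<le> K'" "p * (q * K') + C * K = K'"
  proof -
    show "0 \<le> K'" using pC K0 by (simp add: K'_def)
    have "(1 - p * q) * K' = C * K" using pC by (simp add: K'_def)
    then show "p * (q * K') + C * K = K'" by (simp add: algebra_simps)
  qed
  have "integrable M (\<lambda>w. F n t w powr s) \<and> (\<integral>w. F n t w powr s \<partial>M) \<le> K'" for n t
  proof (induction n arbitrary: t)
    case 0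
    then show ?case using K' s by (simp add: F0)
  next
    case (Suc n)
    have IH: "integrable M (\<lambda>w. F n (t - 1) w powr s)" "(\<integral>w. F n (t - 1) w powr s \<partial>M) \<le> K'"
      using Suc by auto
    have i: "integrable M (\<lambda>w. A t w powr s * F n (t - 1) w powr s)"
      by (rule indep_var_integrable[OF ind A(1) IH(1)])
    have "(\<integral>w. A t w powr s * F n (t - 1) w powr s \<partial>M)
      = (\<integral>w. A t w powr s \<partial>M) * (\<integral>w. F n (t - 1) w powr s \<partial>M)"
      by (rule indep_var_lebesgue_integral[OF ind A(1) IH(1)])
    also have "\<dots> \<le> q * K'" by (intro mult_mono A IH q0) simp
    finally have le: "(\<integral>w. A t w powr s * F n (t - 1) w powr s \<partial>M) \<le> q * K'" .
    let ?R = "\<lambda>w. p * (A t w powr s * F n (t - 1) w powr s) + C * G n t w powr s"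
    have iR: "integrable M ?R"
      by (intro Bochner_Integration.integrable_add integrable_mult_right i G)
    have ptw: "F (Suc n) t w powr s \<le> ?R w" for w
      unfolding rec p_def C_def using powr_add_split[of "A t w * F n (t - 1) w" "G n t w" s \<epsilon>] pos s \<epsilon>
      by (simp add: powr_mult)
    have i': "integrable M (\<lambda>w. F (Suc n) t w powr s)"
      by (rule Bochner_Integration.integrable_bound[OF iR])
         (use ptw in \<open>auto intro: order_trans[OF _ abs_ge_self]\<close>)
    have "(\<integral>w. F (Suc n) t w powr s \<partial>M) \<le> (\<integral>w. ?R w \<partial>M)"
      by (rule integral_mono[OF i' iR ptw])
    also have "\<dots> = p * (\<integral>w. A t w powr s * F n (t - 1) w powr s \<partial>M) + C * (\<integral>w. G n t w powr s \<partial>M)"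
      using i G(1)[of n t] by simp
    also have "\<dots> \<le> p * (q * K') + C * K"
      by (intro add_mono mult_left_mono le G pC)
    finally show ?case using i' K' by simp
  qed
  then show ?thesis by blast
qed

text \<open>Monotone convergence for the powers of the partial sums gives their supremum a finite
  mean. Its finiteness almost everywhere bounds the partial sums of nonnegative terms, so the series
  converges as well.\<close>

lemma series_moment:
  fixes u :: "nat \<Rightarrow> 'a \<Rightarrow> real"
  assumes [measurable]: "\<And>n. u n \<in> borel_measurable M" and nn: "\<And>n w. 0 \<le> u n w" and s: "0 < s"
    and int: "\<And>N. integrable M (\<lambda>w. (\<Sum>n<N. u n w) powr s)"
    and le: "\<And>N. (\<integral>w. (\<Sum>n<N. u n w) powr s \<partial>M) \<le> K"
  shows "AE w in M. summable (\<lambda>n. u n w)" "integrable M (\<lambda>w. (\<Sum>n. u n w) powr s)"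
proof -
  define S where "S N w = ennreal ((\<Sum>n<N. u n w) powr s)" for N w
  have [measurable]: "S N \<in> borel_measurable M" for N unfolding S_def[abs_def] by measurable
  have inc: "incseq S"
  proof (intro incseq_SucI le_funI)
    fix N w
    have "(\<Sum>n<N. u n w) powr s \<le> (\<Sum>n<Suc N. u n w) powr s"
      using s nn by (intro powr_mono2 sum_nonneg) auto
    then show "S N w \<le> S (Suc N) w" by (simp add: S_def ennreal_leI del: sum.lessThan_Suc)
  qed
  have "(\<integral>\<^sup>+w. (SUP N. S N w) \<partial>M) = (SUP N. \<integral>\<^sup>+w. S N w \<partial>M)"
    by (rule nn_integral_monotone_convergence_SUP[OF inc]) simp
  also have "\<dots> \<le> ennreal K"
  proof (rule SUP_least)
    fix N
    have "(\<integral>\<^sup>+w. S N w \<partial>M) = ennreal (\<integral>w. (\<Sum>n<N. u n w) powr s \<partial>M)"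
      unfolding S_def by (rule nn_integral_eq_integral[OF int]) simp
    then show "(\<integral>\<^sup>+w. S N w \<partial>M) \<le> ennreal K" using le by (simp add: ennreal_leI)
  qed
  finally have fin: "(\<integral>\<^sup>+w. (SUP N. S N w) \<partial>M) \<le> ennreal K" .
  then have "AE w in M. (SUP N. S N w) \<noteq> \<infinity>"
    by (intro nn_integral_PInf_AE) (auto simp: top_unique)
  then show summ: "AE w in M. summable (\<lambda>n. u n w)"
  proof eventually_elim
    case (elim w)
    then obtain r where r: "(SUP N. S N w) = ennreal r" "0 \<le> r" by (cases "SUP N. S N w") auto
    have "(\<Sum>n<N. u n w) \<le> r powr (1 / s)" for N
    proof -
      have "S N w \<le> ennreal r" unfolding r(1)[symmetric] by (rule SUP_upper) simp
      then have "(\<Sum>n<N. u n w) powr s \<le> r" using r by (simp add: S_def)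
      then have "((\<Sum>n<N. u n w) powr s) powr (1 / s) \<le> r powr (1 / s)"
        using s by (intro powr_mono2) auto
      then show ?thesis using s nn by (simp add: powr_powr sum_nonneg)
    qed
    then show ?case using nn by (intro summableI_nonneg_bounded) auto
  qed
  show "integrable M (\<lambda>w. (\<Sum>n. u n w) powr s)"
  proof (rule integrableI_bounded)
    have "AE w in M. ennreal (norm ((\<Sum>n. u n w) powr s)) \<le> (SUP N. S N w)"
      using summ
    proof eventually_elim
      case (elim w)
      have "(\<lambda>N. \<Sum>n<N. u n w) \<longlonglongrightarrow> (\<Sum>n. u n w)" using summable_LIMSEQ[OF elim] .
      then have "(\<lambda>N. (\<Sum>n<N. u n w) powr s) \<longlonglongrightarrow> (\<Sum>n. u n w) powr s"
        using s by (intro tendsto_powr2) (auto intro!: always_eventually sum_nonneg nn)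
      then have "(\<lambda>N. S N w) \<longlonglongrightarrow> ennreal ((\<Sum>n. u n w) powr s)"
        unfolding S_def by (rule tendsto_ennrealI)
      then have "ennreal ((\<Sum>n. u n w) powr s) \<le> (SUP N. S N w)"
        by (rule LIMSEQ_le_const2) (intro exI[of _ 0] allI impI SUP_upper UNIV_I)
      then show ?case by simp
    qed
    then have "(\<integral>\<^sup>+w. ennreal (norm ((\<Sum>n. u n w) powr s)) \<partial>M) \<le> (\<integral>\<^sup>+w. (SUP N. S N w) \<partial>M)"
      by (rule nn_integral_mono_AE)
    then show "(\<integral>\<^sup>+w. ennreal (norm ((\<Sum>n. u n w) powr s)) \<partial>M) < \<infinity>"
      using fin by (simp add: order_le_less_trans[OF order_trans])
  qed measurable
qed

text \<open>A coordinate hyperplane is Lebesgue null, and a law with a density does not charge null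
  sets.\<close>

lemma density_component_atomless:
  fixes Z :: "'a \<Rightarrow> real ^ 'n"
  assumes "distributed M lborel Z f"
  shows "prob {w \<in> space M. Z w $ i = v} = 0"
proof -
  have D: "distr M lborel Z = density lborel f" and [measurable]: "Z \<in> borel_measurable M" and mf: "f \<in> borel_measurable lborel"
    using assms by (auto simp: distributed_def)
  let ?N = "{x :: real ^ 'n. x $ i = v}"
  have cl: "closed ?N"
    by (intro closed_Collect_eq continuous_intros)
  have "?N \<in> null_sets lebesgue"
    using negligible_standard_hyperplane[of "axis i (1::real)" v] by (simp add: negligible_iff_null_sets inner_axis)
  then have "?N \<in> null_sets lborel"
    using cl by (subst (asm) null_sets_completion_iff) auto
  then have "?N \<in> null_sets (density lborel f)"
    using absolutely_continuousI_density[OF mf] unfolding absolutely_continuous_def by blast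
  then have "emeasure (distr M lborel Z) ?N = 0" by (simp add: D null_sets_def)
  then have "emeasure M (Z -` ?N \<inter> space M) = 0" using cl by (subst (asm) emeasure_distr) auto
  moreover have "Z -` ?N \<inter> space M = {w \<in> space M. Z w $ i = v}" by auto
  ultimately show ?thesis by (simp add: emeasure_eq_measure)
qed

end

section \<open>The bivariate model and its two components\<close>

locale bivariate_garch = iid_innovations M Z
  for M :: "'a measure" and Z :: "int \<Rightarrow> 'a \<Rightarrow> real ^ 2" +
  fixes \<alpha>01 \<alpha>02 \<alpha>11 \<alpha>12 \<alpha>22 \<beta>11 \<beta>12 \<beta>22 \<alpha>1 \<alpha>2 :: real
  assumes Z_sym: "\<And>t. distr M borel (\<lambda>w. - Z t w) = distr M borel (Z t)"
    and Z_density: "\<And>t. \<exists>f. distributed M lborel (Z t) f"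
    and pos: "0 < \<alpha>01" "0 < \<alpha>02" "0 < \<alpha>11" "0 < \<alpha>12" "0 < \<alpha>22" "0 < \<beta>11" "0 < \<beta>12" "0 < \<beta>22"
    and index: "0 < \<alpha>1" "\<alpha>1 < \<alpha>2"
    and A1_moment: "\<And>t. integrable M (\<lambda>w. (\<alpha>11 * (Z t w $ 1)\<^sup>2 + \<beta>11) powr \<alpha>1)"
      "\<And>t. (\<integral>w. (\<alpha>11 * (Z t w $ 1)\<^sup>2 + \<beta>11) powr \<alpha>1 \<partial>M) = 1"
      "\<And>t. integrable M (\<lambda>w. (\<alpha>11 * (Z t w $ 1)\<^sup>2 + \<beta>11) powr \<alpha>1 * max (ln (\<alpha>11 * (Z t w $ 1)\<^sup>2 + \<beta>11)) 0)"
    and A4_moment: "\<And>t. integrable M (\<lambda>w. (\<alpha>22 * (Z t w $ 2)\<^sup>2 + \<beta>22) powr \<alpha>2)"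
      "\<And>t. (\<integral>w. (\<alpha>22 * (Z t w $ 2)\<^sup>2 + \<beta>22) powr \<alpha>2 \<partial>M) = 1"
      "\<And>t. integrable M (\<lambda>w. (\<alpha>22 * (Z t w $ 2)\<^sup>2 + \<beta>22) powr \<alpha>2 * max (ln (\<alpha>22 * (Z t w $ 2)\<^sup>2 + \<beta>22)) 0)"
begin

abbreviation "a1 x \<equiv> \<alpha>11 * ((x :: real ^ 2) $ 1)\<^sup>2 + \<beta>11"
abbreviation "a2 x \<equiv> \<alpha>12 * ((x :: real ^ 2) $ 2)\<^sup>2 + \<beta>12"
abbreviation "a4 x \<equiv> \<alpha>22 * ((x :: real ^ 2) $ 2)\<^sup>2 + \<beta>22"

abbreviation "intercept \<equiv> vector [\<alpha>01, \<alpha>02] :: real ^ 2"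

definition coeff :: "real ^ 2 \<Rightarrow> real ^ 2 ^ 2" where
  "coeff x = vector [vector [a1 x, a2 x], vector [0, a4 x]]"

text \<open>The terms of the causal series as functions of the sequence of past innovations. In this
  form they are measurable on sequence space and inherit independence and stationarity from the
  innovations.\<close>

primrec summand :: "nat \<Rightarrow> (nat \<Rightarrow> real ^ 2) \<Rightarrow> real ^ 2" where
  "summand 0 z = intercept"
| "summand (Suc n) z = coeff (z 0) *v summand n (\<lambda>k. z (Suc k))"

definition vol :: "(nat \<Rightarrow> real ^ 2) \<Rightarrow> real ^ 2" where "vol z = (\<Sum>n. summand n z)"

lemma coeff_mult: "(coeff x *v y) $ 1 = a1 x * y $ 1 + a2 x * y $ 2" "(coeff x *v y) $ 2 = a4 x * y $ 2"
  by (simp_all add: coeff_def matrix_vector_mult_def sum_2)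

lemma a_pos: "0 < a1 x" "0 < a2 x" "0 < a4 x"
  using pos by (auto intro: add_nonneg_pos)

lemma summand_nonneg: "0 \<le> summand n z $ 1" "0 \<le> summand n z $ 2"
proof -
  have "0 \<le> summand n z $ 1 \<and> 0 \<le> summand n z $ 2"
    using pos a_pos by (induction n arbitrary: z) (auto simp: coeff_mult less_imp_le)
  then show "0 \<le> summand n z $ 1" "0 \<le> summand n z $ 2" by auto
qed

lemma summand_past: "summand n (past t w) = backward_prod (\<lambda>s. coeff (Z (s - 1) w)) t n *v intercept"
proof (induction n arbitrary: t)
  case (Suc n)
  then show ?case by (simp add: past_shift matrix_vector_mul_assoc[symmetric]) (simp add: past_def)
qed simp

lemma vol_past: "vol (past t w) = causal_solution (\<lambda>s. coeff (Z (s - 1) w)) intercept t"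
  by (simp add: vol_def causal_solution_def summand_past)

lemma vec2_measurable:
  fixes f :: "'c \<Rightarrow> real ^ 2"
  assumes "(\<lambda>x. f x $ 1) \<in> borel_measurable N" "(\<lambda>x. f x $ 2) \<in> borel_measurable N"
  shows "f \<in> borel_measurable N"
proof -
  have "(\<lambda>x. f x $ i) \<in> borel_measurable N" for i
    using exhaust_2[of i] by (elim disjE) (simp_all only: assms)
  from borel_measurable_vec[of "\<lambda>i x. f x $ i", OF this] show ?thesis by (simp only: vec_nth_inverse)
qed

lemma coeff_mult_meas:
  assumes "x \<in> borel_measurable N" "y \<in> borel_measurable N"
  shows "(\<lambda>z. coeff (x z) *v y z) \<in> borel_measurable N"
  by (rule vec2_measurable; unfold coeff_mult)
    (intro borel_measurable_add borel_measurable_times borel_measurable_power borel_measurable_const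
      borel_measurable_nth assms)+

lemma summand_meas [measurable]: "summand n \<in> borel_measurable PN"
proof (induction n)
  case (Suc n)
  have "(\<lambda>z. coeff (z 0) *v summand n (\<lambda>k. z (Suc k))) \<in> borel_measurable PN"
    by (intro coeff_mult_meas measurable_compose[OF shift_meas Suc] measurable_component_singleton) simp
  then show ?case by (simp only: summand.simps[abs_def])
qed (simp only: summand.simps[abs_def], rule borel_measurable_const)

lemma vol_meas [measurable]: "vol \<in> borel_measurable PN"
  unfolding vol_def[abs_def] by measurable

text \<open>Partial sums start from 0 and obey the volatility recursion with the level lowered by
  one. They allow moment bounds before anything is known about convergence.\<close>

definition psum :: "nat \<Rightarrow> (nat \<Rightarrow> real ^ 2) \<Rightarrow> real ^ 2" where "psum N z = (\<Sum>n<N. summand n z)"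

lemma psum_meas [measurable]: "psum N \<in> borel_measurable PN"
  unfolding psum_def[abs_def] by measurable

lemma psum_component: "psum N z $ i = (\<Sum>n<N. summand n z $ i)"
  by (simp add: psum_def)

lemma psum_nonneg: "0 \<le> psum N z $ 1" "0 \<le> psum N z $ 2"
  by (auto simp: psum_component intro!: sum_nonneg summand_nonneg)

lemma psum_Suc: "psum (Suc N) (past t w) = intercept + coeff (Z (t - 1) w) *v psum N (past (t - 1) w)"
proof -
  have "psum (Suc N) (past t w) = intercept + (\<Sum>n<N. coeff (past t w 0) *v summand n (past (t - 1) w))"
    unfolding psum_def by (subst sum.lessThan_Suc_shift) (simp add: past_shift)
  also have "(\<Sum>n<N. coeff (past t w 0) *v summand n (past (t - 1) w)) = coeff (Z (t - 1) w) *v psum N (past (t - 1) w)"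
    using linear_sum[OF matrix_vector_mul_linear[of "coeff (Z (t - 1) w)"], of "\<lambda>n. summand n (past (t - 1) w)" "{..<N}"]
    by (simp add: psum_def past_def)
  finally show ?thesis .
qed

lemma psum_Suc1: "psum (Suc N) (past t w) $ 1
    = a1 (Z (t - 1) w) * psum N (past (t - 1) w) $ 1 + (\<alpha>01 + a2 (Z (t - 1) w) * psum N (past (t - 1) w) $ 2)"
  and psum_Suc2: "psum (Suc N) (past t w) $ 2 = a4 (Z (t - 1) w) * psum N (past (t - 1) w) $ 2 + \<alpha>02"
  by (simp_all add: psum_Suc coeff_mult)

lemma Z_atomless: "prob {w \<in> space M. Z t w $ i = v} = 0"
  using Z_density[of t] density_component_atomless by blast

lemma a_atomless: "0 < a \<Longrightarrow> prob {w \<in> space M. a * (Z t w $ i)\<^sup>2 + b = v} = 0"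
  by (rule quadratic_atomless[OF _ Z_atomless]) simp

lemma moment_ident:
  fixes g :: "real ^ 2 \<Rightarrow> real"
  assumes [measurable]: "g \<in> borel_measurable borel"
  shows "(\<integral>w. g (Z t w) \<partial>M) = (\<integral>w. g (Z s w) \<partial>M)"
proof -
  have "(\<integral>w. g (Z t w) \<partial>M) = (\<integral>x. g x \<partial>distr M borel (Z t))" for t
    by (subst integral_distr) auto
  then show ?thesis using Z_ident[of t s] by simp
qed

lemma a1_moment:
  assumes "0 < s" "s < \<alpha>1"
  shows "integrable M (\<lambda>w. a1 (Z t w) powr s)" "(\<integral>w. a1 (Z t w) powr s \<partial>M) < 1"
  using moment_less_1[OF _ a_pos(1) A1_moment(1,2) a_atomless assms] pos by simp_all

lemma a4_moment:
  assumes "0 < s" "s < \<alpha>2"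
  shows "integrable M (\<lambda>w. a4 (Z t w) powr s)" "(\<integral>w. a4 (Z t w) powr s \<partial>M) < 1"
  using moment_less_1[OF _ a_pos(3) A4_moment(1,2) a_atomless assms] pos by simp_all

lemma powr_meas:
  "(\<lambda>x :: real ^ 2. (a * (x $ i)\<^sup>2 + b) powr s) \<in> borel_measurable borel"
  "(\<lambda>z. psum N z $ i powr s) \<in> borel_measurable PN"
  "(\<lambda>z. vol z $ i powr s) \<in> borel_measurable PN"
  by (intro powr_real_measurable borel_measurable_add borel_measurable_times borel_measurable_power
    borel_measurable_const borel_measurable_nth psum_meas vol_meas measurable_ident_sets refl)+

lemma past_component_meas:
  "(\<lambda>w. psum N (past t w) $ i) \<in> borel_measurable M" "(\<lambda>w. vol (past t w) $ i) \<in> borel_measurable M"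
  "(\<lambda>w. summand N (past t w) $ i) \<in> borel_measurable M"
  by (intro borel_measurable_nth measurable_compose[OF past_meas] psum_meas vol_meas summand_meas)+

lemma offset_meas:
  "(\<lambda>w. (\<alpha>01 + a2 (Z t w) * psum N (past t w) $ 2) powr s) \<in> borel_measurable M"
  "(\<lambda>w. (\<alpha>01 + a2 (Z t w) * vol (past t w) $ 2) powr s) \<in> borel_measurable M"
  by (intro powr_real_measurable borel_measurable_add borel_measurable_times borel_measurable_power
    borel_measurable_const borel_measurable_nth Z_meas past_component_meas)+

text \<open>Both \<open>a2\<close> and \<open>a4\<close> are affine with positive coefficients in
  the same square, so \<open>a2\<close> is at most a constant multiple of \<open>a4\<close>.\<close>

lemma a2_moment:
  assumes s: "0 < s" "s < \<alpha>2"
  shows "integrable M (\<lambda>w. a2 (Z t w) powr s)"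
proof -
  define k where "k = max (\<alpha>12 / \<alpha>22) (\<beta>12 / \<beta>22)"
  have k: "0 \<le> k" "\<alpha>12 \<le> k * \<alpha>22" "\<beta>12 \<le> k * \<beta>22"
  proof -
    have "\<alpha>12 / \<alpha>22 \<le> k" "\<beta>12 / \<beta>22 \<le> k" by (auto simp: k_def)
    then show "\<alpha>12 \<le> k * \<alpha>22" "\<beta>12 \<le> k * \<beta>22" using pos by (auto simp: field_simps)
    show "0 \<le> k" using pos by (simp add: k_def le_max_iff_disj)
  qed
  have le: "a2 x \<le> k * a4 x" for x
  proof -
    have "\<alpha>12 * (x $ 2)\<^sup>2 \<le> (k * \<alpha>22) * (x $ 2)\<^sup>2" by (rule mult_right_mono[OF k(2)]) simp
    then show ?thesis using k(3) by (simp add: algebra_simps)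
  qed
  show ?thesis
  proof (rule Bochner_Integration.integrable_bound)
    show "integrable M (\<lambda>w. k powr s * a4 (Z t w) powr s)"
      by (intro integrable_mult_right a4_moment s)
    show "AE w in M. norm (a2 (Z t w) powr s) \<le> norm (k powr s * a4 (Z t w) powr s)"
    proof (intro AE_I2)
      fix w
      have "a2 (Z t w) powr s \<le> (k * a4 (Z t w)) powr s"
        using s le less_imp_le[OF a_pos(2)] by (intro powr_mono2) auto
      then show "norm (a2 (Z t w) powr s) \<le> norm (k powr s * a4 (Z t w) powr s)"
        by (simp add: powr_mult)
    qed
  qed (rule measurable_compose[OF Z_meas powr_meas(1)])
qed

lemma psum2_moment:
  assumes s: "0 < s" "s < \<alpha>2"
  shows "\<exists>K. \<forall>N t. integrable M (\<lambda>w. psum N (past t w) $ 2 powr s) \<and> (\<integral>w. psum N (past t w) $ 2 powr s \<partial>M) \<le> K"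
proof (rule recursion_moment_bound[where A = "\<lambda>t w. a4 (Z (t - 1) w)" and G = "\<lambda>_ _ _. \<alpha>02"
      and q = "\<integral>w. a4 (Z 0 w) powr s \<partial>M" and K = "\<alpha>02 powr s" and F = "\<lambda>N t w. psum N (past t w) $ 2"])
  show "indep_var borel (\<lambda>w. a4 (Z (t - 1) w) powr s) borel (\<lambda>w. psum n (past (t - 1) w) $ 2 powr s)" for n t
    by (rule indep_Z_past[where g = "\<lambda>x. a4 x powr s" and h = "\<lambda>z. psum n z $ 2 powr s"]) (rule powr_meas)+
  show "(\<integral>w. a4 (Z (t - 1) w) powr s \<partial>M) \<le> (\<integral>w. a4 (Z 0 w) powr s \<partial>M)" for t
    by (rule eq_refl, rule moment_ident[where g = "\<lambda>x. a4 x powr s"]) (rule powr_meas)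
  show "psum 0 (past t w) $ 2 = 0" for t w by (simp add: psum_def)
qed (use s pos a_pos a4_moment[OF s] in \<open>simp_all add: psum_Suc2 psum_nonneg less_imp_le prob_space past_component_meas\<close>)

text \<open>The off-diagonal coefficient ties the first coordinate to the second. Its contribution
  acts as an additive term with bounded moments of every order below \<alpha>2, which covers the
  orders below \<alpha>1 that the first coordinate calls for.\<close>

lemma offset_moment_bound:
  assumes s: "0 < s" "s < \<alpha>2"
  shows "\<exists>K. \<forall>N t. integrable M (\<lambda>w. (\<alpha>01 + a2 (Z (t - 1) w) * psum N (past (t - 1) w) $ 2) powr s)
    \<and> (\<integral>w. (\<alpha>01 + a2 (Z (t - 1) w) * psum N (past (t - 1) w) $ 2) powr s \<partial>M) \<le> K"
proof -
  obtain K where K: "\<And>N t. integrable M (\<lambda>w. psum N (past t w) $ 2 powr s)"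
    "\<And>N t. (\<integral>w. psum N (past t w) $ 2 powr s \<partial>M) \<le> K"
    using psum2_moment[OF s] by blast
  define m where "m = (\<integral>w. a2 (Z 0 w) powr s \<partial>M)"
  have "integrable M (\<lambda>w. (\<alpha>01 + a2 (Z (t - 1) w) * psum N (past (t - 1) w) $ 2) powr s)
    \<and> (\<integral>w. (\<alpha>01 + a2 (Z (t - 1) w) * psum N (past (t - 1) w) $ 2) powr s \<partial>M) \<le> 2 powr s * (\<alpha>01 powr s + m * K)" for N t
  proof -
    have ind: "indep_var borel (\<lambda>w. a2 (Z (t - 1) w) powr s) borel (\<lambda>w. psum N (past (t - 1) w) $ 2 powr s)"
      by (rule indep_Z_past[where g = "\<lambda>x. a2 x powr s" and h = "\<lambda>z. psum N z $ 2 powr s"]) (rule powr_meas)+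
    have i: "integrable M (\<lambda>w. a2 (Z (t - 1) w) powr s * psum N (past (t - 1) w) $ 2 powr s)"
      by (rule indep_var_integrable[OF ind a2_moment[OF s] K(1)])
    have "(\<integral>w. a2 (Z (t - 1) w) powr s * psum N (past (t - 1) w) $ 2 powr s \<partial>M)
      = (\<integral>w. a2 (Z (t - 1) w) powr s \<partial>M) * (\<integral>w. psum N (past (t - 1) w) $ 2 powr s \<partial>M)"
      by (rule indep_var_lebesgue_integral[OF ind a2_moment[OF s] K(1)])
    also have "(\<integral>w. a2 (Z (t - 1) w) powr s \<partial>M) = m"
      unfolding m_def by (rule moment_ident[where g = "\<lambda>x. a2 x powr s"]) (rule powr_meas)
    also have "m * (\<integral>w. psum N (past (t - 1) w) $ 2 powr s \<partial>M) \<le> m * K"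
      by (rule mult_left_mono[OF K(2)]) (simp add: m_def)
    finally have le: "(\<integral>w. a2 (Z (t - 1) w) powr s * psum N (past (t - 1) w) $ 2 powr s \<partial>M) \<le> m * K" .
    let ?R = "\<lambda>w. 2 powr s * (\<alpha>01 powr s + a2 (Z (t - 1) w) powr s * psum N (past (t - 1) w) $ 2 powr s)"
    have iR: "integrable M ?R" using i by simp
    have ptw: "(\<alpha>01 + a2 (Z (t - 1) w) * psum N (past (t - 1) w) $ 2) powr s \<le> ?R w" for w
      using powr_add_le_2[of \<alpha>01 "a2 (Z (t - 1) w) * psum N (past (t - 1) w) $ 2" s] s pos
        psum_nonneg(2)[of N "past (t - 1) w"] less_imp_le[OF a_pos(2)[of "Z (t - 1) w"]]
      by (simp add: powr_mult)
    have i': "integrable M (\<lambda>w. (\<alpha>01 + a2 (Z (t - 1) w) * psum N (past (t - 1) w) $ 2) powr s)"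
      by (rule Bochner_Integration.integrable_bound[OF iR])
         (use ptw offset_meas in \<open>auto intro: order_trans[OF _ abs_ge_self]\<close>)
    have "(\<integral>w. (\<alpha>01 + a2 (Z (t - 1) w) * psum N (past (t - 1) w) $ 2) powr s \<partial>M) \<le> (\<integral>w. ?R w \<partial>M)"
      by (rule integral_mono[OF i' iR ptw])
    also have "\<dots> = 2 powr s * (\<alpha>01 powr s + (\<integral>w. a2 (Z (t - 1) w) powr s * psum N (past (t - 1) w) $ 2 powr s \<partial>M))"
      using i by (simp add: prob_space)
    also have "\<dots> \<le> 2 powr s * (\<alpha>01 powr s + m * K)"
      by (intro mult_left_mono add_left_mono le) simp
    finally show ?thesis using i' by simp
  qed
  then show ?thesis by blast
qed

lemma psum1_moment:
  assumes s: "0 < s" "s < \<alpha>1"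
  shows "\<exists>K. \<forall>N t. integrable M (\<lambda>w. psum N (past t w) $ 1 powr s) \<and> (\<integral>w. psum N (past t w) $ 1 powr s \<partial>M) \<le> K"
proof -
  have s2: "s < \<alpha>2" using s index by simp
  obtain K where K: "\<And>N t. integrable M (\<lambda>w. (\<alpha>01 + a2 (Z (t - 1) w) * psum N (past (t - 1) w) $ 2) powr s)"
    "\<And>N t. (\<integral>w. (\<alpha>01 + a2 (Z (t - 1) w) * psum N (past (t - 1) w) $ 2) powr s \<partial>M) \<le> K"
    using offset_moment_bound[OF s(1) s2] by blast
  show ?thesis
  proof (rule recursion_moment_bound[where A = "\<lambda>t w. a1 (Z (t - 1) w)"
        and G = "\<lambda>N t w. \<alpha>01 + a2 (Z (t - 1) w) * psum N (past (t - 1) w) $ 2"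
        and q = "\<integral>w. a1 (Z 0 w) powr s \<partial>M" and K = K and F = "\<lambda>N t w. psum N (past t w) $ 1"])
    show "indep_var borel (\<lambda>w. a1 (Z (t - 1) w) powr s) borel (\<lambda>w. psum n (past (t - 1) w) $ 1 powr s)" for n t
      by (rule indep_Z_past[where g = "\<lambda>x. a1 x powr s" and h = "\<lambda>z. psum n z $ 1 powr s"]) (rule powr_meas)+
    show "(\<integral>w. a1 (Z (t - 1) w) powr s \<partial>M) \<le> (\<integral>w. a1 (Z 0 w) powr s \<partial>M)" for t
      by (rule eq_refl, rule moment_ident[where g = "\<lambda>x. a1 x powr s"]) (rule powr_meas)
    show "0 \<le> \<alpha>01 + a2 (Z (t - 1) w) * psum n (past (t - 1) w) $ 2" for n t w
      using pos psum_nonneg(2)[of n "past (t - 1) w"] a_pos(2)[of "Z (t - 1) w"] by simp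
    show "psum 0 (past t w) $ 1 = 0" for t w by (simp add: psum_def)
  qed (use s pos a_pos a1_moment[OF s] K in \<open>simp_all add: psum_Suc1 psum_nonneg less_imp_le past_component_meas\<close>)
qed

lemma summand_component_series:
  assumes "0 < s" and K: "\<And>N t. integrable M (\<lambda>w. psum N (past t w) $ i powr s)"
    "\<And>N t. (\<integral>w. psum N (past t w) $ i powr s \<partial>M) \<le> K"
  shows "AE w in M. summable (\<lambda>n. summand n (past t w) $ i)"
    "integrable M (\<lambda>w. (\<Sum>n. summand n (past t w) $ i) powr s)"
proof -
  have nn: "0 \<le> summand n z $ i" for n z using exhaust_2[of i] summand_nonneg[of n z] by auto
  show "AE w in M. summable (\<lambda>n. summand n (past t w) $ i)"
    "integrable M (\<lambda>w. (\<Sum>n. summand n (past t w) $ i) powr s)"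
    by (rule series_moment[where u = "\<lambda>n w. summand n (past t w) $ i" and s = s and K = K];
        use K[of _ t] assms(1) nn in \<open>simp add: psum_component\<close>)+
qed

lemma summable_summand: "AE w in M. summable (\<lambda>n. summand n (past t w))"
proof -
  \<comment> \<open>One order below both indices serves for the convergence of the two component
    series.\<close>
  have s: "0 < \<alpha>1 / 2" "\<alpha>1 / 2 < \<alpha>1" "\<alpha>1 / 2 < \<alpha>2" using index by auto
  obtain K1 where "\<And>N t. integrable M (\<lambda>w. psum N (past t w) $ 1 powr (\<alpha>1 / 2))"
    "\<And>N t. (\<integral>w. psum N (past t w) $ 1 powr (\<alpha>1 / 2) \<partial>M) \<le> K1"
    using psum1_moment[OF s(1,2)] by blast
  note 1 = summand_component_series(1)[OF s(1) this, of t]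
  obtain K2 where "\<And>N t. integrable M (\<lambda>w. psum N (past t w) $ 2 powr (\<alpha>1 / 2))"
    "\<And>N t. (\<integral>w. psum N (past t w) $ 2 powr (\<alpha>1 / 2) \<partial>M) \<le> K2"
    using psum2_moment[OF s(1,3)] by blast
  note 2 = summand_component_series(1)[OF s(1) this, of t]
  from 1 2 show ?thesis
  proof eventually_elim
    case (elim w)
    show ?case
    proof (rule summable_comparison_test')
      show "summable (\<lambda>n. summand n (past t w) $ 1 + summand n (past t w) $ 2)"
        using elim by (intro summable_add)
      show "norm (summand n (past t w)) \<le> summand n (past t w) $ 1 + summand n (past t w) $ 2" for n
        using norm_le_l1_cart[of "summand n (past t w)"] by (simp add: sum_2 summand_nonneg)
    qed
  qed
qed

lemma vol_component:
  assumes "summable (\<lambda>n. summand n z)"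
  shows "vol z $ i = (\<Sum>n. summand n z $ i)"
  unfolding vol_def by (rule bounded_linear.suminf[OF bounded_linear_vec_nth assms])

lemma vol_moment:
  assumes "0 < s" and "\<And>N t. integrable M (\<lambda>w. psum N (past t w) $ i powr s)"
    "\<And>N t. (\<integral>w. psum N (past t w) $ i powr s \<partial>M) \<le> K"
  shows "integrable M (\<lambda>w. vol (past t w) $ i powr s)"
proof (rule integrable_cong_AE_imp[OF summand_component_series(2)[OF assms, of t]])
  show "AE w in M. (\<Sum>n. summand n (past t w) $ i) powr s = vol (past t w) $ i powr s"
    using summable_summand[of t] by eventually_elim (simp add: vol_component)
qed measurable

lemma vol_moment1:
  assumes "0 < s" "s < \<alpha>1"
  shows "integrable M (\<lambda>w. vol (past t w) $ 1 powr s)"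
proof -
  obtain K where "\<And>N t. integrable M (\<lambda>w. psum N (past t w) $ 1 powr s)"
    "\<And>N t. (\<integral>w. psum N (past t w) $ 1 powr s \<partial>M) \<le> K"
    using psum1_moment[OF assms] by blast
  then show ?thesis by (rule vol_moment[OF assms(1)])
qed

lemma vol_moment2:
  assumes "0 < s" "s < \<alpha>2"
  shows "integrable M (\<lambda>w. vol (past t w) $ 2 powr s)"
proof -
  obtain K where "\<And>N t. integrable M (\<lambda>w. psum N (past t w) $ 2 powr s)"
    "\<And>N t. (\<integral>w. psum N (past t w) $ 2 powr s \<partial>M) \<le> K"
    using psum2_moment[OF assms] by blast
  then show ?thesis by (rule vol_moment[OF assms(1)])
qed

lemma vol_recursion:
  "AE w in M. vol (past t w) = intercept + coeff (Z (t - 1) w) *v vol (past (t - 1) w)"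
  using summable_summand[of "t - 1"]
  by eventually_elim (simp add: vol_past summand_past causal_solution_recursion)

lemma vol_nonneg: "AE w in M. 0 \<le> vol (past t w) $ 1 \<and> 0 \<le> vol (past t w) $ 2"
  using summable_summand[of t]
proof eventually_elim
  case (elim w)
  have "summable (\<lambda>n. summand n (past t w) $ i)" for i
    by (rule bounded_linear.summable[OF bounded_linear_vec_nth elim])
  then show ?case using elim by (auto simp: vol_component intro!: suminf_nonneg summand_nonneg)
qed

text \<open>The additive term is constant and has moments of all orders, so p = \<alpha>2 + 1 is one
  of many admissible choices.\<close>

lemma component2: "garch_component M Z (\<lambda>x. x $ 2) \<alpha>22 \<beta>22 \<alpha>2 (\<alpha>2 + 1) (\<lambda>z. vol z $ 2) (\<lambda>_. \<alpha>02)"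
proof -
  interpret G: garch_innovations M Z "\<lambda>x. x $ 2" \<alpha>22 \<beta>22 by unfold_locales
  show ?thesis
  proof unfold_locales
    show "AE w in M. vol (past t w) $ 2 = G.A t w * vol (past (t - 1) w) $ 2 + \<alpha>02" for t
      using vol_recursion[of t] by eventually_elim (simp add: coeff_mult G.A_def)
    show "AE w in M. 0 < vol (past t w) $ 2" for t
      using vol_recursion[of t] vol_nonneg[of "t - 1"]
    proof eventually_elim
      case (elim w)
      then show ?case using pos a_pos(3)[of "Z (t - 1) w"] by (simp add: coeff_mult add_pos_nonneg)
    qed
  qed (use pos index Z_sym Z_atomless vol_moment2 A4_moment in \<open>auto simp: G.A_def\<close>)
qed

text \<open>The additive term contains the second volatility and so has moments of orders below
  \<alpha>2. The midpoint p lies strictly between \<alpha>1 and \<alpha>2, below the one for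
  integrability and above the other for the tail argument.\<close>

lemma component1: "garch_component M Z (\<lambda>x. x $ 1) \<alpha>11 \<beta>11 \<alpha>1 ((\<alpha>1 + \<alpha>2) / 2) (\<lambda>z. vol z $ 1)
  (\<lambda>z. \<alpha>01 + a2 (z 0) * vol (\<lambda>k. z (Suc k)) $ 2)"
proof -
  interpret G: garch_innovations M Z "\<lambda>x. x $ 1" \<alpha>11 \<beta>11 by unfold_locales
  have past0: "past t w 0 = Z (t - 1) w" for t w by (simp add: past_def)
  have [measurable]: "(\<lambda>z. vol (\<lambda>k. z (Suc k))) \<in> borel_measurable PN"
    by (rule measurable_compose[OF shift_meas vol_meas])
  show ?thesis
  proof unfold_locales
    show "AE w in M. vol (past t w) $ 1 = G.A t w * vol (past (t - 1) w) $ 1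
      + (\<alpha>01 + a2 (past t w 0) * vol (\<lambda>k. past t w (Suc k)) $ 2)" for t
      unfolding past_shift past0 using vol_recursion[of t] by eventually_elim (simp add: coeff_mult G.A_def)
    show "AE w in M. 0 < \<alpha>01 + a2 (past t w 0) * vol (\<lambda>k. past t w (Suc k)) $ 2" for t
      unfolding past_shift past0 using vol_nonneg[of "t - 1"]
    proof eventually_elim
      case (elim w)
      then show ?case using pos a_pos(2)[of "Z (t - 1) w"] by (simp add: add_pos_nonneg)
    qed
    show "AE w in M. 0 < vol (past t w) $ 1" for t
      using vol_recursion[of t] vol_nonneg[of "t - 1"]
    proof eventually_elim
      case (elim w)
      then show ?case using pos a_pos(1,2)[of "Z (t - 1) w"]
        by (simp add: coeff_mult add_pos_nonneg)
    qed
    show "integrable M (\<lambda>w. (\<alpha>01 + a2 (past t w 0) * vol (\<lambda>k. past t w (Suc k)) $ 2) powr ((\<alpha>1 + \<alpha>2) / 2))" for t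
      unfolding past_shift past0
    proof (rule Bochner_Integration.integrable_bound)
      define s where "s = (\<alpha>1 + \<alpha>2) / 2"
      have s: "0 < s" "s < \<alpha>2" using index by (auto simp: s_def)
      have "integrable M (\<lambda>w. a2 (Z (t - 1) w) powr s * vol (past (t - 1) w) $ 2 powr s)"
        by (rule integrable_Z_past[where g = "\<lambda>x. a2 x powr s" and h = "\<lambda>z. vol z $ 2 powr s"])
           (auto intro: a2_moment vol_moment2 s)
      then show "integrable M (\<lambda>w. 2 powr s * (\<alpha>01 powr s + a2 (Z (t - 1) w) powr s * vol (past (t - 1) w) $ 2 powr s))"
        by simp
      show "AE w in M. norm ((\<alpha>01 + a2 (Z (t - 1) w) * vol (past (t - 1) w) $ 2) powr ((\<alpha>1 + \<alpha>2) / 2))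
        \<le> norm (2 powr s * (\<alpha>01 powr s + a2 (Z (t - 1) w) powr s * vol (past (t - 1) w) $ 2 powr s))"
        using vol_nonneg[of "t - 1"]
      proof eventually_elim
        case (elim w)
        then show ?case
          using powr_add_le_2[of \<alpha>01 "a2 (Z (t - 1) w) * vol (past (t - 1) w) $ 2" s] s pos
            less_imp_le[OF a_pos(2)[of "Z (t - 1) w"]]
          by (simp add: powr_mult s_def[symmetric])
      qed
    qed measurable
  qed (use pos index Z_sym Z_atomless vol_moment1 A1_moment in \<open>auto simp: G.A_def\<close>)
qed

end

theorem proposition4p2:
  fixes M :: "'a measure"
    and Z :: "int \<Rightarrow> 'a \<Rightarrow> real ^ 2"
    and \<rho> \<alpha>01 \<alpha>02 \<alpha>11 \<alpha>12 \<alpha>22 \<beta>11 \<beta>12 \<beta>22 \<alpha>1 \<alpha>2 :: real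
    and A1 A2 A4 :: "int \<Rightarrow> 'a \<Rightarrow> real"
    and \<sigma>sq :: "int \<Rightarrow> 'a \<Rightarrow> real ^ 2"
    and X :: "2 \<Rightarrow> int \<Rightarrow> 'a \<Rightarrow> real"
    and idx :: "'h::finite \<Rightarrow> nat"
    and Y1 Y2 :: "'a \<Rightarrow> real ^ 'h"
  assumes "prob_space M"
    and Z_indep: "prob_space.indep_vars M (\<lambda>_. borel) Z UNIV"
    and Z_ident: "\<And>s t. distr M borel (Z s) = distr M borel (Z t)"
    and Z_square_integrable: "\<And>t i. integrable M (\<lambda>w. (Z t w $ i)\<^sup>2)"
    and Z_mean: "\<And>t i. (\<integral>w. Z t w $ i \<partial>M) = 0"
    and Z_cov: "\<And>t. covariance_matrix M (Z t) = vector [vector [1, \<rho>], vector [\<rho>, 1]]"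
    and Z_density: "\<And>t. \<exists>f. distributed M lborel (Z t) f"
    and Z_symmetric: "\<And>t. distr M borel (\<lambda>w. - Z t w) = distr M borel (Z t)"
    and pos: "\<alpha>01 > 0" "\<alpha>02 > 0" "\<alpha>11 > 0" "\<alpha>12 > 0" "\<alpha>22 > 0" "\<beta>11 > 0" "\<beta>12 > 0" "\<beta>22 > 0"
    and A1: "\<And>t w. A1 t w = \<alpha>11 * (Z (t - 1) w $ 1)\<^sup>2 + \<beta>11"
    and A2: "\<And>t w. A2 t w = \<alpha>12 * (Z (t - 1) w $ 2)\<^sup>2 + \<beta>12"
    and A4: "\<And>t w. A4 t w = \<alpha>22 * (Z (t - 1) w $ 2)\<^sup>2 + \<beta>22"
    and index: "0 < \<alpha>1" "\<alpha>1 < \<alpha>2"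
    and A1_moment: "\<And>t. integrable M (\<lambda>w. A1 t w powr \<alpha>1)"
      "\<And>t. (\<integral>w. A1 t w powr \<alpha>1 \<partial>M) = 1"
      "\<And>t. integrable M (\<lambda>w. A1 t w powr \<alpha>1 * max (ln (A1 t w)) 0)"
    and A4_moment: "\<And>t. integrable M (\<lambda>w. A4 t w powr \<alpha>2)"
      "\<And>t. (\<integral>w. A4 t w powr \<alpha>2 \<partial>M) = 1"
      "\<And>t. integrable M (\<lambda>w. A4 t w powr \<alpha>2 * max (ln (A4 t w)) 0)"
    and \<sigma>sq: "\<And>t w. \<sigma>sq t w =
      causal_solution (\<lambda>s. vector [vector [A1 s w, A2 s w], vector [0, A4 s w]])
        (vector [\<alpha>01, \<alpha>02]) t"
    and X: "\<And>i t w. X i t w = sqrt (\<sigma>sq t w $ i) * Z t w $ i"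
    and idx: "bij_betw idx (UNIV :: 'h set) {1..CARD('h)}"
    and Y1: "\<And>w. Y1 w =
      (\<chi> j. \<bar>Z (int (idx j)) w $ 1\<bar> * sqrt (\<Prod>k = 1..idx j. A1 (int k) w))"
    and Y2: "\<And>w. Y2 w =
      (\<chi> j. \<bar>Z (int (idx j)) w $ 2\<bar> * sqrt (\<Prod>k = 1..idx j. A4 (int k) w))"
  shows "mrv_with_spectral_measure M (\<lambda>w. \<chi> j. X 1 (int (idx j)) w) (2 * \<alpha>1)
           (random_sign_law (weighted_direction_law M Y1 (2 * \<alpha>1)))
       \<and> mrv_with_spectral_measure M (\<lambda>w. \<chi> j. X 2 (int (idx j)) w) (2 * \<alpha>2)
           (random_sign_law (weighted_direction_law M Y2 (2 * \<alpha>2)))"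
proof -
  interpret prob_space M by fact
  interpret bivariate_garch M Z \<alpha>01 \<alpha>02 \<alpha>11 \<alpha>12 \<alpha>22 \<beta>11 \<beta>12 \<beta>22 \<alpha>1 \<alpha>2
  proof unfold_locales
    show "integrable M (\<lambda>w. (\<alpha>11 * (Z t w $ 1)\<^sup>2 + \<beta>11) powr \<alpha>1)"
      "(\<integral>w. (\<alpha>11 * (Z t w $ 1)\<^sup>2 + \<beta>11) powr \<alpha>1 \<partial>M) = 1"
      "integrable M (\<lambda>w. (\<alpha>11 * (Z t w $ 1)\<^sup>2 + \<beta>11) powr \<alpha>1 * max (ln (\<alpha>11 * (Z t w $ 1)\<^sup>2 + \<beta>11)) 0)"
      "integrable M (\<lambda>w. (\<alpha>22 * (Z t w $ 2)\<^sup>2 + \<beta>22) powr \<alpha>2)"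
      "(\<integral>w. (\<alpha>22 * (Z t w $ 2)\<^sup>2 + \<beta>22) powr \<alpha>2 \<partial>M) = 1"
      "integrable M (\<lambda>w. (\<alpha>22 * (Z t w $ 2)\<^sup>2 + \<beta>22) powr \<alpha>2 * max (ln (\<alpha>22 * (Z t w $ 2)\<^sup>2 + \<beta>22)) 0)" for t
      \<comment> \<open>The coefficients at time t + 1 are driven by Z t, whence the shift.\<close>
      using A1_moment[of "t + 1"] A4_moment[of "t + 1"] by (simp_all add: A1 A4)
  qed (fact Z_indep Z_ident Z_symmetric Z_density pos index)+
  interpret C1: garch_component M Z "\<lambda>x. x $ 1" \<alpha>11 \<beta>11 \<alpha>1 "(\<alpha>1 + \<alpha>2) / 2" "\<lambda>z. vol z $ 1"
    "\<lambda>z. \<alpha>01 + a2 (z 0) * vol (\<lambda>k. z (Suc k)) $ 2"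
    by (rule component1)
  interpret C2: garch_component M Z "\<lambda>x. x $ 2" \<alpha>22 \<beta>22 \<alpha>2 "\<alpha>2 + 1" "\<lambda>z. vol z $ 2" "\<lambda>_. \<alpha>02"
    by (rule component2)
  have vol: "vol (past t w) = \<sigma>sq t w" for t w
    by (simp add: vol_past \<sigma>sq coeff_def A1 A2 A4)
  have inj: "inj idx" using idx by (rule bij_betw_imp_inj_on)
  have "mrv_with_spectral_measure M (\<lambda>w. \<chi> j. X 1 (int (idx j)) w) (2 * \<alpha>1)
           (random_sign_law (weighted_direction_law M Y1 (2 * \<alpha>1)))"
    by (rule C1.mrv_component[OF inj]) (simp_all add: X Y1 vol C1.A_def A1)
  moreover have "mrv_with_spectral_measure M (\<lambda>w. \<chi> j. X 2 (int (idx j)) w) (2 * \<alpha>2)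
           (random_sign_law (weighted_direction_law M Y2 (2 * \<alpha>2)))"
    by (rule C2.mrv_component[OF inj]) (simp_all add: X Y2 vol C2.A_def A4)
  ultimately show ?thesis by (rule conjI)
qed

end
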